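(* There exists $\lambda_0>0$ such that for every $\lambda\in(0,\lambda_0)$ the problem $$-\mathcal L_K u=\lambda h(x)|u|^{q-1}u+b(x)|u|^{r-1}u\ \text{ in }\Omega,\qquad u=0\ \text{ in }\mathbb R^n\setminus\Omega,$$ admits at least two non-negative nontrivial (weak) solutions.
   Context: Let $\Omega\subset\mathbb R^n$ be a bounded domain with Lipschitz boundary, $p\ge 2$, $\alpha\in(0,1)$, $n>p\alpha$, $0<q<p-1<r<p^*-1$ with $p^*=\frac{np}{n-p\alpha}$, and let $h,b\in C^\infty(\overline\Omega)$ be sign-changing (each takes both positive and negative values in $\Omega$). Let $K:\mathbb R^n\setminus\{0\}\to(0,\infty)$ be a measurable function satisfying: (i) $mK\in L^1(\mathbb R^n)$, where $m(x)=\min\{1,|x|^p\}$; (ii) there is $\theta>0$ such that $K(x)\ge\theta|x|^{-(n+p\alpha)}$ for all $x\ne 0$; (iii) $K(x)=K(-x)$ for all $x\neq 0$. The non-local operator is $$\mathcal L_K u(x)=2\int_{\mathbb R^n}|u(y)-u(x)|^{p-2}(u(y)-u(x))K(x-y)\,dy .$$ Let $Q=\mathbb R^{2n}\setminus((\mathbb R^n\setminus\Omega)\times(\mathbb R^n\setminus\Omega))$, let $X$ be the space of measurable $u:\mathbb R^n\to\mathbb R$ with $u|_\Omega\in L^p(\Omega)$ and $(u(x)-u(y))K(x-y)^{1/p}\in L^p(Q)$, and let $X_0=\{u\in X:u=0\text{ a.e. in }\mathbb R^n\setminus\Omega\}$. A (weak) solution of the problem is a function $u\in X_0$ such that for every $v\in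 X_0$ $$\int_Q|u(x)-u(y)|^{p-2}(u(x)-u(y))(v(x)-v(y))K(x-y)\,dx\,dy=\lambda\int_\Omega h|u|^{q-1}uv\,dx+\int_\Omega b|u|^{r-1}uv\,dx .$$ Non-negative means $u\ge 0$ a.e. in $\mathbb R^n$; nontrivial means $u$ is not a.e. zero. *)

theory Defs
  imports "HOL-Analysis.Analysis"
begin

definition lipschitz_boundary :: "'a::euclidean_space set \<Rightarrow> bool" where
  "lipschitz_boundary \<Omega> \<longleftrightarrow>
     (\<forall>z\<in>frontier \<Omega>. \<exists>\<rho>>0. \<exists>e L. \<exists>\<phi> :: 'a \<Rightarrow> real.
        norm e = 1 \<and> L-lipschitz_on {y. y \<bullet> e = 0} \<phi> \<and>
        \<Omega> \<inter> ball z \<rho> = {x \<in> ball z \<rho>. x \<bullet> e > \<phi> (x - (x \<bullet> e) *\<^sub>R e)})"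

definition bounded_lipschitz_domain :: "'a::euclidean_space set \<Rightarrow> bool" where
  "bounded_lipschitz_domain \<Omega> \<longleftrightarrow>
     open \<Omega> \<and> connected \<Omega> \<and> \<Omega> \<noteq> {} \<and> bounded \<Omega> \<and> lipschitz_boundary \<Omega>"

text \<open>The class \<open>C\<^sup>\<infinity>\<close> on the closure of an open set: every iterated partial derivative exists in
  \<open>\<Omega>\<close> and extends continuously to the closure. \<open>D [i\<^sub>1, \<dots>, i\<^sub>k]\<close> is the iterated partial
  derivative in the coordinate directions \<open>i\<^sub>k, \<dots>, i\<^sub>1\<close>, so extended. Values of \<open>f\<close> outside the
  closure are irrelevant.\<close>

definition smooth_on_closure :: "'a::euclidean_space set \<Rightarrow> ('a \<Rightarrow> real) \<Rightarrow> bool" where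
  "smooth_on_closure \<Omega> f \<longleftrightarrow>
     (\<exists>D :: 'a list \<Rightarrow> 'a \<Rightarrow> real.
        (\<forall>x\<in>closure \<Omega>. D [] x = f x) \<and>
        (\<forall>is. set is \<subseteq> Basis \<longrightarrow>
           continuous_on (closure \<Omega>) (D is) \<and>
           (\<forall>i\<in>Basis. \<forall>x\<in>\<Omega>.
              ((\<lambda>t. D is (x + t *\<^sub>R i)) has_real_derivative D (i # is) x) (at 0))))"

definition sign_changing_on :: "'a set \<Rightarrow> ('a \<Rightarrow> real) \<Rightarrow> bool" where
  "sign_changing_on \<Omega> f \<longleftrightarrow> (\<exists>x\<in>\<Omega>. f x > 0) \<and> (\<exists>x\<in>\<Omega>. f x < 0)"

definition critical_exponent :: "real \<Rightarrow> real \<Rightarrow> real \<Rightarrow> real" where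
  "critical_exponent n p \<alpha> = n * p / (n - p * \<alpha>)"

text \<open>Elements of \<open>L\<^sup>p(A)\<close> and of the spaces below are represented by functions, not by classes
  modulo a.e. equality.\<close>

definition in_Lp :: "real \<Rightarrow> 'a::euclidean_space set \<Rightarrow> ('a \<Rightarrow> real) \<Rightarrow> bool" where
  "in_Lp p A f \<longleftrightarrow>
     f \<in> borel_measurable (lebesgue_on A) \<and> integrable (lebesgue_on A) (\<lambda>x. \<bar>f x\<bar> powr p)"

definition Q_set :: "'a set \<Rightarrow> ('a \<times> 'a) set" where
  "Q_set \<Omega> = UNIV - (UNIV - \<Omega>) \<times> (UNIV - \<Omega>)"

definition space_X :: "real \<Rightarrow> ('a::euclidean_space \<Rightarrow> real) \<Rightarrow> 'a set \<Rightarrow> ('a \<Rightarrow> real) set" where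
  "space_X p K \<Omega> =
     {u. u \<in> borel_measurable lebesgue \<and> in_Lp p \<Omega> u \<and>
         in_Lp p (Q_set \<Omega>) (\<lambda>(x, y). (u x - u y) * K (x - y) powr (1 / p))}"

definition space_X0 :: "real \<Rightarrow> ('a::euclidean_space \<Rightarrow> real) \<Rightarrow> 'a set \<Rightarrow> ('a \<Rightarrow> real) set" where
  "space_X0 p K \<Omega> = {u \<in> space_X p K \<Omega>. AE x in lebesgue. x \<notin> \<Omega> \<longrightarrow> u x = 0}"

text \<open>Weak solutions of \<open>-\<L>\<^sub>K u = \<lambda> h |u|\<^bsup>q-1\<^esup> u + b |u|\<^bsup>r-1\<^esup> u\<close> in \<open>\<Omega>\<close>, \<open>u = 0\<close> outside \<open>\<Omega>\<close>, where
  \<open>\<L>\<^sub>K u(x) = 2 \<integral> |u(y) - u(x)|\<^bsup>p-2\<^esup> (u(y) - u(x)) K(x - y) dy\<close>. The library integral of a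
  non-integrable function is 0, so the existence of the integrals is stated explicitly. Since
  \<open>0 powr a = 0\<close>, the nonlinearities vanish where \<open>u\<close> does, also if \<open>q < 1\<close>; likewise the
  integrand on the left vanishes where \<open>u(x) = u(y)\<close>, also if \<open>p = 2\<close>.\<close>

definition weak_solution ::
  "'a::euclidean_space set \<Rightarrow> real \<Rightarrow> ('a \<Rightarrow> real) \<Rightarrow> real \<Rightarrow> real \<Rightarrow> ('a \<Rightarrow> real) \<Rightarrow> ('a \<Rightarrow> real) \<Rightarrow>
   real \<Rightarrow> ('a \<Rightarrow> real) \<Rightarrow> bool" where
  "weak_solution \<Omega> p K q r h b lam u \<longleftrightarrow>
     u \<in> space_X0 p K \<Omega> \<and>
     (\<forall>v \<in> space_X0 p K \<Omega>.
        let lhs = (\<lambda>(x, y). \<bar>u x - u y\<bar> powr (p - 2) * (u x - u y) * (v x - v y) * K (x - y));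
            fh = (\<lambda>x. h x * \<bar>u x\<bar> powr (q - 1) * u x * v x);
            fb = (\<lambda>x. b x * \<bar>u x\<bar> powr (r - 1) * u x * v x)
        in integrable (lebesgue_on (Q_set \<Omega>)) lhs \<and>
           integrable (lebesgue_on \<Omega>) fh \<and> integrable (lebesgue_on \<Omega>) fb \<and>
           integral\<^sup>L (lebesgue_on (Q_set \<Omega>)) lhs =
             lam * integral\<^sup>L (lebesgue_on \<Omega>) fh + integral\<^sup>L (lebesgue_on \<Omega>) fb)"

definition nonneg_nontrivial :: "('a::euclidean_space \<Rightarrow> real) \<Rightarrow> bool" where
  "nonneg_nontrivial u \<longleftrightarrow> (AE x in lebesgue. u x \<ge> 0) \<and> \<not> (AE x in lebesgue. u x = 0)"

end

theory Submission
  imports Defs "HOL-Complex_Analysis.Great_Picard"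
begin

text \<open>
  Let \<open>E u\<close> be the energy integral over \<open>Q\<close>, \<open>H u = \<integral> h |u|\<^bsup>q+1\<^esup>\<close>, \<open>B u = \<integral> b |u|\<^bsup>r+1\<^esup>\<close> and
  \<open>J u = E u / p - \<lambda> H u / (q+1) - B u / (r+1)\<close>. Since \<open>q + 1 < p < r + 1\<close>, for small \<open>\<lambda>\<close> the functional \<open>J\<close> is
  bounded below by a positive constant on some sphere \<open>E u = \<rho>\<^sup>p\<close>, but takes negative values inside. The
  first solution minimises \<open>J\<close> in the ball. The second one minimises \<open>max\<^sub>t J (t u)\<close> over all \<open>u\<close> with
  \<open>B u > 0\<close>; it is critical because the maximum point on each ray is unique, so that under a perturbation
  of \<open>u\<close> it moves continuously and, by homogeneity, only the derivative of \<open>J\<close> at \<open>u\<close> enters. The two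
  values of \<open>J\<close> have opposite signs. Passing to \<open>|u|\<close> does not increase the energy, whence non-negativity.

  Minimisers exist because energy bounded sequences have subsequences that converge almost everywhere and
  have bounded integrals \<open>\<integral>|u|\<^sup>s\<close> for \<open>s = p\<^sup>*\<close>, both by the lower bound on \<open>K\<close>. Hence \<open>H\<close> and \<open>B\<close> converge, while
  \<open>E\<close> is lower semicontinuous by Fatou's lemma.\<close>

section \<open>Integrals of powers\<close>

text \<open>The obstacle is loss of energy in the limit: \<open>E\<close> is only lower
  semicontinuous, so the limit u of a minimising sequence U_k need not satisfy the constraint that
  the sequence satisfies. In the ball this does no harm, because the ball is a sublevel set of
  \<open>E\<close>, and the sphere, where J is at least d > 0, cannot carry a negative minimum. For
  the second solution the limit is pushed back to the maximum point of its own ray. For each fixed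
  t, J (t u) is at most the limit of J (t U_k), hence at most the limit of J (U_k), so rescaling
  does not raise the level; convergence of \<open>B\<close> keeps B u > 0, which makes the rescaling
  possible. \<open>H\<close> has no sign, so t -> J (t u) can have a critical point besides its
  maximum. Uniqueness is therefore proved for global maxima, whose value is at least d because every
  ray with B u > 0 crosses the sphere. That positive value is what drives the uniqueness
  argument.\<close>

lemma abs_powr_has_derivative:
  fixes x a :: real
  assumes "a > 1"
  shows "((\<lambda>x. \<bar>x\<bar> powr a) has_real_derivative a * (\<bar>x\<bar> powr (a - 2) * x)) (at x)"
proof (cases "x = 0")
  case True
  \<comment> \<open>At 0 the difference quotient is at most |h|^(a-1) in modulus, and the claimed
    value is 0 by the convention \<open>0 powr _ = 0\<close>, also for a < 2.\<close>
  have "((\<lambda>h. \<bar>h\<bar> powr (a - 1)) \<longlongrightarrow> \<bar>0\<bar> powr (a - 1)) (at (0::real))"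
    using assms by (intro tendsto_powr' tendsto_intros) auto
  then have "((\<lambda>h. \<bar>h\<bar> powr (a - 1)) \<longlongrightarrow> 0) (at (0::real))" by simp
  moreover have "\<bar>\<bar>h\<bar> powr a / h\<bar> \<le> \<bar>h\<bar> powr (a - 1)" for h :: real
    by (cases "h = 0") (auto simp: powr_diff)
  ultimately have "((\<lambda>h. \<bar>h\<bar> powr a / h) \<longlongrightarrow> 0) (at (0::real))"
    by (intro Lim_null_comparison[of "\<lambda>h. \<bar>h\<bar> powr a / h" "\<lambda>h. \<bar>h\<bar> powr (a - 1)"]) auto
  then show ?thesis using True assms by (simp add: DERIV_def)
next
  case False
  have *: "\<bar>x\<bar> powr (a - 1) * sgn x = \<bar>x\<bar> powr (a - 2) * x"
  proof -
    have "\<bar>x\<bar> powr (a - 1) = \<bar>x\<bar> powr (a - 2) * \<bar>x\<bar>"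
      using False powr_add[of "\<bar>x\<bar>" "a - 2" 1] by simp
    then show ?thesis by (simp add: mult.assoc abs_mult_sgn)
  qed
  have "((\<lambda>x. \<bar>x\<bar>) has_real_derivative sgn x) (at x)"
  proof (cases "x > 0")
    case True
    have "eventually (\<lambda>y. \<bar>y\<bar> = y) (nhds x)"
      using eventually_nhds_in_open[of "{0<..}" x] True by (auto elim: eventually_mono)
    then show ?thesis using True by (simp add: DERIV_cong_ev[OF refl _ refl])
  next
    case neg: False
    have "eventually (\<lambda>y. \<bar>y\<bar> = - y) (nhds x)"
      using eventually_nhds_in_open[of "{..<0}" x] neg False by (auto elim!: eventually_mono)
    moreover have "((\<lambda>y. - y) has_real_derivative - 1) (at x)" by (auto intro!: derivative_eq_intros)
    ultimately show ?thesis using neg False by (simp add: DERIV_cong_ev[OF refl _ refl])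
  qed
  moreover have "((\<lambda>y. y powr a) has_real_derivative a * \<bar>x\<bar> powr (a - 1)) (at \<bar>x\<bar>)"
    using False by (intro has_real_derivative_powr) auto
  ultimately have "((\<lambda>x. \<bar>x\<bar> powr a) has_real_derivative (a * \<bar>x\<bar> powr (a - 1)) * sgn x) (at x)"
    by (rule DERIV_chain2[rotated])
  then show ?thesis using * by (simp add: mult.assoc)
qed

lemma powr_add_le:
  fixes x y a :: real
  assumes "0 \<le> x" "0 \<le> y" "0 \<le> a"
  shows "(x + y) powr a \<le> 2 powr a * (x powr a + y powr a)"
proof -
  have "(x + y) powr a \<le> (2 * max x y) powr a" using assms by (intro powr_mono2) auto
  also have "\<dots> = 2 powr a * max x y powr a" using assms by (simp add: powr_mult)
  also have "max x y powr a \<le> x powr a + y powr a" by (simp add: max_def)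
  finally show ?thesis by simp
qed

text \<open>Mean value inequality in t. Linearity in |t| is the point: after division by t there
  remains a majorant independent of t, as dominated convergence demands. \<open>K\<close> is
  arbitrary so that a whole sequence of increments is covered and not only its tail.\<close>

lemma abs_powr_increment_le:
  fixes f g t a K :: real
  assumes a: "a > 1" and t: "\<bar>t\<bar> \<le> K" and K: "1 \<le> K"
  shows "\<bar>\<bar>f + t * g\<bar> powr a - \<bar>f\<bar> powr a\<bar> \<le> \<bar>t\<bar> * (a * (2 * K) powr a * (\<bar>f\<bar> powr a + \<bar>g\<bar> powr a))"
proof -
  define \<phi> where "\<phi> = (\<lambda>t. \<bar>f + t * g\<bar> powr a)"
  define \<phi>' where "\<phi>' = (\<lambda>t. a * (\<bar>f + t * g\<bar> powr (a - 2) * (f + t * g)) * g)"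
  have deriv: "(\<phi> has_real_derivative \<phi>' t) (at t)" for t
    unfolding \<phi>_def \<phi>'_def
    by (rule DERIV_chain2[OF abs_powr_has_derivative[OF a]]) (auto intro!: derivative_eq_intros)
  have bound: "\<bar>\<phi>' \<tau>\<bar> \<le> a * (2 * K) powr a * (\<bar>f\<bar> powr a + \<bar>g\<bar> powr a)" if "\<bar>\<tau>\<bar> \<le> K" for \<tau>
  proof -
    define z where "z = f + \<tau> * g"
    have "\<bar>\<tau> * g\<bar> \<le> K * \<bar>g\<bar>" using that by (simp add: abs_mult mult_right_mono)
    moreover have "\<bar>f\<bar> \<le> K * \<bar>f\<bar>" "\<bar>g\<bar> \<le> K * \<bar>g\<bar>" using K mult_right_mono[of 1 K] by force+
    ultimately have z: "\<bar>z\<bar> \<le> K * (\<bar>f\<bar> + \<bar>g\<bar>)" "\<bar>g\<bar> \<le> K * (\<bar>f\<bar> + \<bar>g\<bar>)"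
      unfolding z_def by (simp_all add: distrib_left)
    \<comment> \<open>Both |z| and |g| are at most m, so |z|^(a-1) |g| is at most m^a, a crude form
      of Young's inequality.\<close>
    define m where "m = K * (\<bar>f\<bar> + \<bar>g\<bar>)"
    have m: "m \<ge> 0" using K by (simp add: m_def)
    have "\<bar>\<bar>z\<bar> powr (a - 2) * z\<bar> = \<bar>z\<bar> powr (a - 1)"
      using powr_add[of "\<bar>z\<bar>" "a - 2" 1] by (cases "z = 0") (auto simp: abs_mult)
    then have "\<bar>\<phi>' \<tau>\<bar> = a * (\<bar>z\<bar> powr (a - 1) * \<bar>g\<bar>)"
      using a by (simp add: \<phi>'_def z_def abs_mult)
    also have "\<bar>z\<bar> powr (a - 1) * \<bar>g\<bar> \<le> m powr (a - 1) * m"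
      using z a by (intro mult_mono powr_mono2) (auto simp: m_def)
    also have "\<dots> = m powr a" using m powr_add[of m "a - 1" 1] by (cases "m = 0") auto
    also have "\<dots> = K powr a * (\<bar>f\<bar> + \<bar>g\<bar>) powr a" using K by (simp add: m_def powr_mult)
    also have "\<dots> \<le> K powr a * (2 powr a * (\<bar>f\<bar> powr a + \<bar>g\<bar> powr a))"
      using a by (intro mult_left_mono powr_add_le) auto
    finally show ?thesis using a K by (simp add: powr_mult mult_ac)
  qed
  have "norm (\<phi> t - \<phi> 0) \<le> a * (2 * K) powr a * (\<bar>f\<bar> powr a + \<bar>g\<bar> powr a) * norm (t - 0)"
  proof (rule field_differentiable_bound)
    show "convex {-K..K}" by simp
    show "(\<phi> has_field_derivative \<phi>' z) (at z within {-K..K})" for z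
      using deriv by (rule has_field_derivative_at_within)
    show "norm (\<phi>' z) \<le> a * (2 * K) powr a * (\<bar>f\<bar> powr a + \<bar>g\<bar> powr a)" if "z \<in> {-K..K}" for z
      using bound[of z] that by auto
  qed (use t K in auto)
  then show ?thesis by (simp add: \<phi>_def mult_ac)
qed

lemma integrable_powr_combination:
  fixes f g w :: "'x \<Rightarrow> real"
  assumes a: "a > 0"
    and [measurable]: "f \<in> borel_measurable M" "g \<in> borel_measurable M" "w \<in> borel_measurable M"
    and int: "integrable M (\<lambda>x. w x * \<bar>f x\<bar> powr a)" "integrable M (\<lambda>x. w x * \<bar>g x\<bar> powr a)"
  shows "integrable M (\<lambda>x. w x * \<bar>f x + t * g x\<bar> powr a)"
proof (rule Bochner_Integration.integrable_bound)
  show "integrable M (\<lambda>x. 2 powr a * (\<bar>w x * \<bar>f x\<bar> powr a\<bar> + \<bar>t\<bar> powr a * \<bar>w x * \<bar>g x\<bar> powr a\<bar>))"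
    using int by (intro integrable_mult_right Bochner_Integration.integrable_add integrable_abs)
  show "AE x in M. norm (w x * \<bar>f x + t * g x\<bar> powr a)
      \<le> norm (2 powr a * (\<bar>w x * \<bar>f x\<bar> powr a\<bar> + \<bar>t\<bar> powr a * \<bar>w x * \<bar>g x\<bar> powr a\<bar>))"
  proof (rule AE_I2)
    fix x
    have "\<bar>f x + t * g x\<bar> powr a \<le> (\<bar>f x\<bar> + \<bar>t\<bar> * \<bar>g x\<bar>) powr a"
      using a by (intro powr_mono2) (auto simp: abs_mult[symmetric])
    also have "\<dots> \<le> 2 powr a * (\<bar>f x\<bar> powr a + (\<bar>t\<bar> * \<bar>g x\<bar>) powr a)"
      using a by (intro powr_add_le) auto
    finally have "\<bar>w x\<bar> * \<bar>f x + t * g x\<bar> powr a \<le> \<bar>w x\<bar> * (2 powr a * (\<bar>f x\<bar> powr a + (\<bar>t\<bar> * \<bar>g x\<bar>) powr a))"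
      by (intro mult_left_mono) auto
    also have "\<dots> = 2 powr a * (\<bar>w x * \<bar>f x\<bar> powr a\<bar> + \<bar>t\<bar> powr a * \<bar>w x * \<bar>g x\<bar> powr a\<bar>)"
      by (simp add: abs_mult powr_mult algebra_simps)
    finally show "norm (w x * \<bar>f x + t * g x\<bar> powr a)
      \<le> norm (2 powr a * (\<bar>w x * \<bar>f x\<bar> powr a\<bar> + \<bar>t\<bar> powr a * \<bar>w x * \<bar>g x\<bar> powr a\<bar>))"
      by (simp add: abs_mult)
  qed
qed measurable

text \<open>Differentiation under the integral, by dominated convergence along sequences. The weight
  may be signed, so one lemma serves the energy (weight 1) and both zero order terms. The first
  conclusion later supplies the integrability that \<open>weak_solution\<close> demands.\<close>

lemma weighted_powr_integral_derivative:
  fixes f g w :: "'x \<Rightarrow> real"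
  assumes a: "a > 1"
    and [measurable]: "f \<in> borel_measurable M" "g \<in> borel_measurable M" "w \<in> borel_measurable M"
    and int: "integrable M (\<lambda>x. w x * \<bar>f x\<bar> powr a)" "integrable M (\<lambda>x. w x * \<bar>g x\<bar> powr a)"
  shows "integrable M (\<lambda>x. w x * (\<bar>f x\<bar> powr (a - 2) * f x * g x))"
    and "((\<lambda>t. \<integral>x. w x * \<bar>f x + t * g x\<bar> powr a \<partial>M) has_real_derivative
      a * (\<integral>x. w x * (\<bar>f x\<bar> powr (a - 2) * f x * g x) \<partial>M)) (at 0)"
proof -
  define D where "D = (\<lambda>x. w x * (a * (\<bar>f x\<bar> powr (a - 2) * f x * g x)))"
  define dom where "dom K x = a * (2 * K) powr a * (\<bar>w x * \<bar>f x\<bar> powr a\<bar> + \<bar>w x * \<bar>g x\<bar> powr a\<bar>)" for K :: real and x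
  define q where "q t x = (w x * \<bar>f x + t * g x\<bar> powr a - w x * \<bar>f x\<bar> powr a) / t" for t x
  have qt: "(\<lambda>i. q (X i) x) \<longlonglongrightarrow> D x" if X: "\<And>i. X i \<noteq> 0" "X \<longlonglongrightarrow> 0" for X x
  proof -
    have "((\<lambda>t. \<bar>f x + t * g x\<bar> powr a) has_real_derivative (a * (\<bar>f x + 0 * g x\<bar> powr (a - 2) * (f x + 0 * g x)) * g x)) (at 0)"
      by (rule DERIV_chain2[OF abs_powr_has_derivative[OF a]]) (auto intro!: derivative_eq_intros)
    then have "((\<lambda>t. w x * \<bar>f x + t * g x\<bar> powr a) has_real_derivative (w x * (a * (\<bar>f x + 0 * g x\<bar> powr (a - 2) * (f x + 0 * g x)) * g x))) (at 0)"
      by (rule DERIV_cmult)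
    then have "((\<lambda>t. q t x) \<longlongrightarrow> D x) (at 0)"
      by (simp add: DERIV_def q_def D_def mult_ac)
    moreover have "filterlim X (at 0) sequentially" using X by (auto simp: filterlim_at)
    ultimately show ?thesis by (rule filterlim_compose)
  qed
  have qb: "\<bar>q t x\<bar> \<le> dom K x" if "t \<noteq> 0" "\<bar>t\<bar> \<le> K" "1 \<le> K" for t K x
  proof -
    have "\<bar>q t x\<bar> = \<bar>w x\<bar> * \<bar>\<bar>f x + t * g x\<bar> powr a - \<bar>f x\<bar> powr a\<bar> / \<bar>t\<bar>"
      by (simp add: q_def abs_mult abs_divide flip: right_diff_distrib)
    also have "\<dots> \<le> \<bar>w x\<bar> * (\<bar>t\<bar> * (a * (2 * K) powr a * (\<bar>f x\<bar> powr a + \<bar>g x\<bar> powr a))) / \<bar>t\<bar>"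
      using that by (intro divide_right_mono mult_left_mono abs_powr_increment_le a) auto
    also have "\<dots> = \<bar>w x\<bar> * (a * (2 * K) powr a * (\<bar>f x\<bar> powr a + \<bar>g x\<bar> powr a))"
      using that by simp
    also have "\<dots> = dom K x" by (simp add: dom_def abs_mult algebra_simps)
    finally show ?thesis .
  qed
  have dom_int: "integrable M (dom K)" for K
    unfolding dom_def using int by (intro integrable_mult_right Bochner_Integration.integrable_add integrable_abs)
  have [measurable]: "D \<in> borel_measurable M" "q t \<in> borel_measurable M" for t
    unfolding D_def q_def by measurable
  have main: "integrable M D \<and> (\<lambda>i. integral\<^sup>L M (q (X i))) \<longlonglongrightarrow> integral\<^sup>L M D"
    if X: "\<And>i. X i \<noteq> 0" "X \<longlonglongrightarrow> 0" for X
  proof -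
    \<comment> \<open>A bound on all of \<open>X\<close>, enlarged to at least 1 as
      \<open>abs_powr_increment_le\<close> requires.\<close>
    obtain K0 where "\<And>i. \<bar>X i\<bar> \<le> K0"
      using convergent_imp_Bseq[OF convergentI[OF X(2)]] by (auto simp: Bseq_def)
    then have K: "\<And>i. \<bar>X i\<bar> \<le> max 1 K0" by (meson max.coboundedI2)
    have bd: "AE x in M. norm (q (X i) x) \<le> dom (max 1 K0) x" for i
      using qb[OF X(1) K] by auto
    have cv: "AE x in M. (\<lambda>i. q (X i) x) \<longlonglongrightarrow> D x" using qt[OF X] by auto
    show ?thesis
      using integrable_dominated_convergence[OF _ _ dom_int cv bd]
        integral_dominated_convergence[OF _ _ dom_int cv bd] by simp
  qed
  have seq: "(\<lambda>i. 1 / real (Suc i)) \<longlonglongrightarrow> 0" by (rule LIMSEQ_Suc[OF lim_1_over_n])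
  have Dint: "integrable M D" using main[OF _ seq] by simp
  have D_eq: "D = (\<lambda>x. a * (w x * (\<bar>f x\<bar> powr (a - 2) * f x * g x)))" by (simp add: D_def mult_ac)
  show "integrable M (\<lambda>x. w x * (\<bar>f x\<bar> powr (a - 2) * f x * g x))"
    using Dint a unfolding D_eq by simp
  have I: "integrable M (\<lambda>x. w x * \<bar>f x + t * g x\<bar> powr a)" for t
    using a int by (intro integrable_powr_combination) auto
  have "((\<lambda>t. ((\<integral>x. w x * \<bar>f x + t * g x\<bar> powr a \<partial>M) - (\<integral>x. w x * \<bar>f x\<bar> powr a \<partial>M)) / t)
      \<longlongrightarrow> integral\<^sup>L M D) (at 0)"
    unfolding tendsto_at_iff_sequentially
  proof (intro allI impI)
    fix X :: "nat \<Rightarrow> real" assume X: "\<forall>i. X i \<in> UNIV - {0}" "X \<longlonglongrightarrow> 0"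
    have "((\<integral>x. w x * \<bar>f x + t * g x\<bar> powr a \<partial>M) - (\<integral>x. w x * \<bar>f x\<bar> powr a \<partial>M)) / t = integral\<^sup>L M (q t)" for t
      unfolding q_def using I int(1) by simp
    then show "((\<lambda>t. ((\<integral>x. w x * \<bar>f x + t * g x\<bar> powr a \<partial>M) - (\<integral>x. w x * \<bar>f x\<bar> powr a \<partial>M)) / t) \<circ> X)
      \<longlonglongrightarrow> integral\<^sup>L M D"
      using main[of X] X by (simp add: o_def)
  qed
  then show "((\<lambda>t. \<integral>x. w x * \<bar>f x + t * g x\<bar> powr a \<partial>M) has_real_derivative
      a * (\<integral>x. w x * (\<bar>f x\<bar> powr (a - 2) * f x * g x) \<partial>M)) (at 0)"
    unfolding DERIV_def by (simp add: D_eq)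
qed

text \<open>Above L the gap in the exponents gives x^s \<le> L^(s-S) x^S. The factor tends to 0 as L
  grows, so the error of truncation is uniform on sets bounded in the higher power.\<close>

lemma powr_tail_le:
  fixes x L s S :: real
  assumes "0 < L" "0 < s" "s < S" "0 \<le> x"
  shows "\<bar>x powr s - min x L powr s\<bar> \<le> L powr (s - S) * x powr S"
proof (cases "x \<le> L")
  case False
  then have "x powr s = x powr S * x powr (s - S)" by (simp flip: powr_add)
  also have "\<dots> \<le> x powr S * L powr (s - S)"
    using False assms by (intro mult_left_mono powr_mono2') auto
  finally have "x powr s \<le> L powr (s - S) * x powr S" by (simp add: mult.commute)
  moreover have "min x L powr s \<le> x powr s" using assms by (intro powr_mono2) auto
  moreover have "0 \<le> min x L powr s" by simp
  ultimately show ?thesis by linarith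
qed (use assms in auto)

lemma powr_le_one_add_powr:
  fixes x s S :: real
  assumes "0 < s" "s \<le> S" "0 \<le> x"
  shows "x powr s \<le> 1 + x powr S"
proof (cases "x \<le> 1")
  case True
  then have "x powr s \<le> 1 powr s" using assms by (intro powr_mono2) auto
  also have "\<dots> \<le> 1 + x powr S" by simp
  finally show ?thesis .
next
  case False
  then have "x powr s \<le> x powr S" using assms by (intro powr_mono) auto
  then show ?thesis by linarith
qed

text \<open>A crude substitute for Hoelder's inequality, from t^s \<le> 1 + t^S. The bound is not
  homogeneous in u; \<open>homogeneous_bounds\<close> restores homogeneity by scaling.\<close>

lemma (in finite_measure) integrable_lower_powr:
  fixes u :: "'a \<Rightarrow> real"
  assumes [measurable]: "u \<in> borel_measurable M" "w \<in> borel_measurable M"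
    and s: "0 < s" "s \<le> S" and int: "integrable M (\<lambda>x. \<bar>u x\<bar> powr S)"
    and w: "\<And>x. x \<in> space M \<Longrightarrow> \<bar>w x\<bar> \<le> W"
  shows "integrable M (\<lambda>x. w x * \<bar>u x\<bar> powr s)"
    and "\<bar>\<integral>x. w x * \<bar>u x\<bar> powr s \<partial>M\<bar> \<le> W * (measure M (space M) + (\<integral>x. \<bar>u x\<bar> powr S \<partial>M))"
proof -
  have dom: "integrable M (\<lambda>x. W * (1 + \<bar>u x\<bar> powr S))"
    using int by simp
  have le: "\<bar>w x * \<bar>u x\<bar> powr s\<bar> \<le> W * (1 + \<bar>u x\<bar> powr S)" if "x \<in> space M" for x
    unfolding abs_mult using w[OF that] powr_le_one_add_powr[OF s, of "\<bar>u x\<bar>"] by (intro mult_mono) auto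
  show I: "integrable M (\<lambda>x. w x * \<bar>u x\<bar> powr s)"
  proof (rule Bochner_Integration.integrable_bound[OF dom])
    show "AE x in M. norm (w x * \<bar>u x\<bar> powr s) \<le> norm (W * (1 + \<bar>u x\<bar> powr S))"
      unfolding real_norm_def by (intro AE_I2 order_trans[OF le abs_ge_self])
  qed measurable
  have "\<bar>\<integral>x. w x * \<bar>u x\<bar> powr s \<partial>M\<bar> \<le> (\<integral>x. \<bar>w x * \<bar>u x\<bar> powr s\<bar> \<partial>M)" by (rule integral_abs_bound)
  also have "\<dots> \<le> (\<integral>x. W * (1 + \<bar>u x\<bar> powr S) \<partial>M)"
    using I dom le by (intro integral_mono integrable_abs) auto
  also have "\<dots> = W * (measure M (space M) + (\<integral>x. \<bar>u x\<bar> powr S \<partial>M))"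
    using int by simp
  finally show "\<bar>\<integral>x. w x * \<bar>u x\<bar> powr s \<partial>M\<bar> \<le> W * (measure M (space M) + (\<integral>x. \<bar>u x\<bar> powr S \<partial>M))" .
qed

text \<open>Vitali's argument: the bound on a higher power controls the tails uniformly, and the
  truncations at height \<open>L\<close> converge by dominated convergence on the finite measure
  space.\<close>

lemma (in finite_measure) powr_integral_limit:
  fixes U :: "nat \<Rightarrow> 'a \<Rightarrow> real"
  assumes [measurable]: "\<And>k. U k \<in> borel_measurable M" "u \<in> borel_measurable M" "w \<in> borel_measurable M"
    and s: "0 < s" "s < S"
    and lim: "AE x in M. (\<lambda>k. U k x) \<longlonglongrightarrow> u x"
    and int: "\<And>k. integrable M (\<lambda>x. \<bar>U k x\<bar> powr S)" "integrable M (\<lambda>x. \<bar>u x\<bar> powr S)"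
    and bound: "\<And>k. (\<integral>x. \<bar>U k x\<bar> powr S \<partial>M) \<le> C" "(\<integral>x. \<bar>u x\<bar> powr S \<partial>M) \<le> C"
    and w: "\<And>x. x \<in> space M \<Longrightarrow> \<bar>w x\<bar> \<le> W"
  shows "(\<lambda>k. \<integral>x. w x * \<bar>U k x\<bar> powr s \<partial>M) \<longlonglongrightarrow> (\<integral>x. w x * \<bar>u x\<bar> powr s \<partial>M)"
proof (rule LIMSEQ_I)
  fix \<epsilon> :: real assume \<epsilon>: "\<epsilon> > 0"
  have "0 \<le> (\<integral>x. \<bar>u x\<bar> powr S \<partial>M)" by (rule integral_nonneg_AE) simp
  then have C: "C \<ge> 0" using bound(2) by linarith
  have w': "\<bar>w x\<bar> \<le> \<bar>W\<bar>" if "x \<in> space M" for x using order_trans[OF w[OF that] abs_ge_self] .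
  \<comment> \<open>The summands 1 make \<open>A\<close> positive even if \<open>W\<close> or
    \<open>C\<close> is 0; \<open>L\<close> below solves L^(s-S) A = \<epsilon>/3.\<close>
  define A where "A = (\<bar>W\<bar> + 1) * (C + 1)"
  have A: "A > 0" using C by (simp add: A_def)
  define L where "L = (\<epsilon> / (3 * A)) powr (1 / (s - S))"
  have L: "L > 0" using \<epsilon> A by (simp add: L_def)
  have LA: "L powr (s - S) * A = \<epsilon> / 3" using s \<epsilon> A by (simp add: L_def powr_powr)
  define T where "T v = (\<integral>x. w x * min \<bar>v x\<bar> L powr s \<partial>M)" for v :: "'a \<Rightarrow> real"
  have Tint: "integrable M (\<lambda>x. w x * min \<bar>v x\<bar> L powr s)" if [measurable]: "v \<in> borel_measurable M" for v
  proof (rule integrable_const_bound[of _ "\<bar>W\<bar> * L powr s"])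
    show "AE x in M. norm (w x * min \<bar>v x\<bar> L powr s) \<le> \<bar>W\<bar> * L powr s"
      using w' L s by (intro AE_I2) (auto simp: abs_mult intro!: mult_mono powr_mono2)
  qed measurable
  have tail: "\<bar>(\<integral>x. w x * \<bar>v x\<bar> powr s \<partial>M) - T v\<bar> < \<epsilon> / 3"
    if [measurable]: "v \<in> borel_measurable M" and v: "integrable M (\<lambda>x. \<bar>v x\<bar> powr S)" "(\<integral>x. \<bar>v x\<bar> powr S \<partial>M) \<le> C" for v
  proof -
    have I: "integrable M (\<lambda>x. w x * \<bar>v x\<bar> powr s)"
      using s v w by (intro integrable_lower_powr) auto
    have "(\<integral>x. w x * \<bar>v x\<bar> powr s \<partial>M) - T v = (\<integral>x. w x * (\<bar>v x\<bar> powr s - min \<bar>v x\<bar> L powr s) \<partial>M)"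
      unfolding T_def using I Tint[of v] by (simp add: right_diff_distrib)
    also have "\<bar>\<dots>\<bar> \<le> (\<integral>x. \<bar>w x * (\<bar>v x\<bar> powr s - min \<bar>v x\<bar> L powr s)\<bar> \<partial>M)" by (rule integral_abs_bound)
    also have "\<dots> \<le> (\<integral>x. \<bar>W\<bar> * (L powr (s - S) * \<bar>v x\<bar> powr S) \<partial>M)"
    proof (rule integral_mono)
      show "integrable M (\<lambda>x. \<bar>w x * (\<bar>v x\<bar> powr s - min \<bar>v x\<bar> L powr s)\<bar>)"
        using I Tint[of v] by (simp add: right_diff_distrib)
      show "integrable M (\<lambda>x. \<bar>W\<bar> * (L powr (s - S) * \<bar>v x\<bar> powr S))" using v by simp
      show "\<bar>w x * (\<bar>v x\<bar> powr s - min \<bar>v x\<bar> L powr s)\<bar> \<le> \<bar>W\<bar> * (L powr (s - S) * \<bar>v x\<bar> powr S)" if "x \<in> space M" for x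
        unfolding abs_mult using w[OF that] powr_tail_le[OF L s, of "\<bar>v x\<bar>"] by (intro mult_mono) auto
    qed
    also have "\<dots> = L powr (s - S) * (\<bar>W\<bar> * (\<integral>x. \<bar>v x\<bar> powr S \<partial>M))" by simp
    also have "\<dots> \<le> L powr (s - S) * (\<bar>W\<bar> * C)" using v by (intro mult_left_mono) auto
    also have "\<dots> < L powr (s - S) * A"
      using L C by (intro mult_strict_left_mono) (auto simp: A_def algebra_simps add_pos_nonneg)
    finally show ?thesis using LA by simp
  qed
  have "(\<lambda>k. T (U k)) \<longlonglongrightarrow> T u"
    unfolding T_def
  proof (rule integral_dominated_convergence[where w = "\<lambda>_. \<bar>W\<bar> * L powr s"])
    show "AE x in M. (\<lambda>k. w x * min \<bar>U k x\<bar> L powr s) \<longlonglongrightarrow> w x * min \<bar>u x\<bar> L powr s"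
      using lim
    proof eventually_elim
      case (elim x)
      then show ?case using s L by (intro tendsto_intros tendsto_powr') (auto intro!: always_eventually)
    qed
    show "AE x in M. norm (w x * min \<bar>U k x\<bar> L powr s) \<le> \<bar>W\<bar> * L powr s" for k
      using w' L s by (intro AE_I2) (auto simp: abs_mult intro!: mult_mono powr_mono2)
  qed simp_all
  then obtain N where N: "\<And>k. k \<ge> N \<Longrightarrow> \<bar>T (U k) - T u\<bar> < \<epsilon> / 3"
    using \<epsilon> LIMSEQ_D[of "\<lambda>k. T (U k)" "T u" "\<epsilon> / 3"] by auto
  have "norm ((\<integral>x. w x * \<bar>U k x\<bar> powr s \<partial>M) - (\<integral>x. w x * \<bar>u x\<bar> powr s \<partial>M)) < \<epsilon>" if "k \<ge> N" for k
  proof -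
    have "\<bar>(\<integral>x. w x * \<bar>U k x\<bar> powr s \<partial>M) - T (U k)\<bar> < \<epsilon> / 3" using int bound by (intro tail) auto
    moreover have "\<bar>(\<integral>x. w x * \<bar>u x\<bar> powr s \<partial>M) - T u\<bar> < \<epsilon> / 3" using int bound by (intro tail) auto
    ultimately show ?thesis using N[OF that] unfolding real_norm_def by linarith
  qed
  then show "\<exists>N. \<forall>k\<ge>N. norm ((\<integral>x. w x * \<bar>U k x\<bar> powr s \<partial>M) - (\<integral>x. w x * \<bar>u x\<bar> powr s \<partial>M)) < \<epsilon>" by blast
qed

section \<open>Homogeneous functionals of concave-convex type\<close>

text \<open>\<open>compactness\<close> packages a compact embedding together with the lower semicontinuity of \<open>E\<close>.\<close>

locale concave_convex =
  fixes V :: "('v \<Rightarrow> real) set"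
    and E H B :: "('v \<Rightarrow> real) \<Rightarrow> real"
    and dE dH dB :: "('v \<Rightarrow> real) \<Rightarrow> ('v \<Rightarrow> real) \<Rightarrow> real"
    and a p s :: real
  assumes exponents: "1 < a" "a < p" "p < s"
    and V_add: "\<And>u v t. u \<in> V \<Longrightarrow> v \<in> V \<Longrightarrow> (\<lambda>x. u x + t * v x) \<in> V"
    and V_abs: "\<And>u. u \<in> V \<Longrightarrow> (\<lambda>x. \<bar>u x\<bar>) \<in> V"
    and E_nonneg: "\<And>u. u \<in> V \<Longrightarrow> 0 \<le> E u"
    and E_scale: "\<And>u t. u \<in> V \<Longrightarrow> 0 \<le> t \<Longrightarrow> E (\<lambda>x. t * u x) = t powr p * E u"
    and H_scale: "\<And>u t. u \<in> V \<Longrightarrow> 0 \<le> t \<Longrightarrow> H (\<lambda>x. t * u x) = t powr a * H u"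
    and B_scale: "\<And>u t. u \<in> V \<Longrightarrow> 0 \<le> t \<Longrightarrow> B (\<lambda>x. t * u x) = t powr s * B u"
    and E_abs: "\<And>u. u \<in> V \<Longrightarrow> E (\<lambda>x. \<bar>u x\<bar>) \<le> E u"
    and H_abs: "\<And>u. u \<in> V \<Longrightarrow> H (\<lambda>x. \<bar>u x\<bar>) = H u"
    and B_abs: "\<And>u. u \<in> V \<Longrightarrow> B (\<lambda>x. \<bar>u x\<bar>) = B u"
    and bounded_on_unit_ball: "\<exists>C. \<forall>u\<in>V. E u \<le> 1 \<longrightarrow> \<bar>H u\<bar> \<le> C \<and> \<bar>B u\<bar> \<le> C"
    and E_deriv: "\<And>u v. u \<in> V \<Longrightarrow> v \<in> V \<Longrightarrow>
      ((\<lambda>t. E (\<lambda>x. u x + t * v x)) has_real_derivative p * dE u v) (at 0)"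
    and H_deriv: "\<And>u v. u \<in> V \<Longrightarrow> v \<in> V \<Longrightarrow>
      ((\<lambda>t. H (\<lambda>x. u x + t * v x)) has_real_derivative a * dH u v) (at 0)"
    and B_deriv: "\<And>u v. u \<in> V \<Longrightarrow> v \<in> V \<Longrightarrow>
      ((\<lambda>t. B (\<lambda>x. u x + t * v x)) has_real_derivative s * dB u v) (at 0)"
    and compactness: "\<And>U T. (\<And>k::nat. U k \<in> V) \<Longrightarrow> (\<And>k. E (U k) \<le> T) \<Longrightarrow>
      \<exists>\<sigma> u e. strict_mono \<sigma> \<and> u \<in> V \<and> (\<lambda>k. E (U (\<sigma> k))) \<longlonglongrightarrow> e \<and> E u \<le> e \<and>
        (\<lambda>k. H (U (\<sigma> k))) \<longlonglongrightarrow> H u \<and> (\<lambda>k. B (U (\<sigma> k))) \<longlonglongrightarrow> B u"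
    and H_pos: "\<exists>u\<in>V. H u > 0"
    and B_pos: "\<exists>u\<in>V. B u > 0"
begin

section \<open>Scaling, a priori bounds and the barrier sphere\<close>

definition J :: "real \<Rightarrow> ('v \<Rightarrow> real) \<Rightarrow> real" where
  "J l u = E u / p - l * H u / a - B u / s"

lemma V_scale: "u \<in> V \<Longrightarrow> (\<lambda>x. t * u x) \<in> V"
  using V_add[of u u "t - 1"] by (simp add: algebra_simps)

lemma J_scale:
  assumes "u \<in> V" "0 \<le> t"
  shows "J l (\<lambda>x. t * u x) = t powr p * E u / p - l * (t powr a * H u) / a - t powr s * B u / s"
  using assms by (simp add: J_def E_scale H_scale B_scale)

lemma J_deriv:
  assumes "u \<in> V" "v \<in> V"
  shows "((\<lambda>t. J l (\<lambda>x. u x + t * v x)) has_real_derivative dE u v - l * dH u v - dB u v) (at 0)"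
proof -
  have "((\<lambda>t. J l (\<lambda>x. u x + t * v x)) has_real_derivative
      (p * dE u v) / p - l * (a * dH u v) / a - (s * dB u v) / s) (at 0)"
    unfolding J_def
    by (intro DERIV_diff DERIV_cdivide DERIV_cmult E_deriv H_deriv B_deriv assms)
  then show ?thesis using exponents by simp
qed

text \<open>Apply the bound on the unit ball to u/t. Allowing every t with E u \<le> t^p, instead of
  only the p-th root of E u, includes the case E u = 0.\<close>

lemma homogeneous_bounds:
  obtains C where "C \<ge> 1" "\<And>u t. u \<in> V \<Longrightarrow> 0 < t \<Longrightarrow> E u \<le> t powr p \<Longrightarrow>
    \<bar>H u\<bar> \<le> C * t powr a \<and> \<bar>B u\<bar> \<le> C * t powr s"
proof -
  obtain C0 where C0: "\<And>u. u \<in> V \<Longrightarrow> E u \<le> 1 \<Longrightarrow> \<bar>H u\<bar> \<le> C0 \<and> \<bar>B u\<bar> \<le> C0"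
    using bounded_on_unit_ball by blast
  define C where "C = max 1 C0"
  show thesis
  proof (rule that[of C])
    show "C \<ge> 1" by (simp add: C_def)
    fix u t assume u: "u \<in> V" and t: "0 < (t::real)" and le: "E u \<le> t powr p"
    let ?v = "\<lambda>x. (1/t) * u x"
    have "E ?v = (1/t) powr p * E u" using u t by (intro E_scale) auto
    also have "\<dots> \<le> (1/t) powr p * t powr p" using le by (intro mult_left_mono) auto
    also have "\<dots> = 1" using t by (simp add: powr_divide)
    finally have "\<bar>H ?v\<bar> \<le> C0 \<and> \<bar>B ?v\<bar> \<le> C0" using C0[OF V_scale[OF u]] by blast
    moreover have "H ?v = (1/t) powr a * H u" using u t by (intro H_scale) auto
    moreover have "B ?v = (1/t) powr s * B u" using u t by (intro B_scale) auto
    ultimately have "\<bar>H u\<bar> \<le> C0 * t powr a \<and> \<bar>B u\<bar> \<le> C0 * t powr s"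
      using t by (auto simp: powr_divide abs_mult pos_divide_le_eq)
    moreover have "C0 * t powr a \<le> C * t powr a" "C0 * t powr s \<le> C * t powr s"
      by (auto simp: C_def intro!: mult_right_mono)
    ultimately show "\<bar>H u\<bar> \<le> C * t powr a \<and> \<bar>B u\<bar> \<le> C * t powr s" by linarith
  qed
qed

text \<open>The radius is fixed by the higher order term alone, since t^s is small against t^p near
  0. Only then is \<open>l\<close> made small enough for the lower order term, which t^p does not
  control near 0.\<close>

lemma positive_on_sphere:
  obtains l0 \<rho> d where "l0 > 0" "\<rho> > 0" "d > 0"
    "\<And>l u. 0 < l \<Longrightarrow> l < l0 \<Longrightarrow> u \<in> V \<Longrightarrow> E u = \<rho> powr p \<Longrightarrow> J l u \<ge> d"
proof -
  obtain C where C: "C \<ge> 1" "\<And>u t. u \<in> V \<Longrightarrow> 0 < t \<Longrightarrow> E u \<le> t powr p \<Longrightarrow>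
    \<bar>H u\<bar> \<le> C * t powr a \<and> \<bar>B u\<bar> \<le> C * t powr s" using homogeneous_bounds by blast
  \<comment> \<open>Solves C \<rho>^s / s = \<rho>^p / (4 p): the \<open>B\<close> term uses up a
    quarter of the energy term. The choice of \<open>l0\<close> allows the \<open>H\<close> term
    another quarter, so half is left.\<close>
  define \<rho> where "\<rho> = (s / (4 * p * C)) powr (1 / (s - p))"
  have pos: "\<rho> > 0" using exponents C by (simp add: \<rho>_def)
  have "\<rho> powr (s - p) = s / (4 * p * C)"
    using exponents C by (simp add: \<rho>_def powr_powr)
  then have "\<rho> powr s = \<rho> powr p * (s / (4 * p * C))"
    using powr_add[of \<rho> p "s - p"] by simp
  then have B1: "C * \<rho> powr s / s = \<rho> powr p / (4 * p)"
    using exponents C by (simp add: field_simps)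
  define l0 where "l0 = a * \<rho> powr p / (4 * p) / (C * \<rho> powr a)"
  have l0: "l0 > 0" using exponents C pos by (simp add: l0_def)
  have H1: "l0 * (C * \<rho> powr a) / a = \<rho> powr p / (4 * p)"
    using exponents C pos by (simp add: l0_def field_simps)
  show thesis
  proof (rule that[OF l0 pos, of "\<rho> powr p / (2 * p)"])
    show "\<rho> powr p / (2 * p) > 0" using pos exponents by simp
    fix l u assume l: "0 < l" "l < l0" and u: "u \<in> V" and e: "E u = \<rho> powr p"
    from C(2)[OF u pos] e have hb: "\<bar>H u\<bar> \<le> C * \<rho> powr a" "\<bar>B u\<bar> \<le> C * \<rho> powr s" by auto
    have "l * H u \<le> l0 * (C * \<rho> powr a)" using l hb(1) by (intro order_trans[OF mult_left_mono mult_right_mono]) auto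
    then have "l * H u / a \<le> \<rho> powr p / (4 * p)"
      using H1 exponents by (metis divide_right_mono dual_order.trans less_eq_real_def zero_le_one)
    moreover have "B u / s \<le> \<rho> powr p / (4 * p)"
      using hb(2) B1 exponents by (metis abs_le_D1 divide_right_mono dual_order.trans less_eq_real_def zero_le_one)
    ultimately have "J l u \<ge> \<rho> powr p / p - \<rho> powr p / (4 * p) - \<rho> powr p / (4 * p)"
      using e by (simp add: J_def)
    moreover have "\<rho> powr p / p - \<rho> powr p / (4 * p) - \<rho> powr p / (4 * p) = \<rho> powr p / (2 * p)"
      using exponents by (simp add: field_simps)
    ultimately show "J l u \<ge> \<rho> powr p / (2 * p)" by simp
  qed
qed

end

text \<open>The smallness of \<open>l\<close> enters only through the barrier
  \<open>sphere\<close>.\<close>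

locale concave_convex_small = concave_convex V E H B dE dH dB a p s
  for V :: "('v \<Rightarrow> real) set" and E H B dE dH dB a p s +
  fixes l \<rho> d :: real
  assumes l_pos: "0 < l" and \<rho>_pos: "0 < \<rho>" and d_pos: "0 < d"
    and sphere: "\<And>u. u \<in> V \<Longrightarrow> E u = \<rho> powr p \<Longrightarrow> J l u \<ge> d"
begin

section \<open>Minimisation inside the ball\<close>

lemma bounded_below_on_ball:
  obtains m where "\<And>u. u \<in> V \<Longrightarrow> E u \<le> \<rho> powr p \<Longrightarrow> J l u \<ge> m"
proof -
  obtain C where C: "C \<ge> 1" "\<And>u t. u \<in> V \<Longrightarrow> 0 < t \<Longrightarrow> E u \<le> t powr p \<Longrightarrow>
    \<bar>H u\<bar> \<le> C * t powr a \<and> \<bar>B u\<bar> \<le> C * t powr s" using homogeneous_bounds by blast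
  show thesis
  proof (rule that[of "- l * (C * \<rho> powr a) / a - C * \<rho> powr s / s"])
    fix u assume u: "u \<in> V" "E u \<le> \<rho> powr p"
    from C(2)[OF u(1) \<rho>_pos u(2)] have hb: "H u \<le> C * \<rho> powr a" "B u \<le> C * \<rho> powr s" by auto
    have "l * H u / a \<le> l * (C * \<rho> powr a) / a" "B u / s \<le> C * \<rho> powr s / s"
      using hb l_pos exponents by (auto intro!: divide_right_mono mult_left_mono)
    moreover have "E u / p \<ge> 0" using E_nonneg[OF u(1)] exponents by simp
    ultimately show "J l u \<ge> - l * (C * \<rho> powr a) / a - C * \<rho> powr s / s"
      by (simp add: J_def)
  qed
qed

lemma negative_in_ball:
  obtains u where "u \<in> V" "E u \<le> \<rho> powr p" "J l u < 0"
proof -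
  obtain w where w: "w \<in> V" "H w > 0" using H_pos by blast
  \<comment> \<open>For t \<le> 1 the t^s term is absorbed into t^p, giving J (t w) \<le> t^p K -
    t^a c. The entries of the minimum in \<open>t\<close> ensure t \<le> 1, t^(p-a) K \<le> c/2 and
    membership in the ball; E w + 1 avoids a division by zero.\<close>
  define K where "K = E w / p + \<bar>B w\<bar> / s + 1"
  have K: "K > 0" using E_nonneg[OF w(1)] exponents by (simp add: K_def add_nonneg_pos)
  define c where "c = l * H w / a"
  have c: "c > 0" using l_pos w exponents by (simp add: c_def)
  define t where "t = min 1 (min ((c / (2 * K)) powr (1 / (p - a))) (\<rho> / (E w + 1) powr (1/p)))"
  have E1: "E w + 1 > 0" using E_nonneg[OF w(1)] by simp
  have t: "t > 0" "t \<le> 1" "t \<le> (c / (2 * K)) powr (1 / (p - a))" "t \<le> \<rho> / (E w + 1) powr (1/p)"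
    using c K \<rho>_pos E1 by (auto simp: t_def)
  have "t powr (p - a) \<le> ((c / (2 * K)) powr (1 / (p - a))) powr (p - a)"
    using t exponents by (intro powr_mono2) auto
  then have ta: "t powr (p - a) \<le> c / (2 * K)" using exponents c K by (simp add: powr_powr)
  have "t powr p \<le> (\<rho> / (E w + 1) powr (1/p)) powr p"
    using t exponents by (intro powr_mono2) auto
  also have "\<dots> = \<rho> powr p / (E w + 1)"
    using exponents \<rho>_pos E1 by (simp add: powr_divide powr_powr)
  finally have tE: "t powr p * (E w + 1) \<le> \<rho> powr p" using E1 by (simp add: field_simps)
  show thesis
  proof (rule that[of "\<lambda>x. t * w x"])
    show "(\<lambda>x. t * w x) \<in> V" using V_scale w by blast
    have "E (\<lambda>x. t * w x) = t powr p * E w" using E_scale w t by simp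
    also have "\<dots> \<le> t powr p * (E w + 1)" by (simp add: mult_left_mono)
    finally show "E (\<lambda>x. t * w x) \<le> \<rho> powr p" using tE by simp
    have "t powr s \<le> t powr p" using t exponents by (intro powr_mono') auto
    then have "t powr s * \<bar>B w\<bar> \<le> t powr p * \<bar>B w\<bar>" by (intro mult_right_mono) auto
    moreover have "- (t powr s * B w) \<le> t powr s * \<bar>B w\<bar>"
      by (metis abs_ge_minus_self abs_mult abs_of_nonneg powr_ge_zero)
    ultimately have "- (t powr s * B w) / s \<le> t powr p * \<bar>B w\<bar> / s" 
      using exponents by (intro divide_right_mono) auto
    then have "J l (\<lambda>x. t * w x) \<le> t powr p * (E w / p + \<bar>B w\<bar> / s) - t powr a * c"
      using w t by (simp add: J_scale c_def algebra_simps)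
    also have "\<dots> \<le> t powr p * K - t powr a * c" by (simp add: K_def mult_left_mono)
    also have "t powr p = t powr a * t powr (p - a)" by (simp flip: powr_add)
    also have "t powr a * t powr (p - a) * K - t powr a * c = t powr a * (t powr (p - a) * K - c)"
      by (simp add: algebra_simps)
    also have "t powr (p - a) * K \<le> c / (2 * K) * K" using ta K by (intro mult_right_mono) auto
    then have "t powr a * (t powr (p - a) * K - c) \<le> t powr a * (c / (2 * K) * K - c)"
      by (intro mult_left_mono) auto
    also have "\<dots> < 0" using K c t by (auto simp: mult_less_0_iff)
    finally show "J l (\<lambda>x. t * w x) < 0" .
  qed
qed

lemma first_solution:
  obtains u where "u \<in> V" "\<And>x. 0 \<le> u x" "\<And>v. v \<in> V \<Longrightarrow> dE u v = l * dH u v + dB u v" "J l u < 0"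
proof -
  define S where "S = {u \<in> V. E u \<le> \<rho> powr p}"
  define m where "m = (INF u\<in>S. J l u)"
  obtain m0 where m0: "\<And>u. u \<in> S \<Longrightarrow> m0 \<le> J l u"
    using bounded_below_on_ball by (metis (no_types, lifting) S_def mem_Collect_eq)
  then have bdd: "bdd_below (J l ` S)" by (rule bdd_belowI2)
  obtain w where w: "w \<in> S" "J l w < 0" using negative_in_ball by (auto simp: S_def)
  have m_le: "m \<le> J l u" if "u \<in> S" for u unfolding m_def using bdd that by (rule cINF_lower)
  have m_neg: "m < 0" using m_le[OF w(1)] w(2) by linarith
  have "\<exists>u\<in>S. J l u < m + 1 / real (Suc k)" for k
  proof -
    have "(INF u\<in>S. J l u) < m + 1 / real (Suc k)" by (simp add: m_def)
    then show ?thesis using cINF_less_iff[OF _ bdd] w by blast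
  qed
  then obtain U where U: "\<And>k. U k \<in> S" "\<And>k. J l (U k) < m + 1 / real (Suc k)" by metis
  have Jlim: "(\<lambda>k. J l (U k)) \<longlonglongrightarrow> m"
  proof (rule tendsto_sandwich[of "\<lambda>_. m" _ _ "\<lambda>k. m + 1 / real (Suc k)"])
    have "(\<lambda>k. m + 1 / real (Suc k)) \<longlonglongrightarrow> m + 0"
      by (intro tendsto_add tendsto_const LIMSEQ_Suc[OF lim_1_over_n])
    then show "(\<lambda>k. m + 1 / real (Suc k)) \<longlonglongrightarrow> m" by simp
  qed (use U m_le in \<open>auto intro!: always_eventually less_imp_le\<close>)
  have "\<And>k. U k \<in> V" "\<And>k. E (U k) \<le> \<rho> powr p" using U(1) by (auto simp: S_def)
  from compactness[of U, OF this] obtain \<sigma> u e where \<sigma>: "strict_mono \<sigma>" "u \<in> V"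
    "(\<lambda>k. E (U (\<sigma> k))) \<longlonglongrightarrow> e" "E u \<le> e"
    "(\<lambda>k. H (U (\<sigma> k))) \<longlonglongrightarrow> H u" "(\<lambda>k. B (U (\<sigma> k))) \<longlonglongrightarrow> B u" by blast
  have "e \<le> \<rho> powr p"
    by (rule LIMSEQ_le_const2[OF \<sigma>(3)]) (use U(1) in \<open>auto simp: S_def\<close>)
  have "(\<lambda>k. J l (U (\<sigma> k))) \<longlonglongrightarrow> e / p - l * H u / a - B u / s"
    unfolding J_def using exponents by (intro tendsto_intros \<sigma>) auto
  moreover have "(\<lambda>k. J l (U (\<sigma> k))) \<longlonglongrightarrow> m"
    using LIMSEQ_subseq_LIMSEQ[OF Jlim \<sigma>(1)] by (simp add: o_def)
  \<comment> \<open>Energy may drop in the limit, so \<open>m\<close> is expressed by the limit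
    \<open>e\<close> of the energies and not by E u.\<close>
  ultimately have em: "e / p - l * H u / a - B u / s = m" by (rule LIMSEQ_unique)
  define z where "z = (\<lambda>x. \<bar>u x\<bar>)"
  have zV: "z \<in> V" using V_abs \<sigma> by (simp add: z_def)
  have Ez: "E z \<le> e" using E_abs[OF \<sigma>(2)] \<sigma>(4) by (simp add: z_def)
  then have zS: "z \<in> S" using zV \<open>e \<le> \<rho> powr p\<close> by (simp add: S_def)
  have "J l z \<le> m"
    using Ez em exponents \<sigma>(2) divide_right_mono[OF Ez, of p]
    by (simp add: J_def z_def H_abs B_abs)
  then have Jz: "J l z = m" using m_le[OF zS] by simp
  \<comment> \<open>The barrier makes the minimum interior, so that small variations in both
    directions stay in the ball.\<close>
  have "E z \<noteq> \<rho> powr p" using sphere[OF zV] Jz m_neg d_pos by auto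
  then have Ez_less: "E z < \<rho> powr p" using zS by (simp add: S_def)
  have crit: "dE z v = l * dH z v + dB z v" if v: "v \<in> V" for v
  proof -
    have "isCont (\<lambda>t. E (\<lambda>x. z x + t * v x)) 0" using E_deriv[OF zV v] DERIV_isCont by blast
    moreover have "E (\<lambda>x. z x + 0 * v x) < \<rho> powr p" using Ez_less by simp
    ultimately have "eventually (\<lambda>t. E (\<lambda>x. z x + t * v x) < \<rho> powr p) (at 0)"
      unfolding isCont_def by (rule order_tendstoD)
    then obtain \<delta> where \<delta>: "\<delta> > 0" "\<And>t. t \<noteq> 0 \<Longrightarrow> \<bar>t\<bar> < \<delta> \<Longrightarrow> E (\<lambda>x. z x + t * v x) < \<rho> powr p"
      by (auto simp: eventually_at dist_real_def)
    have "J l (\<lambda>x. z x + 0 * v x) \<le> J l (\<lambda>x. z x + t * v x)" if "\<bar>0 - t\<bar> < \<delta>" for t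
    proof (cases "t = 0")
      case False
      then have "(\<lambda>x. z x + t * v x) \<in> S" using \<delta>(2)[of t] that V_add[OF zV v] by (simp add: S_def)
      then show ?thesis using m_le Jz by simp
    qed simp
    then have "dE z v - l * dH z v - dB z v = 0"
      using DERIV_local_min[OF J_deriv[OF zV v] \<delta>(1)] by blast
    then show ?thesis by simp
  qed
  show thesis by (rule that[OF zV _ crit]) (use Jz m_neg in \<open>auto simp: z_def\<close>)
qed

text \<open>Here \<open>J\<close> takes its maximum over the ray \<open>{t u | t \<ge> 0}\<close> at \<open>t = 1\<close>; for small \<open>l\<close> this is the part
  \<open>N\<^sup>-\<close> of the Nehari manifold.\<close>

definition fibre_maximal :: "('v \<Rightarrow> real) set" where
  "fibre_maximal = {u \<in> V. 0 < B u \<and> (\<forall>t\<ge>0. J l (\<lambda>x. t * u x) \<le> J l u)}"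

section \<open>Fibre maxima: existence, level, coercivity and uniqueness\<close>

lemma B_pos_imp_E_pos:
  assumes "u \<in> V" "B u > 0" shows "E u > 0"
proof (rule ccontr)
  obtain C where C: "C \<ge> 1" "\<And>u t. u \<in> V \<Longrightarrow> 0 < t \<Longrightarrow> E u \<le> t powr p \<Longrightarrow>
    \<bar>H u\<bar> \<le> C * t powr a \<and> \<bar>B u\<bar> \<le> C * t powr s" using homogeneous_bounds by blast
  assume "\<not> E u > 0"
  then have "E u = 0" using E_nonneg[OF assms(1)] by simp
  \<comment> \<open>With E u = 0 the bound on B u is available for every t > 0; this t makes it half
    of B u.\<close>
  define t where "t = (B u / (2 * C)) powr (1/s)"
  have t: "t > 0" using assms C by (simp add: t_def)
  have "B u \<le> C * t powr s" using C(2)[OF assms(1) t] \<open>E u = 0\<close> by auto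
  also have "t powr s = B u / (2 * C)" using exponents assms C by (simp add: t_def powr_powr)
  also have "C * (B u / (2 * C)) = B u / 2" using C by simp
  finally show False using assms by simp
qed

text \<open>The ray meets the barrier sphere, so J reaches at least d on it, and B u > 0 sends J to
  minus infinity, whatever the sign of H u.\<close>

lemma fibre_maximum:
  assumes u: "u \<in> V" "B u > 0"
  obtains t where "t > 0" "(\<lambda>x. t * u x) \<in> fibre_maximal" "J l (\<lambda>x. t * u x) \<ge> d"
proof -
  have Ep: "E u > 0" using B_pos_imp_E_pos[OF u] .
  define f where "f = (\<lambda>t. t powr p * E u / p - l * (t powr a * H u) / a - t powr s * B u / s)"
  have Jf: "J l (\<lambda>x. t * u x) = f t" if "t \<ge> 0" for t using J_scale[OF u(1) that] by (simp add: f_def)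
  \<comment> \<open>The parameter at which the ray crosses the sphere.\<close>
  define t1 where "t1 = \<rho> / E u powr (1/p)"
  have t1: "t1 > 0" using \<rho>_pos Ep by (simp add: t1_def)
  have "E (\<lambda>x. t1 * u x) = \<rho> powr p"
    using u t1 exponents Ep \<rho>_pos by (simp add: E_scale) (simp add: t1_def powr_divide powr_powr)
  then have ft1: "f t1 \<ge> d" using sphere[OF V_scale[OF u(1)], of t1] Jf[of t1] t1 by simp
  define K where "K = E u / p + l * \<bar>H u\<bar> / a"
  have K: "K > 0" using Ep exponents l_pos by (simp add: K_def add_pos_nonneg)
  \<comment> \<open>Beyond \<open>T\<close> the t^s term outweighs the others. The entry 1 gives t^a
    \<le> t^p, so that \<open>K\<close> can collect both lower order coefficients.\<close>
  define T where "T = max 1 ((s * K / B u) powr (1 / (s - p)))"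
  have neg: "f t \<le> 0" if "t \<ge> T" for t
  proof -
    have t: "t \<ge> 1" "t \<ge> (s * K / B u) powr (1 / (s - p))" using that by (auto simp: T_def)
    have "((s * K / B u) powr (1 / (s - p))) powr (s - p) \<le> t powr (s - p)"
      using t exponents by (intro powr_mono2) auto
    then have k: "K \<le> t powr (s - p) * B u / s" using exponents K u by (simp add: powr_powr field_simps)
    have "t powr a \<le> t powr p" using t exponents by (intro powr_mono) auto
    then have "t powr a * \<bar>H u\<bar> \<le> t powr p * \<bar>H u\<bar>" by (intro mult_right_mono) auto
    moreover have "- (t powr a * H u) \<le> t powr a * \<bar>H u\<bar>"
      by (metis abs_ge_minus_self abs_mult abs_of_nonneg powr_ge_zero)
    ultimately have "l * - (t powr a * H u) / a \<le> l * (t powr p * \<bar>H u\<bar>) / a" 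
      using exponents l_pos by (intro divide_right_mono mult_left_mono) auto
    then have "f t \<le> t powr p * K - t powr s * B u / s"
      by (simp add: f_def K_def algebra_simps)
    also have "t powr s = t powr p * t powr (s - p)" by (simp flip: powr_add)
    also have "t powr p * K - t powr p * t powr (s - p) * B u / s = t powr p * (K - t powr (s - p) * B u / s)"
      by (simp add: algebra_simps)
    also have "\<dots> \<le> 0" using k by (simp add: mult_nonneg_nonpos)
    finally show ?thesis .
  qed
  have "t1 < T" using neg[of t1] ft1 d_pos by (meson linorder_not_le order_less_le_trans)
  have cont: "continuous_on {0..T} f"
    unfolding f_def using exponents
    by (intro continuous_intros continuous_on_powr') auto
  obtain t where t: "t \<in> {0..T}" "\<And>y. y \<in> {0..T} \<Longrightarrow> f y \<le> f t"
    using continuous_attains_sup[OF compact_Icc _ cont] t1 \<open>t1 < T\<close> by fastforce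
  have ftd: "f t \<ge> d" using t(2)[of t1] ft1 t1 \<open>t1 < T\<close> by simp
  have "t \<noteq> 0" using ftd d_pos exponents by (auto simp: f_def)
  then have tp: "t > 0" using t by simp
  have max: "f y \<le> f t" if "y \<ge> 0" for y
    using neg[of y] t(2)[of y] ftd d_pos that by (cases "y \<le> T") auto
  show thesis
  proof (rule that[OF tp])
    show "J l (\<lambda>x. t * u x) \<ge> d" using Jf tp ftd by simp
    have "J l (\<lambda>x. y * (t * u x)) \<le> J l (\<lambda>x. t * u x)" if "y \<ge> 0" for y
      using max[of "y * t"] Jf[of "y * t"] Jf[of t] tp that by (simp add: mult.assoc)
    then show "(\<lambda>x. t * u x) \<in> fibre_maximal"
      using u tp by (simp add: fibre_maximal_def V_scale B_scale)
  qed
qed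

text \<open>First order condition along the ray, at t = 1.\<close>

lemma fibre_maximal_Nehari:
  assumes "u \<in> fibre_maximal" shows "E u = l * H u + B u"
proof -
  have u: "u \<in> V" "\<And>t. t \<ge> 0 \<Longrightarrow> J l (\<lambda>x. t * u x) \<le> J l u"
    using assms by (auto simp: fibre_maximal_def)
  define f where "f = (\<lambda>t. t powr p * E u / p - l * (t powr a * H u) / a - t powr s * B u / s)"
  have "(f has_real_derivative p * 1 powr (p - 1) * E u / p - l * (a * 1 powr (a - 1) * H u) / a - s * 1 powr (s - 1) * B u / s) (at 1)"
    unfolding f_def
    by (intro DERIV_diff DERIV_cdivide DERIV_cmult DERIV_cmult_right has_real_derivative_powr) auto
  then have "(f has_real_derivative E u - l * H u - B u) (at 1)" using exponents by simp
  moreover have "\<forall>y. \<bar>1 - y\<bar> < 1 \<longrightarrow> f y \<le> f 1"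
    using u(2) J_scale[OF u(1), of _ l] J_scale[OF u(1), of 1 l] by (auto simp: f_def)
  ultimately have "E u - l * H u - B u = 0" by (intro DERIV_local_max[of f _ 1 1]) auto
  then show ?thesis by simp
qed

text \<open>The Nehari identity with \<open>H\<close> eliminated. Along a ray the left side grows like \<open>t\<^sup>s\<close>, the energy term
  like \<open>t\<^sup>p\<close> and \<open>J\<close> is constant on maximisers, hence uniqueness of the maximum point below.\<close>

lemma fibre_maximal_value:
  assumes "u \<in> fibre_maximal"
  shows "B u * (1/a - 1/s) = J l u + E u * (1/a - 1/p)"
proof -
  have "l * H u = E u - B u" using fibre_maximal_Nehari[OF assms] by simp
  then have "J l u = E u / p - (E u - B u) / a - B u / s" by (simp add: J_def)
  then show ?thesis by (simp add: algebra_simps diff_divide_distrib)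
qed

lemma fibre_maximal_ge:
  assumes "u \<in> fibre_maximal" shows "J l u \<ge> d"
proof -
  have u: "u \<in> V" "B u > 0" "\<And>t. t \<ge> 0 \<Longrightarrow> J l (\<lambda>x. t * u x) \<le> J l u"
    using assms by (auto simp: fibre_maximal_def)
  obtain t where "t > 0" "J l (\<lambda>x. t * u x) \<ge> d" using fibre_maximum[OF u(1,2)] by blast
  then show ?thesis using u(3)[of t] by simp
qed

text \<open>Eliminating \<open>B\<close> by the Nehari identity leaves J u = (1/p - 1/s) E u - l
  (1/a - 1/s) H u, where H u grows at most like (E u)^(a/p) with a < p.\<close>

lemma fibre_maximal_coercive:
  obtains T where "\<And>u. u \<in> fibre_maximal \<Longrightarrow> J l u \<le> M \<Longrightarrow> E u \<le> T"
proof -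
  obtain C where C: "C \<ge> 1" "\<And>u t. u \<in> V \<Longrightarrow> 0 < t \<Longrightarrow> E u \<le> t powr p \<Longrightarrow>
    \<bar>H u\<bar> \<le> C * t powr a \<and> \<bar>B u\<bar> \<le> C * t powr s" using homogeneous_bounds by blast
  define \<gamma> where "\<gamma> = 1/p - 1/s"
  define \<eta> where "\<eta> = l * (1/a - 1/s) * C"
  have g: "\<gamma> > 0" "\<eta> > 0" using exponents l_pos C by (auto simp: \<gamma>_def \<eta>_def frac_less2)
  \<comment> \<open>Beyond the first entry |M| < \<gamma> E u / 2, beyond the second \<eta> t^a <
    \<gamma> E u / 2 where t^p = E u; together they contradict J u \<le> M.\<close>
  define T where "T = max (2 * \<bar>M\<bar> / \<gamma>) ((2 * \<eta> / \<gamma>) powr (p / (p - a)))"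
  show thesis
  proof (rule that[of T], rule ccontr)
    fix u assume u: "u \<in> fibre_maximal" "J l u \<le> M" and "\<not> E u \<le> T"
    then have e: "E u > 2 * \<bar>M\<bar> / \<gamma>" "E u > (2 * \<eta> / \<gamma>) powr (p / (p - a))"
      by (auto simp: T_def)
    have uV: "u \<in> V" using u by (simp add: fibre_maximal_def)
    have Ep: "E u > 0" using e(1) g by (meson abs_ge_zero divide_nonneg_pos less_eq_real_def mult_nonneg_nonneg order_le_less_trans zero_le_numeral)
    define t where "t = E u powr (1/p)"
    have t: "t > 0" "t powr p = E u" using Ep exponents by (auto simp: t_def powr_powr)
    have "\<bar>H u\<bar> \<le> C * t powr a" using C(2)[OF uV t(1)] t by simp
    then have "l * (1/a - 1/s) * H u \<le> l * (1/a - 1/s) * (C * t powr a)"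
      using l_pos exponents by (intro mult_left_mono) (auto simp: frac_le)
    moreover have "J l u = \<gamma> * E u - l * (1/a - 1/s) * H u"
      using fibre_maximal_Nehari[OF u(1)] by (simp add: J_def \<gamma>_def algebra_simps diff_divide_distrib add_divide_distrib)
    ultimately have 1: "\<gamma> * E u - \<eta> * t powr a \<le> M" using u(2) by (simp add: \<eta>_def)
    have "((2 * \<eta> / \<gamma>) powr (p / (p - a))) powr ((p - a) / p) < E u powr ((p - a) / p)"
      using e(2) exponents by (intro powr_less_mono2) auto
    then have "2 * \<eta> / \<gamma> < E u powr ((p - a) / p)" using exponents g by (simp add: powr_powr)
    also have "\<dots> = t powr (p - a)" by (simp add: t_def powr_powr)
    finally have "2 * \<eta> < \<gamma> * t powr (p - a)" using g by (simp add: field_simps)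
    then have "2 * \<eta> * t powr a < \<gamma> * t powr (p - a) * t powr a" using t by (intro mult_strict_right_mono) auto
    also have "\<dots> = \<gamma> * E u" using t by (simp add: mult.assoc flip: powr_add)
    finally have "\<eta> * t powr a < \<gamma> * E u / 2" by simp
    moreover have "\<bar>M\<bar> < \<gamma> * E u / 2" using e(1) g by (simp add: field_simps)
    ultimately show False using 1 by linarith
  qed
qed

lemma fibre_maximum_unique:
  assumes u: "u \<in> fibre_maximal" and t: "t > 0" "(\<lambda>x. t * u x) \<in> fibre_maximal"
  shows "t = 1"
proof -
  have uV: "u \<in> V" "B u > 0" "\<And>t. t \<ge> 0 \<Longrightarrow> J l (\<lambda>x. t * u x) \<le> J l u"
    using u by (auto simp: fibre_maximal_def)
  let ?v = "\<lambda>x. t * u x"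
  have "\<And>y. y \<ge> 0 \<Longrightarrow> J l (\<lambda>x. y * ?v x) \<le> J l ?v"
    using t by (auto simp: fibre_maximal_def)
  \<comment> \<open>Both points maximise J over the same ray, so the values agree.\<close>
  from this[of "1/t"] have "J l u \<le> J l ?v" using t by simp
  then have Jeq: "J l ?v = J l u" using uV(3)[of t] t by simp
  have Jp: "J l u > 0" using fibre_maximal_ge[OF u] d_pos by simp
  define \<beta> \<gamma> where "\<beta> = B u * (1/a - 1/s)" and "\<gamma> = E u * (1/a - 1/p)"
  have \<beta>: "\<beta> > 0" using uV exponents by (simp add: \<beta>_def frac_less2)
  have eq1: "\<beta> = J l u + \<gamma>" using fibre_maximal_value[OF u] by (simp add: \<beta>_def \<gamma>_def)
  have "(t powr s * B u) * (1/a - 1/s) = J l u + (t powr p * E u) * (1/a - 1/p)"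
    using fibre_maximal_value[OF t(2)] Jeq t uV by (simp add: E_scale B_scale)
  then have eq2: "t powr s * \<beta> = J l u + t powr p * \<gamma>" by (simp add: \<beta>_def \<gamma>_def algebra_simps)
  \<comment> \<open>Subtracting t^p times \<open>eq1\<close> from \<open>eq2\<close> gives (t^s -
    t^p) \<beta> = (1 - t^p) J u. As \<beta> and J u are positive, the two sides have opposite signs
    unless t = 1.\<close>
  show ?thesis
  proof (rule ccontr)
    assume "t \<noteq> 1"
    then consider "t > 1" | "t < 1" by linarith
    then show False
    proof cases
      case 1
      then have "t powr p < t powr s" "1 < t powr p" using exponents by (auto intro: powr_less_mono gr_one_powr)
      then have "t powr p * \<beta> < t powr s * \<beta>" using \<beta> by simp
      moreover have "J l u < t powr p * J l u" using Jp \<open>1 < t powr p\<close> by simp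
      ultimately show False using eq1 eq2 by (simp add: algebra_simps)
    next
      case 2
      then have "t powr s < t powr p" "t powr p < 1" using exponents t powr_less_mono'[of t 0 p] by (auto simp: powr_less_mono')
      then have "t powr s * \<beta> < t powr p * \<beta>" using \<beta> by simp
      moreover have "t powr p * J l u < J l u" using Jp \<open>t powr p < 1\<close> by simp
      ultimately show False using eq1 eq2 by (simp add: algebra_simps)
    qed
  qed
qed


text \<open>If \<open>z\<close> minimises \<open>J\<close> over the fibre maxima, then the maximum point on the fibre through
  \<open>z + S\<^sub>k v\<close> tends to 1, so homogeneity reduces the comparison with \<open>z\<close> to a difference quotient
  of \<open>J\<close> at \<open>z\<close>.\<close>

lemma minimiser_variation:
  assumes z: "z \<in> fibre_maximal" and min: "\<And>u. u \<in> fibre_maximal \<Longrightarrow> J l z \<le> J l u"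
    and v: "v \<in> V" and S: "S \<longlonglongrightarrow> 0" "\<And>k::nat. S k \<noteq> 0"
  shows "\<exists>\<tau> Q. strict_mono \<tau> \<and> Q \<longlonglongrightarrow> dE z v - l * dH z v - dB z v \<and> (\<forall>k. S (\<tau> k) * Q k \<ge> 0)"
proof -
  have zV: "z \<in> V" and Bz: "B z > 0" and zmax: "\<And>t. t \<ge> 0 \<Longrightarrow> J l (\<lambda>x. t * z x) \<le> J l z"
    using z by (auto simp: fibre_maximal_def)
  define w where "w k = (\<lambda>x. z x + S k * v x)" for k
  have wV: "w k \<in> V" for k using V_add[OF zV v] by (simp add: w_def)
  have conv: "(\<lambda>k. G (w k)) \<longlonglongrightarrow> G z"
    if "((\<lambda>t. G (\<lambda>x. z x + t * v x)) has_real_derivative D) (at 0)" for G :: "_ \<Rightarrow> real" and D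
    using isCont_tendsto_compose[OF DERIV_isCont[OF that] S(1)] by (simp add: w_def)
  have quot: "(\<lambda>k. (G (w k) - G z) / S k) \<longlonglongrightarrow> D"
    if "((\<lambda>t. G (\<lambda>x. z x + t * v x)) has_real_derivative D) (at 0)" for G :: "_ \<Rightarrow> real" and D
  proof -
    have "((\<lambda>h. (G (\<lambda>x. z x + h * v x) - G z) / h) \<longlongrightarrow> D) (at 0)"
      using that by (simp add: DERIV_def)
    moreover have "filterlim S (at 0) sequentially" using S by (auto simp: filterlim_at)
    ultimately show ?thesis unfolding w_def by (rule filterlim_compose)
  qed
  note dEz = E_deriv[OF zV v] and dHz = H_deriv[OF zV v] and dBz = B_deriv[OF zV v]
  have "eventually (\<lambda>k. B z / 2 < B (w k)) sequentially"
    using conv[OF dBz] Bz by (intro order_tendstoD(1)) auto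
  then obtain N where N: "\<And>k. k \<ge> N \<Longrightarrow> B z / 2 < B (w k)"
    by (auto simp: eventually_sequentially)
  \<comment> \<open>The shift by \<open>N\<close> restricts to indices with B (w k) > 0, where a
    fibre maximum exists; \<open>\<tau>\<close> below contains the same shift.\<close>
  have "\<exists>t>0. (\<lambda>x. t * w (k + N) x) \<in> fibre_maximal" for k
    using fibre_maximum[OF wV, of "k + N"] N[of "k + N"] Bz by (smt (verit) le_add2 field_sum_of_halves)
  then obtain t where t: "\<And>k. t k > 0" "\<And>k. (\<lambda>x. t k * w (k + N) x) \<in> fibre_maximal" by metis
  obtain KE where KE: "\<And>k. \<bar>E (w k)\<bar> \<le> KE"
    using convergent_imp_Bseq[OF convergentI[OF conv[OF dEz]]] by (auto simp: Bseq_def)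
  obtain KH where KH: "\<And>k. \<bar>H (w k)\<bar> \<le> KH"
    using convergent_imp_Bseq[OF convergentI[OF conv[OF dHz]]] by (auto simp: Bseq_def)
  \<comment> \<open>Beyond \<open>T\<close> the Nehari identity t^s B = t^p E - l t^a H would fail,
    because B (w k) stays above B z / 2 while E and H stay bounded.\<close>
  define T where "T = max 1 ((2 * (KE + l * KH) / B z) powr (1 / (s - p)))"
  have tT: "t k \<le> T" for k
  proof (rule ccontr)
    assume "\<not> t k \<le> T"
    then have t1: "t k > 1" "t k > (2 * (KE + l * KH) / B z) powr (1 / (s - p))" by (auto simp: T_def)
    have nn: "0 \<le> KE + l * KH" using KE[of 0] KH[of 0] l_pos by (intro add_nonneg_nonneg mult_nonneg_nonneg) auto
    have "((2 * (KE + l * KH) / B z) powr (1 / (s - p))) powr (s - p) < t k powr (s - p)"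
      using t1 exponents by (intro powr_less_mono2) auto
    then have big: "KE + l * KH < t k powr (s - p) * (B z / 2)"
      using exponents nn Bz by (simp add: powr_powr field_simps)
    have "t k powr s * B (w (k+N)) = t k powr p * E (w (k+N)) - l * (t k powr a * H (w (k+N)))"
      using fibre_maximal_Nehari[OF t(2)[of k]] t(1)[of k] wV by (simp add: E_scale H_scale B_scale)
    also have "\<dots> \<le> t k powr p * KE + l * (t k powr p * KH)"
    proof -
      have "t k powr p * E (w (k+N)) \<le> t k powr p * KE" using KE[of "k+N"] by (intro mult_left_mono) auto
      moreover have "- (t k powr a * H (w (k+N))) \<le> t k powr a * KH"
        using KH[of "k+N"] mult_left_mono[of "- H (w (k+N))" KH "t k powr a"] by auto
      moreover have "t k powr a * KH \<le> t k powr p * KH"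
        using t1 exponents KH[of 0] by (intro mult_right_mono powr_mono) auto
      ultimately have "l * - (t k powr a * H (w (k+N))) \<le> l * (t k powr p * KH)"
        using l_pos by (intro mult_left_mono) auto
      then show ?thesis using \<open>t k powr p * E (w (k+N)) \<le> t k powr p * KE\<close> by simp
    qed
    also have "\<dots> = t k powr p * (KE + l * KH)" by (simp add: algebra_simps)
    also have "\<dots> < t k powr p * (t k powr (s - p) * (B z / 2))" using big t1 by simp
    also have "\<dots> = t k powr s * (B z / 2)" by (simp flip: powr_add mult.assoc)
    also have "\<dots> < t k powr s * B (w (k+N))" using N[of "k+N"] t1 by simp
    finally show False .
  qed
  have "bounded (range t)"
    unfolding bounded_iff using tT t(1) by (intro exI[of _ T]) (auto simp: less_imp_le)
  then obtain r t0 where r: "strict_mono r" "(t \<circ> r) \<longlonglongrightarrow> t0"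
    using bounded_imp_convergent_subsequence by metis
  have t0: "t0 \<ge> 0" by (rule LIMSEQ_le_const[OF r(2)]) (use t(1) in \<open>auto simp: less_imp_le\<close>)
  define \<tau> where "\<tau> k = r k + N" for k
  have \<tau>: "strict_mono \<tau>" using r(1) by (auto simp: \<tau>_def strict_mono_def)
  define y where "y k = t (r k)" for k
  have y: "y \<longlonglongrightarrow> t0" "\<And>k. y k > 0" "\<And>k. (\<lambda>x. y k * w (\<tau> k) x) \<in> fibre_maximal"
    using r(2) t by (auto simp: y_def[abs_def] \<tau>_def o_def)
  have ypow: "(\<lambda>k. y k powr c) \<longlonglongrightarrow> t0 powr c" if "c > 0" for c
    using y that by (intro tendsto_powr' tendsto_const) (auto intro!: always_eventually less_imp_le)
  have conv\<tau>: "(\<lambda>k. G (w (\<tau> k))) \<longlonglongrightarrow> G z"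
    if "((\<lambda>t. G (\<lambda>x. z x + t * v x)) has_real_derivative D) (at 0)" for G :: "_ \<Rightarrow> real" and D
    using LIMSEQ_subseq_LIMSEQ[OF conv[OF that] \<tau>] by (simp add: o_def)
  have quot\<tau>: "(\<lambda>k. (G (w (\<tau> k)) - G z) / S (\<tau> k)) \<longlonglongrightarrow> D"
    if "((\<lambda>t. G (\<lambda>x. z x + t * v x)) has_real_derivative D) (at 0)" for G :: "_ \<Rightarrow> real" and D
    using LIMSEQ_subseq_LIMSEQ[OF quot[OF that] \<tau>] by (simp add: o_def)
  have Jy: "J l (\<lambda>x. y k * u x) = y k powr p * E u / p - l * (y k powr a * H u) / a - y k powr s * B u / s"
    if "u \<in> V" for k u using J_scale[OF that] y(2)[of k] by simp
  have lower: "J l z \<le> J l (\<lambda>x. y k * w (\<tau> k) x)" for k using min y(3) by blast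
  have "(\<lambda>k. J l (\<lambda>x. y k * w (\<tau> k) x)) \<longlonglongrightarrow>
      t0 powr p * E z / p - l * (t0 powr a * H z) / a - t0 powr s * B z / s"
    unfolding Jy[OF wV] using exponents
    by (intro tendsto_intros ypow conv\<tau>[OF dEz] conv\<tau>[OF dHz] conv\<tau>[OF dBz]) auto
  then have "J l z \<le> t0 powr p * E z / p - l * (t0 powr a * H z) / a - t0 powr s * B z / s"
    by (rule LIMSEQ_le_const) (use lower in auto)
  \<comment> \<open>Thus \<open>t0\<close> is another maximum point on the ray of z, and equals 1 by
    uniqueness once \<open>t0\<close> = 0 is excluded.\<close>
  then have Jt0: "J l z = J l (\<lambda>x. t0 * z x)"
    using J_scale[OF zV t0, of l] zmax[OF t0] by simp
  have "t0 \<noteq> 0"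
  proof
    assume "t0 = 0"
    then have "J l z = 0" using Jt0 J_scale[OF zV, of 0 l] exponents by simp
    then show False using fibre_maximal_ge[OF z] d_pos by simp
  qed
  then have t0p: "t0 > 0" using t0 by simp
  have "J l (\<lambda>x. y * (t0 * z x)) \<le> J l (\<lambda>x. t0 * z x)" if "y \<ge> 0" for y
    using zmax[of "y * t0"] that t0 Jt0 by (simp add: mult.assoc)
  then have "(\<lambda>x. t0 * z x) \<in> fibre_maximal"
    using zV Bz t0p by (simp add: fibre_maximal_def V_scale B_scale)
  then have t01: "t0 = 1" using fibre_maximum_unique[OF z t0p] by simp
  \<comment> \<open>Both terms carry the same factor \<open>y k\<close>, so homogeneity turns
    \<open>Q\<close> into difference quotients at z with weights tending to 1, and the rate of that
    convergence does not enter. Minimality of z and J (y k z) \<le> J z make the numerator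
    nonnegative.\<close>
  define Q where "Q k = (J l (\<lambda>x. y k * w (\<tau> k) x) - J l (\<lambda>x. y k * z x)) / S (\<tau> k)" for k
  have Q_eq: "Q k = y k powr p * ((E (w (\<tau> k)) - E z) / S (\<tau> k)) / p
      - l * (y k powr a * ((H (w (\<tau> k)) - H z) / S (\<tau> k))) / a
      - y k powr s * ((B (w (\<tau> k)) - B z) / S (\<tau> k)) / s" for k
    unfolding Q_def Jy[OF wV] Jy[OF zV] by (simp add: diff_divide_distrib add_divide_distrib algebra_simps)
  have "Q \<longlonglongrightarrow> t0 powr p * (p * dE z v) / p - l * (t0 powr a * (a * dH z v)) / a - t0 powr s * (s * dB z v) / s"
    unfolding Q_eq using exponents
    by (intro tendsto_intros ypow quot\<tau>[OF dEz] quot\<tau>[OF dHz] quot\<tau>[OF dBz]) auto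
  then have Qlim: "Q \<longlonglongrightarrow> dE z v - l * dH z v - dB z v" using t01 exponents by simp
  have "S (\<tau> k) * Q k \<ge> 0" for k
  proof -
    have "S (\<tau> k) * Q k = J l (\<lambda>x. y k * w (\<tau> k) x) - J l (\<lambda>x. y k * z x)"
      using S(2)[of "\<tau> k"] by (simp add: Q_def)
    moreover have "J l (\<lambda>x. y k * z x) \<le> J l z" using zmax y(2)[of k] by simp
    ultimately show ?thesis using lower[of k] by simp
  qed
  then show ?thesis using \<tau> Qlim by blast
qed

text \<open>The increments 1/(k+1) and -1/(k+1) give the two one-sided inequalities for the
  derivative.\<close>

lemma minimiser_critical:
  assumes z: "z \<in> fibre_maximal" and min: "\<And>u. u \<in> fibre_maximal \<Longrightarrow> J l z \<le> J l u"
    and v: "v \<in> V"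
  shows "dE z v = l * dH z v + dB z v"
proof -
  have lim: "(\<lambda>k. c / real (Suc k)) \<longlonglongrightarrow> 0" for c :: real
    using LIMSEQ_Suc[OF lim_const_over_n] .
  obtain \<tau> Q where Q: "Q \<longlonglongrightarrow> dE z v - l * dH z v - dB z v" "\<And>k. 1 / real (Suc (\<tau> k)) * Q k \<ge> 0"
    using minimiser_variation[OF z min v lim[of 1]] by auto
  have "0 \<le> dE z v - l * dH z v - dB z v"
    by (rule LIMSEQ_le_const[OF Q(1)]) (use Q(2) in \<open>auto simp: field_simps\<close>)
  moreover obtain \<tau>' Q' where Q': "Q' \<longlonglongrightarrow> dE z v - l * dH z v - dB z v" "\<And>k. - 1 / real (Suc (\<tau>' k)) * Q' k \<ge> 0"
    using minimiser_variation[OF z min v lim[of "-1"]] by auto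
  have "dE z v - l * dH z v - dB z v \<le> 0"
    by (rule LIMSEQ_le_const2[OF Q'(1)]) (use Q'(2) in \<open>auto simp: field_simps\<close>)
  ultimately show ?thesis by simp
qed

lemma second_solution:
  obtains u where "u \<in> V" "\<And>x. 0 \<le> u x" "\<And>v. v \<in> V \<Longrightarrow> dE u v = l * dH u v + dB u v" "J l u > 0"
proof -
  define c where "c = (INF u\<in>fibre_maximal. J l u)"
  have bdd: "bdd_below (J l ` fibre_maximal)" by (rule bdd_belowI2[of _ d]) (rule fibre_maximal_ge)
  obtain w where w: "w \<in> fibre_maximal" using B_pos fibre_maximum by metis
  have c_le: "c \<le> J l u" if "u \<in> fibre_maximal" for u unfolding c_def using bdd that by (rule cINF_lower)
  have cd: "c \<ge> d" unfolding c_def using w by (intro cINF_greatest fibre_maximal_ge) auto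
  have "\<exists>u\<in>fibre_maximal. J l u < c + 1 / real (Suc k)" for k
  proof -
    have "(INF u\<in>fibre_maximal. J l u) < c + 1 / real (Suc k)" by (simp add: c_def)
    then show ?thesis using cINF_less_iff[OF _ bdd] w by blast
  qed
  then obtain U where U: "\<And>k. U k \<in> fibre_maximal" "\<And>k. J l (U k) < c + 1 / real (Suc k)" by metis
  have Jlim: "(\<lambda>k. J l (U k)) \<longlonglongrightarrow> c"
  proof (rule tendsto_sandwich[of "\<lambda>_. c" _ _ "\<lambda>k. c + 1 / real (Suc k)"])
    have "(\<lambda>k. c + 1 / real (Suc k)) \<longlonglongrightarrow> c + 0"
      by (intro tendsto_add tendsto_const LIMSEQ_Suc[OF lim_1_over_n])
    then show "(\<lambda>k. c + 1 / real (Suc k)) \<longlonglongrightarrow> c" by simp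
  qed (use U c_le in \<open>auto intro!: always_eventually less_imp_le\<close>)
  obtain T where T: "\<And>u. u \<in> fibre_maximal \<Longrightarrow> J l u \<le> c + 1 \<Longrightarrow> E u \<le> T"
    using fibre_maximal_coercive by blast
  have UV: "\<And>k. U k \<in> V" and UT: "\<And>k. E (U k) \<le> T"
  proof -
    show "U k \<in> V" for k using U(1) by (simp add: fibre_maximal_def)
    have "1 / real (Suc k) \<le> 1" for k by simp
    then show "E (U k) \<le> T" for k using T[OF U(1)[of k]] U(2)[of k] by (smt (verit, best))
  qed
  from compactness[of U, OF UV UT] obtain \<sigma> u e where \<sigma>: "strict_mono \<sigma>" "u \<in> V"
    "(\<lambda>k. E (U (\<sigma> k))) \<longlonglongrightarrow> e" "E u \<le> e"
    "(\<lambda>k. H (U (\<sigma> k))) \<longlonglongrightarrow> H u" "(\<lambda>k. B (U (\<sigma> k))) \<longlonglongrightarrow> B u" by blast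
  \<comment> \<open>The energy term in \<open>fibre_maximal_value\<close> is nonnegative because a <
    p. Hence \<open>B\<close> stays away from 0 along the sequence and remains positive in the
    limit.\<close>
  have "d \<le> B u * (1/a - 1/s)"
  proof (rule LIMSEQ_le_const)
    show "(\<lambda>k. B (U (\<sigma> k)) * (1/a - 1/s)) \<longlonglongrightarrow> B u * (1/a - 1/s)"
      by (intro tendsto_intros \<sigma>)
    have "d \<le> B (U k) * (1/a - 1/s)" for k
    proof -
      have "E (U k) * (1/a - 1/p) \<ge> 0"
        using E_nonneg[OF UV] exponents by (intro mult_nonneg_nonneg) (auto simp: frac_le)
      then show ?thesis using fibre_maximal_value[OF U(1)[of k]] fibre_maximal_ge[OF U(1)[of k]] by simp
    qed
    then show "\<exists>N. \<forall>k\<ge>N. d \<le> B (U (\<sigma> k)) * (1/a - 1/s)" by blast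
  qed
  then have "0 < B u * (1/a - 1/s)" using d_pos by simp
  moreover have "1/a - 1/s > 0" using exponents by (simp add: frac_less2)
  ultimately have Bu: "B u > 0" by (simp add: zero_less_mult_iff)
  \<comment> \<open>Lower semicontinuity of the energy for each fixed t, followed by maximality of
    \<open>U (\<sigma> k)\<close> on its own ray: the whole ray of u stays below the infimum
    c.\<close>
  have Jc: "J l (\<lambda>x. t * u x) \<le> c" if t: "t \<ge> 0" for t
  proof -
    have "J l (\<lambda>x. t * u x) \<le> t powr p * e / p - l * (t powr a * H u) / a - t powr s * B u / s"
      using J_scale[OF \<sigma>(2) t, of l] \<sigma>(4) exponents by (auto intro!: divide_right_mono mult_left_mono)
    also have "\<dots> \<le> c"
    proof (rule LIMSEQ_le)
      show "(\<lambda>k. J l (\<lambda>x. t * U (\<sigma> k) x)) \<longlonglongrightarrow>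
        t powr p * e / p - l * (t powr a * H u) / a - t powr s * B u / s"
        unfolding J_scale[OF UV t] using exponents by (intro tendsto_intros \<sigma>) auto
      show "(\<lambda>k. J l (U (\<sigma> k))) \<longlonglongrightarrow> c"
        using LIMSEQ_subseq_LIMSEQ[OF Jlim \<sigma>(1)] by (simp add: o_def)
      show "\<exists>N. \<forall>k\<ge>N. J l (\<lambda>x. t * U (\<sigma> k) x) \<le> J l (U (\<sigma> k))"
        using U(1) t by (auto simp: fibre_maximal_def)
    qed
    finally show ?thesis .
  qed
  \<comment> \<open>The modulus is taken before rescaling: with t the maximum point on the ray of y,
    J (t y) \<le> J (t u) \<le> c.\<close>
  define y where "y = (\<lambda>x. \<bar>u x\<bar>)"
  have y: "y \<in> V" "B y > 0" using V_abs[OF \<sigma>(2)] B_abs[OF \<sigma>(2)] Bu by (auto simp: y_def)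
  obtain t where t: "t > 0" "(\<lambda>x. t * y x) \<in> fibre_maximal" using fibre_maximum[OF y] by blast
  define z where "z = (\<lambda>x. t * y x)"
  have "J l z \<le> J l (\<lambda>x. t * u x)"
    using J_scale[OF y(1), of t l] J_scale[OF \<sigma>(2), of t l] t E_abs[OF \<sigma>(2)] exponents
    by (auto simp: z_def y_def H_abs[OF \<sigma>(2)] B_abs[OF \<sigma>(2)] intro!: divide_right_mono mult_left_mono)
  then have "J l z \<le> c" using Jc[of t] t by simp
  then have zc: "\<And>u. u \<in> fibre_maximal \<Longrightarrow> J l z \<le> J l u" using c_le by force
  have zF: "z \<in> fibre_maximal" using t by (simp add: z_def)
  show thesis
  proof (rule that)
    show "z \<in> V" using zF by (simp add: fibre_maximal_def)
    show "0 \<le> z x" for x using t by (simp add: z_def y_def)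
    show "dE z v = l * dH z v + dB z v" if "v \<in> V" for v using minimiser_critical[OF zF zc that] .
    show "J l z > 0" using fibre_maximal_ge[OF zF] d_pos by simp
  qed
qed

end

text \<open>The signs of \<open>J\<close> are kept in the conclusion because they exclude the zero
  function and tell the two critical points apart.\<close>

theorem (in concave_convex) two_critical_points:
  "\<exists>l0>0. \<forall>l. 0 < l \<and> l < l0 \<longrightarrow> (\<exists>u1\<in>V. \<exists>u2\<in>V.
     (\<forall>x. 0 \<le> u1 x) \<and> (\<forall>v\<in>V. dE u1 v = l * dH u1 v + dB u1 v) \<and> J l u1 < 0 \<and>
     (\<forall>x. 0 \<le> u2 x) \<and> (\<forall>v\<in>V. dE u2 v = l * dH u2 v + dB u2 v) \<and> J l u2 > 0)"
proof -
  obtain l0 \<rho> d where *: "l0 > 0" "\<rho> > 0" "d > 0"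
    "\<And>l u. 0 < l \<Longrightarrow> l < l0 \<Longrightarrow> u \<in> V \<Longrightarrow> E u = \<rho> powr p \<Longrightarrow> J l u \<ge> d"
    using positive_on_sphere by blast
  show ?thesis
  proof (intro exI[of _ l0] conjI allI impI)
    fix l assume l: "0 < l \<and> l < l0"
    interpret concave_convex_small V E H B dE dH dB a p s l \<rho> d
      by unfold_locales (use l * in auto)
    obtain u1 where u1: "u1 \<in> V" "\<And>x. 0 \<le> u1 x" "\<And>v. v \<in> V \<Longrightarrow> dE u1 v = l * dH u1 v + dB u1 v" "J l u1 < 0"
      using first_solution by blast
    obtain u2 where u2: "u2 \<in> V" "\<And>x. 0 \<le> u2 x" "\<And>v. v \<in> V \<Longrightarrow> dE u2 v = l * dH u2 v + dB u2 v" "J l u2 > 0"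
      using second_solution by blast
    show "\<exists>u1\<in>V. \<exists>u2\<in>V.
     (\<forall>x. 0 \<le> u1 x) \<and> (\<forall>v\<in>V. dE u1 v = l * dH u1 v + dB u1 v) \<and> J l u1 < 0 \<and>
     (\<forall>x. 0 \<le> u2 x) \<and> (\<forall>v\<in>V. dE u2 v = l * dH u2 v + dB u2 v) \<and> J l u2 > 0"
      using u1 u2 by blast
  qed (use * in simp)
qed

section \<open>Fractional Sobolev inequality and compactness\<close>

text \<open>With \<beta> = n + p \<alpha> its integral over x is the p-th power of the Gagliardo
  seminorm. Values in \<open>ennreal\<close> spare finiteness assumptions.\<close>

definition gagliardo_density :: "real \<Rightarrow> real \<Rightarrow> ('a::euclidean_space \<Rightarrow> real) \<Rightarrow> 'a \<Rightarrow> ennreal" where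
  "gagliardo_density p \<beta> u x =
     (\<integral>\<^sup>+y. ennreal (\<bar>u x - u y\<bar> powr p * norm (x - y) powr (- \<beta>)) \<partial>lborel)"

lemma borel_measurable_gagliardo_density [measurable]:
  assumes [measurable]: "u \<in> borel_measurable borel"
  shows "gagliardo_density p \<beta> u \<in> borel_measurable borel"
  unfolding gagliardo_density_def by measurable

lemma emeasure_ball_unit:
  fixes x :: "'a::euclidean_space"
  assumes "0 < \<rho>"
  shows "emeasure lborel (ball x \<rho>) = ennreal (unit_ball_vol (real DIM('a)) * \<rho> powr real DIM('a))"
  using assms emeasure_ball[of \<rho> x] by (simp add: powr_realpow)

text \<open>The radius is chosen so that the set \<open>{|u| \<ge> |u x| / 2}\<close>, small by Markov's inequality, fills at most
  half of the ball; on the other half \<open>|u x - u y| \<ge> |u x| / 2\<close>.\<close>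

lemma gagliardo_density_lower_bound:
  fixes u :: "'a::euclidean_space \<Rightarrow> real"
  assumes [measurable]: "u \<in> borel_measurable borel"
    and p: "0 < p" and \<beta>: "0 \<le> \<beta>" and s: "0 < s" and S: "0 < S" "(\<integral>\<^sup>+y. ennreal (\<bar>u y\<bar> powr s) \<partial>lborel) \<le> ennreal S"
    and x: "u x \<noteq> 0" and \<rho>: "0 < \<rho>"
    and vol: "unit_ball_vol (real DIM('a)) * \<rho> powr real DIM('a) = 2 * (S / (\<bar>u x\<bar> / 2) powr s)"
  shows "ennreal ((\<bar>u x\<bar> / 2) powr p * \<rho> powr (- \<beta>) * (S / (\<bar>u x\<bar> / 2) powr s)) \<le> gagliardo_density p \<beta> u x"
proof -
  define t where "t = \<bar>u x\<bar> / 2"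
  have t: "t > 0" using x by (simp add: t_def)
  define A where "A = {y. t \<le> \<bar>u y\<bar>}"
  have [measurable]: "A \<in> sets borel" unfolding A_def by measurable
  define m where "m = S / t powr s"
  have m: "m > 0" using S t by (simp add: m_def)
  have "ennreal (t powr s) * emeasure lborel A = (\<integral>\<^sup>+y. ennreal (t powr s) * indicator A y \<partial>lborel)"
    by (subst nn_integral_cmult_indicator) auto
  also have "\<dots> \<le> (\<integral>\<^sup>+y. ennreal (\<bar>u y\<bar> powr s) \<partial>lborel)"
    using t s by (intro nn_integral_mono) (auto simp: A_def indicator_def intro!: powr_mono2)
  also note S(2)
  finally have "ennreal (1 / t powr s) * (ennreal (t powr s) * emeasure lborel A) \<le> ennreal (1 / t powr s) * ennreal S"
    by (rule mult_left_mono) simp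
  then have A: "emeasure lborel A \<le> ennreal m"
    using t S by (simp add: m_def mult.assoc[symmetric] flip: ennreal_mult)
  have "ennreal (m + m) = emeasure lborel (ball x \<rho>)"
    using vol \<rho> by (subst emeasure_ball_unit) (auto simp: m_def t_def)
  also have "\<dots> \<le> emeasure lborel (ball x \<rho> - A) + emeasure lborel A"
    by (rule order_trans[OF emeasure_mono emeasure_subadditive]) auto
  also have "\<dots> \<le> emeasure lborel (ball x \<rho> - A) + ennreal m" using A by (rule add_left_mono)
  finally have D: "ennreal m \<le> emeasure lborel (ball x \<rho> - A)"
    using m by (cases "emeasure lborel (ball x \<rho> - A)") (auto simp flip: ennreal_plus)
  have "ennreal (t powr p * \<rho> powr (- \<beta>) * m) = ennreal (t powr p * \<rho> powr (- \<beta>)) * ennreal m"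
    using m by (intro ennreal_mult) auto
  also have "\<dots> \<le> ennreal (t powr p * \<rho> powr (- \<beta>)) * emeasure lborel (ball x \<rho> - A)"
    using D by (rule mult_left_mono) simp
  also have "\<dots> = (\<integral>\<^sup>+y. ennreal (t powr p * \<rho> powr (- \<beta>)) * indicator (ball x \<rho> - A) y \<partial>lborel)"
    by (subst nn_integral_cmult_indicator) auto
  also have "\<dots> \<le> gagliardo_density p \<beta> u x"
    unfolding gagliardo_density_def
  proof (intro nn_integral_mono)
    fix y
    have "t powr p * \<rho> powr (- \<beta>) \<le> \<bar>u x - u y\<bar> powr p * norm (x - y) powr (- \<beta>)" if y: "y \<in> ball x \<rho> - A"
    proof (intro mult_mono)
      have "\<bar>u y\<bar> < t" "\<bar>u x\<bar> = 2 * t" using y by (auto simp: A_def t_def)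
      then have "t \<le> \<bar>u x - u y\<bar>" "x \<noteq> y" using t by auto
      then show "t powr p \<le> \<bar>u x - u y\<bar> powr p" using t p by (intro powr_mono2) auto
      show "\<rho> powr - \<beta> \<le> norm (x - y) powr - \<beta>"
        using \<open>x \<noteq> y\<close> y \<beta> by (intro powr_mono2') (auto simp: dist_norm)
    qed auto
    then show "ennreal (t powr p * \<rho> powr (- \<beta>)) * indicator (ball x \<rho> - A) y
      \<le> ennreal (\<bar>u x - u y\<bar> powr p * norm (x - y) powr (- \<beta>))"
      by (auto simp: indicator_def intro!: ennreal_leI)
  qed
  finally show ?thesis by (simp add: t_def m_def)
qed

text \<open>\<open>dummy\<close> ties the locale to the type whose dimension is \<open>n\<close>;
  the real parameters do not mention that type.\<close>

locale fractional_exponents =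
  fixes p \<alpha> s n :: real and dummy :: "'a::euclidean_space itself"
  assumes p: "1 \<le> p" and \<alpha>: "0 < \<alpha>" and n: "n = real DIM('a)" "p * \<alpha> < n"
    and s_def: "s = n * p / (n - p * \<alpha>)"
begin

abbreviation F :: "('a \<Rightarrow> real) \<Rightarrow> 'a \<Rightarrow> ennreal" where
  "F \<equiv> gagliardo_density p (n + p * \<alpha>)"

text \<open>\<open>s_identity\<close> is the scaling relation of the critical exponent; it balances
  the powers of |u x| in \<open>pointwise_sobolev\<close>.\<close>

lemma n_pos: "0 < n" and s_pos: "0 < s" and s_gt: "p < s" and s_identity: "s * (p * \<alpha> / n) = s - p"
proof -
  have a: "0 < p * \<alpha>" using p \<alpha> by simp
  show "0 < n" using n a by linarith
  show "0 < s" unfolding s_def using \<open>0 < n\<close> n p by simp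
  show "p < s" unfolding s_def using \<open>0 < n\<close> n mult_pos_pos[OF _ a, of p] p by (simp add: less_divide_eq algebra_simps)
  show "s * (p * \<alpha> / n) = s - p"
    unfolding s_def using \<open>0 < n\<close> n p by (simp add: field_simps)
qed

definition "\<omega> = unit_ball_vol n"
text \<open>Inverts the constants of \<open>gagliardo_density_lower_bound\<close>: 2^p undoes (|u
  x|/2)^p, 2/\<omega> undoes the mass of half a ball divided by \<rho>^n, and the last factor undoes
  the constant in \<rho>^(-p \<alpha>).\<close>

definition "sobolev_const = 2 powr p * (2 / \<omega>) * (2 powr (s + 1) / \<omega>) powr (p * \<alpha> / n)"

lemma \<omega>_pos: "0 < \<omega>" using n_pos by (simp add: \<omega>_def)
lemma sobolev_const_pos: "0 < sobolev_const" using \<omega>_pos by (simp add: sobolev_const_def)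

text \<open>With \<rho>^n proportional to S / |u x|^s the lower bound for \<open>F u x\<close>
  becomes a constant times |u x|^(p + s \<kappa>) S^(-\<kappa>), where \<kappa> = p \<alpha> / n; by
  \<open>s_identity\<close> the exponent of |u x| is s.\<close>

lemma pointwise_sobolev:
  assumes [measurable]: "u \<in> borel_measurable borel"
    and S: "0 < S" "(\<integral>\<^sup>+y. ennreal (\<bar>u y\<bar> powr s) \<partial>lborel) \<le> ennreal S"
  shows "ennreal (\<bar>u x\<bar> powr s) \<le> ennreal (sobolev_const * S powr (p * \<alpha> / n)) * F u x"
proof (cases "u x = 0")
  case False
  define a where "a = \<bar>u x\<bar>"
  have a: "a > 0" using False by (simp add: a_def)
  define \<kappa> where "\<kappa> = p * \<alpha> / n"
  define R where "R = 2 powr (s + 1) / \<omega> * S * a powr (- s)"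
  have R: "R > 0" using S \<omega>_pos a by (simp add: R_def)
  define \<rho> where "\<rho> = R powr (1 / n)"
  have \<rho>: "\<rho> > 0" using R by (simp add: \<rho>_def)
  have \<rho>n: "\<rho> powr n = R" using n_pos R by (simp add: \<rho>_def powr_powr)
  have half: "(a / 2) powr s = a powr s / 2 powr s" using a by (simp add: powr_divide)
  have vol: "\<omega> * \<rho> powr n = 2 * (S / (a / 2) powr s)"
    unfolding \<rho>n R_def half using \<omega>_pos a by (simp add: powr_minus powr_add field_simps)
  have "ennreal ((a / 2) powr p * \<rho> powr (- (n + p * \<alpha>)) * (S / (a / 2) powr s)) \<le> F u x"
    unfolding a_def
  proof (rule gagliardo_density_lower_bound)
    show "unit_ball_vol (real DIM('a)) * \<rho> powr real DIM('a) = 2 * (S / (\<bar>u x\<bar> / 2) powr s)"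
      unfolding n(1)[symmetric] \<omega>_def[symmetric] using vol by (simp add: a_def)
  qed (use p n_pos s_pos \<alpha> S False \<rho> in \<open>auto simp: mult_nonneg_nonneg\<close>)
  then have "ennreal (sobolev_const * S powr \<kappa>) * ennreal ((a / 2) powr p * \<rho> powr (- (n + p * \<alpha>)) * (S / (a / 2) powr s))
      \<le> ennreal (sobolev_const * S powr \<kappa>) * F u x" by (rule mult_left_mono) simp
  moreover have "(sobolev_const * S powr \<kappa>) * ((a / 2) powr p * \<rho> powr (- (n + p * \<alpha>)) * (S / (a / 2) powr s)) = a powr s"
  proof -
    have "S / (a / 2) powr s = (\<omega> * \<rho> powr n) / 2" unfolding vol by simp
    then have "\<rho> powr (- (n + p * \<alpha>)) * (S / (a / 2) powr s) = \<rho> powr (- (n + p * \<alpha>)) * \<rho> powr n * (\<omega> / 2)"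
      by (simp only:) simp
    also have "\<rho> powr (- (n + p * \<alpha>)) * \<rho> powr n = \<rho> powr (- (p * \<alpha>))" by (simp flip: powr_add)
    also have "\<rho> powr (- (p * \<alpha>)) = R powr (- \<kappa>)" by (simp add: \<rho>_def powr_powr \<kappa>_def)
    also have "R powr (- \<kappa>) = (2 powr (s + 1) / \<omega>) powr (- \<kappa>) * S powr (- \<kappa>) * a powr (s * \<kappa>)"
      using S \<omega>_pos a by (simp add: R_def powr_mult powr_powr powr_divide)
    finally have "(a / 2) powr p * \<rho> powr (- (n + p * \<alpha>)) * (S / (a / 2) powr s)
      = (a / 2) powr p * ((2 powr (s + 1) / \<omega>) powr (- \<kappa>) * S powr (- \<kappa>) * a powr (s * \<kappa>) * (\<omega> / 2))"
      by (simp only: mult.assoc)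
    then have "(sobolev_const * S powr \<kappa>) * ((a / 2) powr p * \<rho> powr (- (n + p * \<alpha>)) * (S / (a / 2) powr s))
      = (sobolev_const * S powr \<kappa>) * ((a / 2) powr p * ((2 powr (s + 1) / \<omega>) powr (- \<kappa>) * S powr (- \<kappa>) * a powr (s * \<kappa>) * (\<omega> / 2)))"
      by (simp only:)
    also have "\<dots> = (2 powr p * (a / 2) powr p * a powr (s * \<kappa>)) * (2 / \<omega> * (\<omega> / 2)) *
        ((2 powr (s + 1) / \<omega>) powr \<kappa> * (2 powr (s + 1) / \<omega>) powr (- \<kappa>)) * (S powr \<kappa> * S powr (- \<kappa>))"
      unfolding sobolev_const_def \<kappa>_def[symmetric] by (simp only: mult_ac)
    also have "\<dots> = a powr p * a powr (s * \<kappa>)"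
      using \<omega>_pos a S by (simp add: powr_divide flip: powr_add)
    also have "\<dots> = a powr s" using s_identity by (simp add: \<kappa>_def flip: powr_add)
    finally show ?thesis .
  qed
  ultimately show ?thesis
    using sobolev_const_pos S by (simp add: a_def \<kappa>_def flip: ennreal_mult)
qed simp

text \<open>At the critical exponent \<open>s\<close> the pointwise bound integrates to
  \<open>N \<le> C T N\<^bsup>1 - p/s\<^esup>\<close> for \<open>N = \<integral>|u|\<^sup>s\<close>, which can be solved for \<open>N\<close> if \<open>N\<close> is finite; truncation
  removes that proviso.\<close>

lemma sobolev_finite:
  assumes [measurable]: "u \<in> borel_measurable borel"
    and fin: "(\<integral>\<^sup>+y. ennreal (\<bar>u y\<bar> powr s) \<partial>lborel) < \<infinity>"
    and T: "0 < T" "(\<integral>\<^sup>+x. F u x \<partial>lborel) \<le> ennreal T"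
  shows "(\<integral>\<^sup>+y. ennreal (\<bar>u y\<bar> powr s) \<partial>lborel) \<le> ennreal ((sobolev_const * T) powr (s / p))"
proof -
  obtain N where N: "N \<ge> 0" "(\<integral>\<^sup>+y. ennreal (\<bar>u y\<bar> powr s) \<partial>lborel) = ennreal N"
    using fin by (cases "\<integral>\<^sup>+y. ennreal (\<bar>u y\<bar> powr s) \<partial>lborel") auto
  show ?thesis
  proof (cases "N = 0")
    case False
    then have Np: "N > 0" using N by simp
    define \<kappa> where "\<kappa> = p * \<alpha> / n"
    have "ennreal N \<le> (\<integral>\<^sup>+x. ennreal (sobolev_const * N powr \<kappa>) * F u x \<partial>lborel)"
      unfolding N(2)[symmetric] \<kappa>_def using Np N by (intro nn_integral_mono pointwise_sobolev) auto
    also have "\<dots> = ennreal (sobolev_const * N powr \<kappa>) * (\<integral>\<^sup>+x. F u x \<partial>lborel)"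
      by (intro nn_integral_cmult) auto
    also have "\<dots> \<le> ennreal (sobolev_const * N powr \<kappa>) * ennreal T"
      using T(2) by (rule mult_left_mono) simp
    finally have "N \<le> sobolev_const * N powr \<kappa> * T"
      using T sobolev_const_pos Np by (simp flip: ennreal_mult)
    then have "N powr (1 - \<kappa>) \<le> sobolev_const * T"
      using Np by (simp add: powr_diff field_simps)
    then have "(N powr (1 - \<kappa>)) powr (s / p) \<le> (sobolev_const * T) powr (s / p)"
      using s_pos p by (intro powr_mono2) auto
    moreover have "(1 - \<kappa>) * (s / p) = 1"
    proof -
      have "(1 - \<kappa>) * s = p" using s_identity by (simp add: \<kappa>_def algebra_simps)
      then show ?thesis using p by simp
    qed
    ultimately have "N \<le> (sobolev_const * T) powr (s / p)"
      using Np powr_one[of N] by (simp only: powr_powr less_imp_le)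
    then show ?thesis unfolding N(2) by (rule ennreal_leI)
  qed (use N in simp)
qed

lemma sobolev:
  assumes [measurable]: "u \<in> borel_measurable borel"
    and \<Omega>: "\<Omega> \<in> sets borel" "emeasure lborel \<Omega> < \<infinity>" "\<And>x. x \<notin> \<Omega> \<Longrightarrow> u x = 0"
    and T: "0 < T" "(\<integral>\<^sup>+x. F u x \<partial>lborel) \<le> ennreal T"
  shows "(\<integral>\<^sup>+y. ennreal (\<bar>u y\<bar> powr s) \<partial>lborel) \<le> ennreal ((sobolev_const * T) powr (s / p))"
proof -
  define v where "v k x = min \<bar>u x\<bar> (real k)" for k x
  have [measurable]: "v k \<in> borel_measurable borel" for k unfolding v_def[abs_def] by measurable
  have bound: "(\<integral>\<^sup>+y. ennreal (\<bar>v k y\<bar> powr s) \<partial>lborel) \<le> ennreal ((sobolev_const * T) powr (s / p))" for k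
  proof (rule sobolev_finite)
    have "(\<integral>\<^sup>+y. ennreal (\<bar>v k y\<bar> powr s) \<partial>lborel) \<le> (\<integral>\<^sup>+y. ennreal (real k powr s) * indicator \<Omega> y \<partial>lborel)"
      using \<Omega>(3) s_pos by (intro nn_integral_mono) (auto simp: v_def indicator_def intro!: powr_mono2)
    also have "\<dots> = ennreal (real k powr s) * emeasure lborel \<Omega>"
      using \<Omega> by (subst nn_integral_cmult_indicator) auto
    also have "\<dots> < \<infinity>" using \<Omega> by (simp add: ennreal_mult_less_top)
    finally show "(\<integral>\<^sup>+y. ennreal (\<bar>v k y\<bar> powr s) \<partial>lborel) < \<infinity>" .
    \<comment> \<open>Taking the modulus and truncating is 1-Lipschitz, so the density does not
      increase.\<close>
    have "F (v k) x \<le> F u x" for x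
      unfolding gagliardo_density_def v_def using p
      by (intro nn_integral_mono ennreal_leI mult_right_mono powr_mono2) auto
    then show "(\<integral>\<^sup>+x. F (v k) x \<partial>lborel) \<le> ennreal T"
      using T(2) by (meson nn_integral_mono order_trans)
  qed (use T in auto)
  have lim: "(\<lambda>k. ennreal (\<bar>v k y\<bar> powr s)) \<longlonglongrightarrow> ennreal (\<bar>u y\<bar> powr s)" for y
  proof (rule tendsto_eventually)
    obtain k0 where "\<bar>u y\<bar> \<le> real k0" using real_arch_simple by blast
    then show "\<forall>\<^sub>F k in sequentially. ennreal (\<bar>v k y\<bar> powr s) = ennreal (\<bar>u y\<bar> powr s)"
      by (intro eventually_mono[OF eventually_ge_at_top[of k0]]) (auto simp: v_def min_def)
  qed
  have "(\<integral>\<^sup>+y. ennreal (\<bar>u y\<bar> powr s) \<partial>lborel) = (\<integral>\<^sup>+y. liminf (\<lambda>k. ennreal (\<bar>v k y\<bar> powr s)) \<partial>lborel)"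
    by (intro nn_integral_cong lim_imp_Liminf[OF _ lim, symmetric]) simp
  also have "\<dots> \<le> liminf (\<lambda>k. \<integral>\<^sup>+y. ennreal (\<bar>v k y\<bar> powr s) \<partial>lborel)"
    by (intro nn_integral_liminf) auto
  also have "\<dots> \<le> ennreal ((sobolev_const * T) powr (s / p))"
    using bound by (intro Liminf_le) auto
  finally show ?thesis .
qed

text \<open>Instead of Hoelder's inequality, \<open>d \<le> \<epsilon> + \<epsilon>\<^bsup>1 - p\<^esup> d\<^sup>p\<close> with \<open>\<epsilon> = \<rho>\<^sup>\<alpha>\<close>.\<close>

lemma average_deviation:
  assumes [measurable]: "u \<in> borel_measurable borel" and u: "integrable lborel u"
    and \<rho>: "0 < \<rho>" and x: "x \<in> ball z \<rho>"
  shows "ennreal \<bar>u x - (LINT y|lborel. indicator (ball z \<rho>) y * u y) / (\<omega> * \<rho> powr n)\<bar>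
    \<le> ennreal (\<rho> powr \<alpha>) * (1 + ennreal (2 powr (n + p * \<alpha>) / \<omega>) * F u x)"
proof -
  define G where "G = ball z \<rho>"
  define \<beta> where "\<beta> = n + p * \<alpha>"
  define V where "V = \<omega> * \<rho> powr n"
  have \<beta>: "0 \<le> \<beta>" using n_pos p \<alpha> by (simp add: \<beta>_def)
  have V: "0 < V" using \<omega>_pos \<rho> by (simp add: V_def)
  have emG: "emeasure lborel G = ennreal V"
    unfolding G_def emeasure_ball_unit[OF \<rho>] V_def \<omega>_def n(1)[symmetric] ..
  have [measurable]: "G \<in> sets borel" by (simp add: G_def)
  have mG: "measure lborel G = V" using emG V by (simp add: measure_def)
  have Gfin: "emeasure lborel G < \<infinity>" using emG by simp
  have i1: "integrable lborel (\<lambda>y. indicator G y * u y)"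
    using integrable_mult_indicator[of G lborel u] u by simp
  have i2: "integrable lborel (\<lambda>y. indicator G y * u x)"
    using Gfin by (intro integrable_mult_left integrable_real_indicator) auto
  have "(LINT y|lborel. indicator G y * (u x - u y)) = V * u x - (LINT y|lborel. indicator G y * u y)"
    using i1 i2 mG by (simp add: right_diff_distrib)
  then have "u x - (LINT y|lborel. indicator G y * u y) / V = (LINT y|lborel. indicator G y * (u x - u y)) / V"
    using V by (simp add: field_simps)
  then have eq: "\<bar>u x - (LINT y|lborel. indicator G y * u y) / V\<bar> = 1 / V * \<bar>LINT y|lborel. indicator G y * (u x - u y)\<bar>"
    using V by (simp add: abs_divide)
  \<comment> \<open>Both x and y lie in a ball of radius \<rho>, hence (2 \<rho>)^\<beta>
    |x-y|^(-\<beta>) \<ge> 1 off the diagonal; this factor inserts the kernel.\<close>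
  have pw: "ennreal (norm (indicator G y * (u x - u y))) \<le> ennreal (\<rho> powr \<alpha>) * indicator G y +
    ennreal (\<rho> powr (\<alpha> - p * \<alpha>) * (2 * \<rho>) powr \<beta>) * ennreal (\<bar>u x - u y\<bar> powr p * norm (x - y) powr (- \<beta>))" for y
  proof (cases "y \<in> G")
    case True
    define d where "d = \<bar>u x - u y\<bar>"
    have "d \<le> \<rho> powr \<alpha> + (\<rho> powr (\<alpha> - p * \<alpha>) * (2 * \<rho>) powr \<beta>) * (d powr p * norm (x - y) powr (- \<beta>))"
    proof (cases "d \<le> \<rho> powr \<alpha>")
      case True
      then show ?thesis by (simp add: add_increasing2)
    next
      case False
      then have dp: "d > \<rho> powr \<alpha>" "d > 0" using powr_ge_zero[of \<rho> \<alpha>] by linarith+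
      then have xy: "x \<noteq> y" by (auto simp: d_def)
      have "norm (x - y) \<le> 2 * \<rho>"
        using x \<open>y \<in> G\<close> dist_triangle2[of x y z] by (simp add: G_def dist_norm[symmetric] dist_commute)
      then have "1 \<le> (2 * \<rho>) powr \<beta> * norm (x - y) powr (- \<beta>)"
        using xy \<beta> powr_mono2[of \<beta> "norm (x - y)" "2 * \<rho>"] by (simp add: powr_minus divide_simps)
      moreover have "d \<le> \<rho> powr (\<alpha> - p * \<alpha>) * d powr p"
      proof -
        have "d powr (1 - p) \<le> (\<rho> powr \<alpha>) powr (1 - p)"
          using dp p \<rho> by (intro powr_mono2') auto
        then have "d powr (1 - p) * d powr p \<le> \<rho> powr (\<alpha> - p * \<alpha>) * d powr p"
          by (intro mult_right_mono) (auto simp: powr_powr algebra_simps)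
        then show ?thesis using dp by (simp flip: powr_add)
      qed
      ultimately have "d * 1 \<le> (\<rho> powr (\<alpha> - p * \<alpha>) * d powr p) * ((2 * \<rho>) powr \<beta> * norm (x - y) powr (- \<beta>))"
        using dp by (intro mult_mono) auto
      then show ?thesis by (simp add: mult_ac add_increasing)
    qed
    then show ?thesis
      using True by (simp add: d_def flip: ennreal_plus ennreal_mult)
  qed simp
  have "ennreal \<bar>LINT y|lborel. indicator G y * (u x - u y)\<bar> \<le> (\<integral>\<^sup>+y. ennreal (norm (indicator G y * (u x - u y))) \<partial>lborel)"
    unfolding real_norm_def[symmetric] using i1 i2 by (intro integral_norm_bound_ennreal) (simp add: right_diff_distrib)
  also have "\<dots> \<le> (\<integral>\<^sup>+y. ennreal (\<rho> powr \<alpha>) * indicator G y +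
    ennreal (\<rho> powr (\<alpha> - p * \<alpha>) * (2 * \<rho>) powr \<beta>) * ennreal (\<bar>u x - u y\<bar> powr p * norm (x - y) powr (- \<beta>)) \<partial>lborel)"
    by (intro nn_integral_mono pw)
  also have "\<dots> = ennreal (\<rho> powr \<alpha>) * ennreal V + ennreal (\<rho> powr (\<alpha> - p * \<alpha>) * (2 * \<rho>) powr \<beta>) * F u x"
    using emG by (simp add: nn_integral_add nn_integral_cmult gagliardo_density_def \<beta>_def)
  finally have "ennreal (1 / V) * ennreal \<bar>LINT y|lborel. indicator G y * (u x - u y)\<bar>
    \<le> ennreal (1 / V) * (ennreal (\<rho> powr \<alpha>) * ennreal V + ennreal (\<rho> powr (\<alpha> - p * \<alpha>) * (2 * \<rho>) powr \<beta>) * F u x)"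
    by (rule mult_left_mono) simp
  also have "\<dots> = ennreal (1 / V * (\<rho> powr \<alpha> * V)) + ennreal (1 / V * (\<rho> powr (\<alpha> - p * \<alpha>) * (2 * \<rho>) powr \<beta>)) * F u x"
  proof -
    have "ennreal (1 / V) * (ennreal (\<rho> powr \<alpha>) * ennreal V) = ennreal (1 / V * (\<rho> powr \<alpha> * V))"
      using V by (simp flip: ennreal_mult)
    moreover have "ennreal (1 / V) * (ennreal B * X) = ennreal (1 / V * B) * X" if "0 \<le> B" for B X
      using V that by (subst ennreal_mult) (auto simp: mult.assoc)
    ultimately show ?thesis by (simp only: distrib_left) simp
  qed
  also have "1 / V * (\<rho> powr \<alpha> * V) = \<rho> powr \<alpha>" using V by simp
  \<comment> \<open>The exponents of \<rho> collapse, \<alpha> - p \<alpha> + \<beta> - n =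
    \<alpha>, leaving a factor that tends to 0 with the radius.\<close>
  also have "1 / V * (\<rho> powr (\<alpha> - p * \<alpha>) * (2 * \<rho>) powr \<beta>) = \<rho> powr \<alpha> * (2 powr \<beta> / \<omega>)"
  proof -
    have "\<rho> powr (\<alpha> - p * \<alpha>) * (2 * \<rho>) powr \<beta> = 2 powr \<beta> * (\<rho> powr (\<alpha> - p * \<alpha>) * \<rho> powr \<beta>)"
      using \<rho> by (simp add: powr_mult)
    also have "\<rho> powr (\<alpha> - p * \<alpha>) * \<rho> powr \<beta> = \<rho> powr \<alpha> * \<rho> powr n"
      by (simp add: \<beta>_def flip: powr_add)
    finally show ?thesis using V \<rho> \<omega>_pos by (simp add: V_def)
  qed
  also have "ennreal (\<rho> powr \<alpha> * (2 powr \<beta> / \<omega>)) = ennreal (\<rho> powr \<alpha>) * ennreal (2 powr \<beta> / \<omega>)"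
    using \<omega>_pos by (intro ennreal_mult) auto
  also have "ennreal (1 / V) * ennreal \<bar>LINT y|lborel. indicator G y * (u x - u y)\<bar> =
      ennreal \<bar>u x - (LINT y|lborel. indicator G y * u y) / V\<bar>"
    unfolding eq using V by (intro ennreal_mult[symmetric]) auto
  finally show ?thesis
    unfolding V_def G_def \<beta>_def by (simp only: distrib_left mult.assoc mult_1_right)
qed

text \<open>A diagonal argument makes the averages over finitely many balls of each radius converge; by the
  previous bound the sequence is then Cauchy in \<open>L\<^sup>1\<close>. Bounding \<open>U\<^sub>i x - U\<^sub>j x\<close> by functions of \<open>x\<close> alone
  avoids a measurable choice of the ball containing \<open>x\<close>.\<close>

lemma compactness_AE:
  fixes U :: "nat \<Rightarrow> 'a \<Rightarrow> real"
  assumes meas [measurable]: "\<And>k. U k \<in> borel_measurable borel"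
    and \<Omega>: "\<Omega> \<in> sets borel" "bounded \<Omega>" "\<And>k x. x \<notin> \<Omega> \<Longrightarrow> U k x = 0"
    and T: "0 < T" "\<And>k. (\<integral>\<^sup>+x. F (U k) x \<partial>lborel) \<le> ennreal T"
  obtains \<sigma> where "strict_mono \<sigma>" "AE x in lborel. convergent (\<lambda>k. U (\<sigma> k) x)"
proof -
  note [measurable] = \<Omega>(1)
  have em\<Omega>: "emeasure lborel \<Omega> < \<infinity>" using \<Omega>(2) by (rule emeasure_bounded_finite)
  define c where "c = measure lborel \<Omega>"
  have c: "emeasure lborel \<Omega> = ennreal c" "0 \<le> c"
    using em\<Omega> by (auto simp: c_def emeasure_eq_ennreal_measure)
  define C where "C = c + (sobolev_const * T) powr (s / p)"
  have bound: "(\<integral>\<^sup>+x. ennreal \<bar>U k x\<bar> \<partial>lborel) \<le> ennreal C" for k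
  proof -
    have "(\<integral>\<^sup>+x. ennreal \<bar>U k x\<bar> \<partial>lborel) \<le> (\<integral>\<^sup>+x. indicator \<Omega> x + ennreal (\<bar>U k x\<bar> powr s) \<partial>lborel)"
    proof (intro nn_integral_mono)
      fix x
      have "\<bar>U k x\<bar> \<le> 1 + \<bar>U k x\<bar> powr s"
        using powr_le_one_add_powr[of 1 s "\<bar>U k x\<bar>"] s_gt p by simp
      then have "ennreal \<bar>U k x\<bar> \<le> 1 + ennreal (\<bar>U k x\<bar> powr s)"
        by (simp flip: ennreal_1 ennreal_plus)
      then show "ennreal \<bar>U k x\<bar> \<le> indicator \<Omega> x + ennreal (\<bar>U k x\<bar> powr s)"
        using \<Omega>(3)[of x k] by (cases "x \<in> \<Omega>") auto
    qed
    also have "\<dots> = ennreal c + (\<integral>\<^sup>+x. ennreal (\<bar>U k x\<bar> powr s) \<partial>lborel)"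
      by (subst nn_integral_add) (auto simp: c)
    also have "\<dots> \<le> ennreal c + ennreal ((sobolev_const * T) powr (s / p))"
      using sobolev[OF meas \<Omega>(1) em\<Omega> \<Omega>(3) T] by (rule add_left_mono)
    also have "\<dots> = ennreal C" using c by (simp add: C_def ennreal_plus)
    finally show ?thesis .
  qed
  have C: "0 \<le> C" using c by (simp add: C_def)
  have int: "integrable lborel (U k)" for k
    using bound[of k] by (intro integrableI_bounded) (auto simp: le_less_trans)
  define \<delta> where "\<delta> m = 1 / real (Suc m)" for m
  have \<delta>: "0 < \<delta> m" for m by (simp add: \<delta>_def)
  have "\<exists>Z. finite Z \<and> \<Omega> \<subseteq> (\<Union>z\<in>Z. ball z (\<delta> m))" for m
  proof -
    have "compact (closure \<Omega>)" using \<Omega>(2) by simp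
    then obtain Z where "finite Z" "closure \<Omega> \<subseteq> (\<Union>z\<in>Z. ball z (\<delta> m))"
      using \<delta>[of m] unfolding compact_eq_totally_bounded by blast
    then show ?thesis using closure_subset by blast
  qed
  then obtain Z where Z: "\<And>m. finite (Z m)" "\<And>m. \<Omega> \<subseteq> (\<Union>z\<in>Z m. ball z (\<delta> m))" by metis
  \<comment> \<open>Integrals instead of averages: all of them share the bound \<open>C\<close>,
    whatever the radius, and the volume is divided out later.\<close>
  define I where "I k = (\<lambda>(m, z). LINT y|lborel. indicator (ball z (\<delta> m)) y * U k y)" for k
  have Ibound: "norm (I k i) \<le> C" for k i
  proof -
    obtain m z where i: "i = (m, z)" by (cases i)
    have "integrable lborel (\<lambda>y. indicator (ball z (\<delta> m)) y * U k y)"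
      using integrable_mult_indicator[of "ball z (\<delta> m)" lborel "U k"] int by simp
    then have "ennreal (norm (I k i)) \<le> (\<integral>\<^sup>+y. norm (indicator (ball z (\<delta> m)) y * U k y) \<partial>lborel)"
      unfolding I_def i prod.case by (rule integral_norm_bound_ennreal)
    also have "\<dots> \<le> (\<integral>\<^sup>+x. ennreal \<bar>U k x\<bar> \<partial>lborel)"
      by (intro nn_integral_mono) (auto simp: indicator_def)
    also note bound
    finally show ?thesis using C by simp
  qed
  have cnt: "countable (\<Union>m. {m} \<times> Z m)" using Z(1) by (intro countable_UN countable_SIGMA) (auto intro: countable_finite)
  obtain r where r: "strict_mono r" "\<And>i. i \<in> (\<Union>m. {m} \<times> Z m) \<Longrightarrow> \<exists>l. (\<lambda>k. I (r k) i) \<longlonglongrightarrow> l"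
  proof (rule function_convergent_subsequence[OF cnt, of I C], goal_cases)
    case (1 k i)
    show ?case by (rule Ibound)
  next
    case (2 k)
    show ?case by (rule 2(1)[OF 2(2,3)])
  qed
  define W where "W k = U (r k)" for k
  define D where "D = 2 powr (n + p * \<alpha>) / \<omega>"
  have D: "0 \<le> D" using \<omega>_pos by (simp add: D_def)
  \<comment> \<open>The first term, the deviation from the averages, is uniform in i and j. Hence m
    can be fixed first and the indices afterwards.\<close>
  have est: "(LINT x|lborel. norm (W i x - W j x)) \<le> \<delta> m powr \<alpha> * (2 * c + 2 * D * T) + \<eta> * c"
    if \<eta>: "0 \<le> \<eta>" "\<And>z. z \<in> Z m \<Longrightarrow> \<bar>I (r i) (m, z) - I (r j) (m, z)\<bar> / (\<omega> * \<delta> m powr n) \<le> \<eta>" for i j m \<eta>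
  proof -
    define d where "d = \<delta> m powr \<alpha>"
    have d: "0 \<le> d" by (simp add: d_def)
    have pw: "ennreal (norm (W i x - W j x)) \<le>
      ennreal (2 * d + \<eta>) * indicator \<Omega> x + (ennreal (d * D) * F (W i) x + ennreal (d * D) * F (W j) x)" for x
    proof (cases "x \<in> \<Omega>")
      case True
      then obtain z where z: "z \<in> Z m" "x \<in> ball z (\<delta> m)" using Z(2) by blast
      define A where "A k = I (r k) (m, z) / (\<omega> * \<delta> m powr n)" for k
      have dev: "ennreal \<bar>W k x - A k\<bar> \<le> ennreal d + ennreal (d * D) * F (W k) x" for k
      proof -
        have "ennreal \<bar>W k x - A k\<bar> \<le> ennreal d * (1 + ennreal D * F (W k) x)"
          using average_deviation[of "W k" "\<delta> m" x z] int \<delta>[of m] z(2)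
          by (simp add: W_def A_def I_def D_def d_def)
        also have "\<dots> = ennreal d + ennreal (d * D) * F (W k) x"
          using d D by (simp add: distrib_left ennreal_mult mult.assoc)
        finally show ?thesis .
      qed
      have "\<bar>A i - A j\<bar> \<le> \<eta>"
        using \<eta>(2)[OF z(1)] \<omega>_pos \<delta>[of m] by (simp add: A_def flip: diff_divide_distrib)
      then have "norm (W i x - W j x) \<le> \<bar>W i x - A i\<bar> + \<bar>W j x - A j\<bar> + \<eta>"
        unfolding real_norm_def by linarith
      then have "ennreal (norm (W i x - W j x)) \<le> ennreal \<bar>W i x - A i\<bar> + ennreal \<bar>W j x - A j\<bar> + ennreal \<eta>"
        using \<eta>(1) by (simp flip: ennreal_plus)
      also have "\<dots> \<le> (ennreal d + ennreal (d * D) * F (W i) x) + (ennreal d + ennreal (d * D) * F (W j) x) + ennreal \<eta>"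
        by (intro add_mono dev order_refl)
      also have "\<dots> = ennreal (2 * d + \<eta>) + (ennreal (d * D) * F (W i) x + ennreal (d * D) * F (W j) x)"
      proof -
        have "ennreal (2 * d + \<eta>) = ennreal d + ennreal d + ennreal \<eta>"
          using d \<eta>(1) by (simp flip: ennreal_plus)
        then show ?thesis by (simp add: add_ac)
      qed
      finally show ?thesis using True by simp
    qed (use \<Omega>(3) in \<open>simp add: W_def\<close>)
    have [measurable]: "W k \<in> borel_measurable borel" for k by (simp add: W_def)
    have FT: "(\<integral>\<^sup>+x. F (W k) x \<partial>lborel) \<le> ennreal T" for k using T(2) by (simp add: W_def)
    have "ennreal (LINT x|lborel. norm (W i x - W j x)) = (\<integral>\<^sup>+x. ennreal (norm (W i x - W j x)) \<partial>lborel)"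
      using int by (intro nn_integral_eq_integral[symmetric]) (auto simp: W_def)
    also have "\<dots> \<le> (\<integral>\<^sup>+x. ennreal (2 * d + \<eta>) * indicator \<Omega> x + (ennreal (d * D) * F (W i) x + ennreal (d * D) * F (W j) x) \<partial>lborel)"
      by (intro nn_integral_mono pw)
    also have "\<dots> = ennreal (2 * d + \<eta>) * ennreal c + (ennreal (d * D) * (\<integral>\<^sup>+x. F (W i) x \<partial>lborel) + ennreal (d * D) * (\<integral>\<^sup>+x. F (W j) x \<partial>lborel))"
      by (simp add: nn_integral_add nn_integral_cmult c)
    also have "\<dots> \<le> ennreal (2 * d + \<eta>) * ennreal c + (ennreal (d * D) * ennreal T + ennreal (d * D) * ennreal T)"
      by (intro add_mono mult_left_mono FT) auto
    also have "\<dots> = ennreal ((2 * d + \<eta>) * c + (d * D * T + d * D * T))"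
      using d D T c(2) \<eta>(1) by (simp flip: ennreal_mult ennreal_plus)
    finally have "(LINT x|lborel. norm (W i x - W j x)) \<le> (2 * d + \<eta>) * c + (d * D * T + d * D * T)"
      using d D T c(2) \<eta>(1) by (subst (asm) ennreal_le_iff) auto
    then show ?thesis by (simp add: d_def algebra_simps)
  qed
  have cauchy: "\<exists>N. \<forall>i\<ge>N. \<forall>j\<ge>N. (LINT x|lborel. norm (W i x - W j x)) < e" if e: "e > 0" for e
  proof -
    define B where "B = 2 * c + 2 * D * T"
    have B: "0 \<le> B" using c D T by (simp add: B_def)
    have "(\<lambda>m. \<delta> m powr \<alpha> * B) \<longlonglongrightarrow> 0 powr \<alpha> * B"
      unfolding \<delta>_def using \<alpha> LIMSEQ_Suc[OF lim_1_over_n[where 'a=real]]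
      by (intro tendsto_intros tendsto_powr') (auto intro!: always_eventually)
    then have "eventually (\<lambda>m. \<delta> m powr \<alpha> * B < e / 2) sequentially"
      using e by (intro order_tendstoD) auto
    then obtain m where m: "\<delta> m powr \<alpha> * B < e / 2" by (auto simp: eventually_sequentially)
    \<comment> \<open>For c = 0 the quotient e / (2 c) would be 0 by convention, hence c +
      1.\<close>
    define \<eta> where "\<eta> = e / (2 * (c + 1))"
    have \<eta>: "0 < \<eta>" "\<eta> * c < e / 2" using e c by (auto simp: \<eta>_def field_simps)
    define V where "V = \<omega> * \<delta> m powr n"
    have V: "V > 0" using \<omega>_pos \<delta>[of m] by (simp add: V_def)
    have "\<forall>z\<in>Z m. \<exists>N. \<forall>i\<ge>N. \<forall>j\<ge>N. \<bar>I (r i) (m, z) - I (r j) (m, z)\<bar> < \<eta> * V"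
    proof
      fix z assume "z \<in> Z m"
      then have "Cauchy (\<lambda>k. I (r k) (m, z))" using r(2)[of "(m, z)"] LIMSEQ_imp_Cauchy by blast
      then show "\<exists>N. \<forall>i\<ge>N. \<forall>j\<ge>N. \<bar>I (r i) (m, z) - I (r j) (m, z)\<bar> < \<eta> * V"
        using \<eta>(1) V by (auto simp: Cauchy_def dist_real_def)
    qed
    then obtain N where N: "\<And>z i j. z \<in> Z m \<Longrightarrow> i \<ge> N z \<Longrightarrow> j \<ge> N z \<Longrightarrow> \<bar>I (r i) (m, z) - I (r j) (m, z)\<bar> < \<eta> * V"
      by metis
    \<comment> \<open>Inserting 0 keeps the maximum meaningful when \<open>Z m\<close> is
      empty.\<close>
    have "(LINT x|lborel. norm (W i x - W j x)) < e" if ij: "i \<ge> Max (insert 0 (N ` Z m))" "j \<ge> Max (insert 0 (N ` Z m))" for i j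
    proof -
      have "\<bar>I (r i) (m, z) - I (r j) (m, z)\<bar> / (\<omega> * \<delta> m powr n) \<le> \<eta>" if z: "z \<in> Z m" for z
      proof -
        have "N z \<le> Max (insert 0 (N ` Z m))" using z Z(1) by (intro Max_ge) auto
        then have "\<bar>I (r i) (m, z) - I (r j) (m, z)\<bar> < \<eta> * V" using ij z by (intro N) auto
        then show ?thesis unfolding V_def[symmetric] using V by (simp add: pos_divide_le_eq)
      qed
      then have "(LINT x|lborel. norm (W i x - W j x)) \<le> \<delta> m powr \<alpha> * B + \<eta> * c"
        unfolding B_def using \<eta>(1) by (intro est) auto
      then show ?thesis using m \<eta>(2) by linarith
    qed
    then show ?thesis by blast
  qed
  have "\<And>k. integrable lborel (W k)" using int by (simp add: W_def)
  from cauchy_L1_AE_cauchy_subseq[OF this cauchy] obtain r' where r': "strict_mono r'"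
    "AE x in lborel. Cauchy (\<lambda>k. W (r' k) x)" by blast
  show thesis
  proof (rule that[of "r \<circ> r'"])
    show "strict_mono (r \<circ> r')" using r(1) r'(1) by (rule strict_mono_o)
    show "AE x in lborel. convergent (\<lambda>k. U ((r \<circ> r') k) x)"
      using r'(2) by eventually_elim (simp add: W_def Cauchy_convergent)
  qed
qed

end

section \<open>Lebesgue measurability on products\<close>

lemma vimage_fst_null_sets:
  fixes N :: "'a::euclidean_space set"
  assumes "N \<in> null_sets lborel"
  shows "(fst :: 'a \<times> 'b::euclidean_space \<Rightarrow> 'a) -` N \<in> null_sets lborel"
proof -
  have N: "N \<in> sets lborel" "emeasure lborel N = 0" using assms by auto
  have "(fst :: 'a \<times> 'b \<Rightarrow> 'a) -` N = N \<times> UNIV" by auto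
  moreover have "emeasure (lborel \<Otimes>\<^sub>M lborel) (N \<times> (UNIV :: 'b set)) = 0"
    using N by (subst lborel.emeasure_pair_measure_Times) auto
  moreover have "N \<times> (UNIV :: 'b set) \<in> sets (lborel \<Otimes>\<^sub>M lborel)" using N by auto
  ultimately show ?thesis unfolding lborel_prod by (simp add: null_sets_def)
qed

lemma vimage_snd_null_sets:
  fixes N :: "'b::euclidean_space set"
  assumes "N \<in> null_sets lborel"
  shows "(snd :: 'a::euclidean_space \<times> 'b \<Rightarrow> 'b) -` N \<in> null_sets lborel"
proof -
  have N: "N \<in> sets lborel" "emeasure lborel N = 0" using assms by auto
  have "(snd :: 'a \<times> 'b \<Rightarrow> 'b) -` N = UNIV \<times> N" by auto
  moreover have "emeasure (lborel \<Otimes>\<^sub>M lborel) ((UNIV :: 'a set) \<times> N) = 0"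
    using N by (subst lborel.emeasure_pair_measure_Times) auto
  moreover have "(UNIV :: 'a set) \<times> N \<in> sets (lborel \<Otimes>\<^sub>M lborel)" using N by auto
  ultimately show ?thesis unfolding lborel_prod by (simp add: null_sets_def)
qed

text \<open>The slices at a fixed second coordinate are translates of N, so Tonelli applies.\<close>

lemma vimage_diff_null_sets:
  fixes N :: "'a::euclidean_space set"
  assumes "N \<in> null_sets lborel"
  shows "(\<lambda>z::'a \<times> 'a. fst z - snd z) -` N \<in> null_sets lborel"
proof -
  have [measurable]: "N \<in> sets borel" using assms by auto
  have m: "(\<lambda>z::'a \<times> 'a. fst z - snd z) -` N \<in> sets borel"
  proof -
    have "(\<lambda>z::'a \<times> 'a. fst z - snd z) \<in> borel_measurable borel"
      by (intro borel_measurable_continuous_onI continuous_intros)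
    from measurable_sets[OF this, of N] show ?thesis by simp
  qed
  then have m2: "(\<lambda>z::'a \<times> 'a. fst z - snd z) -` N \<in> sets (lborel \<Otimes>\<^sub>M lborel)"
    unfolding lborel_prod by simp
  have "emeasure (lborel \<Otimes>\<^sub>M lborel) ((\<lambda>z::'a \<times> 'a. fst z - snd z) -` N) =
    (\<integral>\<^sup>+y. emeasure lborel ((\<lambda>x. (x, y)) -` ((\<lambda>z. fst z - snd z) -` N)) \<partial>lborel)"
    using m2 by (rule lborel_pair.emeasure_pair_measure_alt2)
  also have "\<dots> = (\<integral>\<^sup>+y. 0 \<partial>(lborel :: 'a measure))"
  proof (intro nn_integral_cong)
    fix y :: 'a
    have "(\<lambda>x. (x, y)) -` ((\<lambda>z. fst z - snd z) -` N) = {x. x - y \<in> N}" by auto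
    then show "emeasure lborel ((\<lambda>x. (x, y)) -` ((\<lambda>z. fst z - snd z) -` N)) = 0"
      using null_sets_translation[OF assms, of y] by auto
  qed
  finally show ?thesis using m unfolding lborel_prod by (simp add: null_sets_def)
qed

lemma AE_vimage:
  fixes T :: "'b::euclidean_space \<Rightarrow> 'a::euclidean_space"
  assumes "\<And>N. N \<in> null_sets lborel \<Longrightarrow> T -` N \<in> null_sets lborel" and "AE x in lborel. P x"
  shows "AE z in lborel. P (T z)"
proof -
  obtain N where N: "{x \<in> space lborel. \<not> P x} \<subseteq> N" "N \<in> null_sets lborel"
    using assms(2) by (auto elim!: AE_E simp: null_sets_def)
  show ?thesis by (rule AE_I'[OF assms(1)[OF N(2)]]) (use N(1) in auto)
qed

text \<open>Precomposing a Lebesgue measurable function with a Borel map can destroy measurability;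
  it does not if null sets pull back to null sets.\<close>

lemma lebesgue_measurable_compose:
  fixes T :: "'b::euclidean_space \<Rightarrow> 'a::euclidean_space"
  assumes T: "T \<in> borel_measurable borel" "\<And>N. N \<in> null_sets lborel \<Longrightarrow> T -` N \<in> null_sets lborel"
    and f: "f \<in> lebesgue \<rightarrow>\<^sub>M M"
  shows "(\<lambda>x. f (T x)) \<in> lebesgue \<rightarrow>\<^sub>M M"
proof -
  have T': "T \<in> lebesgue \<rightarrow>\<^sub>M lborel" using T(1) by (intro measurable_completion) simp
  have "T \<in> lebesgue \<rightarrow>\<^sub>M lebesgue"
  proof (rule completion.measurable_completion2[OF T'])
    show "null_sets lborel \<subseteq> null_sets (distr lebesgue lborel T)"
    proof
      fix N assume N: "N \<in> null_sets (lborel :: 'a measure)"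
      then have "T -` N \<in> null_sets lebesgue" using T(2) by (simp add: null_sets_completionI)
      then show "N \<in> null_sets (distr lebesgue lborel T)"
        using N T' by (auto simp: null_sets_def emeasure_distr)
    qed
  qed
  then show ?thesis using f by (rule measurable_compose)
qed

lemma AE_fst: "AE x in lborel. P x \<Longrightarrow> AE z in lborel. P (fst z)"
  and AE_snd: "AE x in lborel. P x \<Longrightarrow> AE z in lborel. P (snd z)"
  and AE_diff: "AE x in lborel. P x \<Longrightarrow> AE z in lborel. P (fst z - snd z)"
  by (rule AE_vimage, erule vimage_fst_null_sets vimage_snd_null_sets vimage_diff_null_sets, assumption)+

lemma lebesgue_measurable_fst: "f \<in> lebesgue \<rightarrow>\<^sub>M M \<Longrightarrow> (\<lambda>z. f (fst z)) \<in> lebesgue \<rightarrow>\<^sub>M M"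
  and lebesgue_measurable_snd: "f \<in> lebesgue \<rightarrow>\<^sub>M M \<Longrightarrow> (\<lambda>z. f (snd z)) \<in> lebesgue \<rightarrow>\<^sub>M M"
  and lebesgue_measurable_diff: "f \<in> lebesgue \<rightarrow>\<^sub>M M \<Longrightarrow> (\<lambda>z. f (fst z - snd z)) \<in> lebesgue \<rightarrow>\<^sub>M M"
  by (auto intro!: lebesgue_measurable_compose vimage_fst_null_sets vimage_snd_null_sets vimage_diff_null_sets
      borel_measurable_continuous_onI continuous_intros)

section \<open>Transfer of integrals, Fatou's lemma and translation invariance\<close>

lemma nn_integral_lebesgue_on:
  assumes "S \<in> sets lebesgue"
  shows "(\<integral>\<^sup>+x. f x \<partial>lebesgue_on S) = (\<integral>\<^sup>+x. f x * indicator S x \<partial>lborel)"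
  using assms by (simp add: nn_integral_restrict_space nn_integral_completion)

lemma AE_lebesgue_on_iff:
  assumes "S \<in> sets lebesgue"
  shows "(AE x in lebesgue_on S. P x) \<longleftrightarrow> (AE x in lborel. x \<in> S \<longrightarrow> P x)"
  using assms by (simp add: AE_restrict_space_iff AE_completion_iff)

lemma integrable_if_nn_integral_le:
  assumes "f \<in> borel_measurable M" "\<And>x. 0 \<le> f x" "(\<integral>\<^sup>+x. ennreal (f x) \<partial>M) \<le> ennreal C" "0 \<le> C"
  shows "integrable M f" "integral\<^sup>L M f \<le> C"
proof -
  show I: "integrable M f"
    using assms by (intro integrableI_nonneg) (auto simp: le_less_trans)
  have "ennreal (integral\<^sup>L M f) \<le> ennreal C"
    using nn_integral_eq_integral[OF I] assms by auto
  then show "integral\<^sup>L M f \<le> C" using assms(4) by simp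
qed

text \<open>The bounds \<open>c k\<close> may vary, and their limit bounds the result. This yields
  \<open>energy u \<le> e\<close> in \<open>X0_compactness\<close> with \<open>e\<close> the limit
  of the energies.\<close>

lemma Fatou_powr:
  fixes f :: "nat \<Rightarrow> 'x \<Rightarrow> real"
  assumes [measurable]: "\<And>k. f k \<in> borel_measurable M" "g \<in> borel_measurable M" and p: "0 < p"
    and lim: "AE x in M. (\<lambda>k. f k x) \<longlonglongrightarrow> g x"
    and bound: "\<And>k. (\<integral>\<^sup>+x. ennreal (\<bar>f k x\<bar> powr p) \<partial>M) \<le> ennreal (c k)" and c: "c \<longlonglongrightarrow> C" "0 \<le> C"
  shows "integrable M (\<lambda>x. \<bar>g x\<bar> powr p)" "(\<integral>x. \<bar>g x\<bar> powr p \<partial>M) \<le> C"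
proof -
  have "(\<integral>\<^sup>+x. ennreal (\<bar>g x\<bar> powr p) \<partial>M) = (\<integral>\<^sup>+x. liminf (\<lambda>k. ennreal (\<bar>f k x\<bar> powr p)) \<partial>M)"
  proof (rule nn_integral_cong_AE)
    show "AE x in M. ennreal (\<bar>g x\<bar> powr p) = liminf (\<lambda>k. ennreal (\<bar>f k x\<bar> powr p))"
      using lim
    proof eventually_elim
      case (elim x)
      have "(\<lambda>k. \<bar>f k x\<bar> powr p) \<longlonglongrightarrow> \<bar>g x\<bar> powr p"
        using elim p by (intro tendsto_powr' tendsto_intros) (auto intro!: always_eventually)
      then have "(\<lambda>k. ennreal (\<bar>f k x\<bar> powr p)) \<longlonglongrightarrow> ennreal (\<bar>g x\<bar> powr p)"
        by (rule tendsto_ennrealI)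
      then show ?case by (intro lim_imp_Liminf[symmetric]) auto
    qed
  qed
  also have "\<dots> \<le> liminf (\<lambda>k. \<integral>\<^sup>+x. ennreal (\<bar>f k x\<bar> powr p) \<partial>M)"
    by (intro nn_integral_liminf) measurable
  also have "\<dots> \<le> liminf (\<lambda>k. ennreal (c k))"
    using bound by (intro Liminf_mono always_eventually) auto
  also have "\<dots> = ennreal C" using c(1) by (intro lim_imp_Liminf tendsto_ennrealI) auto
  finally show "integrable M (\<lambda>x. \<bar>g x\<bar> powr p)" "(\<integral>x. \<bar>g x\<bar> powr p \<partial>M) \<le> C"
    using c(2) by (auto intro!: integrable_if_nn_integral_le)
qed

lemma nn_integral_lborel_reflect:
  fixes f :: "'a::euclidean_space \<Rightarrow> ennreal"
  assumes [measurable]: "f \<in> borel_measurable borel"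
  shows "(\<integral>\<^sup>+y. f (x - y) \<partial>lborel) = (\<integral>\<^sup>+y. f y \<partial>lborel)"
proof -
  have "lborel = distr lborel borel (\<lambda>y::'a. x - y)"
    using lborel_affine[of "-1" x] by (simp add: density_1)
  then have "(\<integral>\<^sup>+y. f y \<partial>lborel) = (\<integral>\<^sup>+y. f y \<partial>distr lborel borel (\<lambda>y::'a. x - y))" by simp
  also have "\<dots> = (\<integral>\<^sup>+y. f (x - y) \<partial>lborel)" by (subst nn_integral_distr) auto
  finally show ?thesis ..
qed

lemma nn_integral_lborel_shift:
  fixes f :: "'a::euclidean_space \<Rightarrow> ennreal"
  assumes [measurable]: "f \<in> borel_measurable borel"
  shows "(\<integral>\<^sup>+x. f (x - y) \<partial>lborel) = (\<integral>\<^sup>+x. f x \<partial>lborel)"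
proof -
  have "(\<integral>\<^sup>+x. f x \<partial>lborel) = (\<integral>\<^sup>+x. f x \<partial>distr lborel borel ((+) (- y)))" by (simp add: lborel_distr_plus)
  also have "\<dots> = (\<integral>\<^sup>+x. f (x - y) \<partial>lborel)" by (subst nn_integral_distr) auto
  finally show ?thesis ..
qed


section \<open>The energy space\<close>

locale nonlocal_problem =
  fixes \<Omega> :: "'a::euclidean_space set" and K :: "'a \<Rightarrow> real" and p \<alpha> \<theta> pstar :: real
  assumes open_\<Omega>: "open \<Omega>" and bounded_\<Omega>: "bounded \<Omega>"
    and p: "1 < p" and \<alpha>: "0 < \<alpha>" and dim: "p * \<alpha> < real DIM('a)"
    and pstar: "pstar = critical_exponent (real DIM('a)) p \<alpha>"
    and K_measurable: "K \<in> borel_measurable (lebesgue_on (UNIV - {0}))"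
    and K_pos: "\<And>x. x \<noteq> 0 \<Longrightarrow> 0 < K x"
    and K_integrable: "integrable lebesgue (\<lambda>x. min 1 (norm x powr p) * K x)"
    and \<theta>: "0 < \<theta>"
    and K_lower: "\<And>x. x \<noteq> 0 \<Longrightarrow> \<theta> * norm x powr (- (real DIM('a) + p * \<alpha>)) \<le> K x"
begin

abbreviation "Q \<equiv> Q_set \<Omega>"
abbreviation "X0 \<equiv> space_X0 p K \<Omega>"
sublocale frac: fractional_exponents p \<alpha> pstar "real DIM('a)" "TYPE('a)"
  by unfold_locales (use p \<alpha> dim pstar in \<open>auto simp: critical_exponent_def\<close>)

text \<open>Linear in u: the energy becomes the integral of the p-th power of a linear image of u,
  to which the lemmas on integrals of powers apply with weight 1.\<close>

definition quot :: "('a \<Rightarrow> real) \<Rightarrow> 'a \<times> 'a \<Rightarrow> real" where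
  "quot u = (\<lambda>(x, y). (u x - u y) * K (x - y) powr (1 / p))"

definition energy :: "('a \<Rightarrow> real) \<Rightarrow> real" where
  "energy u = (LINT z|lebesgue_on Q. \<bar>quot u z\<bar> powr p)"

lemma Q_sets: "Q \<in> sets lebesgue"
proof -
  have "Q = \<Omega> \<times> UNIV \<union> UNIV \<times> \<Omega>" by (auto simp: Q_set_def)
  then have "open Q" using open_\<Omega> by (simp add: open_Times open_Un)
  then show ?thesis by simp
qed

lemma \<Omega>_sets: "\<Omega> \<in> sets lebesgue" using open_\<Omega> by simp

lemma \<Omega>_emeasure: "emeasure lborel \<Omega> < \<infinity>" using bounded_\<Omega> by (rule emeasure_bounded_finite)

lemma finite_measure_\<Omega>: "finite_measure (lebesgue_on \<Omega>)"
  using \<Omega>_emeasure open_\<Omega> by (intro finite_measureI) (simp add: emeasure_restrict_space)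

lemma quot_add: "quot (\<lambda>x. u x + t * v x) z = quot u z + t * quot v z"
  by (simp add: quot_def case_prod_beta algebra_simps)

lemma quot_abs_le: "\<bar>quot (\<lambda>x. \<bar>u x\<bar>) z\<bar> \<le> \<bar>quot u z\<bar>"
  unfolding quot_def case_prod_beta abs_mult by (intro mult_right_mono) auto

lemma quot_powr:
  assumes "x \<noteq> y"
  shows "\<bar>quot u (x, y)\<bar> powr p = \<bar>u x - u y\<bar> powr p * K (x - y)"
  using K_pos[of "x - y"] assms p by (simp add: quot_def abs_mult powr_mult powr_powr)

lemma quot_measurable:
  assumes "u \<in> borel_measurable lebesgue"
  shows "quot u \<in> borel_measurable lebesgue"
proof -
  \<comment> \<open>Measurability of \<open>K\<close> is given away from 0 only. The value at 0 may
    be changed, as it meets the factor u x - u y = 0 on the diagonal.\<close>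
  define K0 where "K0 x = (if x \<in> UNIV - {0} then K x else 0)" for x
  have K0: "K0 \<in> borel_measurable lebesgue"
    unfolding K0_def using K_measurable by (subst borel_measurable_if) auto
  have "quot u = (\<lambda>z. (u (fst z) - u (snd z)) * K0 (fst z - snd z) powr (1 / p))"
    by (auto simp: quot_def K0_def fun_eq_iff)
  also have "\<dots> \<in> borel_measurable lebesgue"
    using lebesgue_measurable_fst[OF assms] lebesgue_measurable_snd[OF assms] lebesgue_measurable_diff[OF K0]
    by measurable
  finally show ?thesis .
qed

lemma quot_measurable_Q:
  "u \<in> borel_measurable lebesgue \<Longrightarrow> quot u \<in> borel_measurable (lebesgue_on Q)"
  by (intro measurable_restrict_space1 quot_measurable)

lemma X0_iff:
  "u \<in> X0 \<longleftrightarrow> u \<in> borel_measurable lebesgue \<and> integrable (lebesgue_on \<Omega>) (\<lambda>x. \<bar>u x\<bar> powr p) \<and>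
    integrable (lebesgue_on Q) (\<lambda>z. \<bar>quot u z\<bar> powr p) \<and> (AE x in lborel. x \<notin> \<Omega> \<longrightarrow> u x = 0)"
proof -
  have "u \<in> X0 \<longleftrightarrow> u \<in> borel_measurable lebesgue \<and> in_Lp p \<Omega> u \<and> in_Lp p Q (quot u) \<and>
      (AE x in lborel. x \<notin> \<Omega> \<longrightarrow> u x = 0)"
    unfolding space_X0_def space_X_def quot_def AE_completion_iff by blast
  then show ?thesis
    unfolding in_Lp_def using quot_measurable_Q[of u] measurable_restrict_space1[of u lebesgue borel \<Omega>] by blast
qed

lemma X0_add:
  assumes u: "u \<in> X0" and v: "v \<in> X0"
  shows "(\<lambda>x. u x + t * v x) \<in> X0"
  unfolding X0_iff
proof (intro conjI)
  have m: "u \<in> borel_measurable lebesgue" "v \<in> borel_measurable lebesgue" using u v by (auto simp: X0_iff)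
  then show "(\<lambda>x. u x + t * v x) \<in> borel_measurable lebesgue" by measurable
  show "integrable (lebesgue_on \<Omega>) (\<lambda>x. \<bar>u x + t * v x\<bar> powr p)"
    using integrable_powr_combination[of p u "lebesgue_on \<Omega>" v "\<lambda>_. 1" t] u v p m
    by (simp add: X0_iff measurable_restrict_space1)
  show "integrable (lebesgue_on Q) (\<lambda>z. \<bar>quot (\<lambda>x. u x + t * v x) z\<bar> powr p)"
    using integrable_powr_combination[of p "quot u" "lebesgue_on Q" "quot v" "\<lambda>_. 1" t] u v p m
    by (simp add: X0_iff quot_add quot_measurable_Q)
  have "AE x in lborel. x \<notin> \<Omega> \<longrightarrow> u x = 0" "AE x in lborel. x \<notin> \<Omega> \<longrightarrow> v x = 0" using u v by (auto simp: X0_iff)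
  then show "AE x in lborel. x \<notin> \<Omega> \<longrightarrow> u x + t * v x = 0" by eventually_elim simp
qed

lemma X0_abs:
  assumes u: "u \<in> X0"
  shows "(\<lambda>x. \<bar>u x\<bar>) \<in> X0" "energy (\<lambda>x. \<bar>u x\<bar>) \<le> energy u"
proof -
  have m: "u \<in> borel_measurable lebesgue" and I: "integrable (lebesgue_on Q) (\<lambda>z. \<bar>quot u z\<bar> powr p)"
    and ae: "AE x in lborel. x \<notin> \<Omega> \<longrightarrow> u x = 0" using u by (auto simp: X0_iff)
  then have am: "(\<lambda>x. \<bar>u x\<bar>) \<in> borel_measurable lebesgue" by measurable
  have le: "\<bar>quot (\<lambda>x. \<bar>u x\<bar>) z\<bar> powr p \<le> \<bar>quot u z\<bar> powr p" for z
    using quot_abs_le p by (intro powr_mono2) auto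
  have I': "integrable (lebesgue_on Q) (\<lambda>z. \<bar>quot (\<lambda>x. \<bar>u x\<bar>) z\<bar> powr p)"
  proof (rule Bochner_Integration.integrable_bound[OF I])
    show "(\<lambda>z. \<bar>quot (\<lambda>x. \<bar>u x\<bar>) z\<bar> powr p) \<in> borel_measurable (lebesgue_on Q)"
      using quot_measurable_Q[OF am] by measurable
    show "AE z in lebesgue_on Q. norm (\<bar>quot (\<lambda>x. \<bar>u x\<bar>) z\<bar> powr p) \<le> norm (\<bar>quot u z\<bar> powr p)"
      using le by (intro AE_I2) simp
  qed
  show "(\<lambda>x. \<bar>u x\<bar>) \<in> X0" using u am I' ae by (simp add: X0_iff)
  show "energy (\<lambda>x. \<bar>u x\<bar>) \<le> energy u"
    unfolding energy_def by (intro integral_mono I I' le)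
qed

lemma energy_nonneg: "0 \<le> energy u" unfolding energy_def by simp

lemma energy_scale: "0 \<le> t \<Longrightarrow> energy (\<lambda>x. t * u x) = t powr p * energy u"
proof -
  assume t: "0 \<le> t"
  have "\<bar>quot (\<lambda>x. t * u x) z\<bar> powr p = t powr p * \<bar>quot u z\<bar> powr p" for z
  proof -
    have "quot (\<lambda>x. t * u x) z = t * quot u z" by (simp add: quot_def case_prod_beta algebra_simps)
    then show ?thesis using t by (simp add: abs_mult powr_mult)
  qed
  then show ?thesis by (simp add: energy_def)
qed

text \<open>A null set of points spoils only a null set of pairs, by pulling it back along both
  projections.\<close>

lemma energy_cong:
  assumes "u \<in> borel_measurable lebesgue" "v \<in> borel_measurable lebesgue" "AE x in lborel. u x = v x"
  shows "energy u = energy v"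
  unfolding energy_def
proof (rule integral_cong_AE)
  show "(\<lambda>z. \<bar>quot u z\<bar> powr p) \<in> borel_measurable (lebesgue_on Q)"
    "(\<lambda>z. \<bar>quot v z\<bar> powr p) \<in> borel_measurable (lebesgue_on Q)"
    using quot_measurable_Q[OF assms(1)] quot_measurable_Q[OF assms(2)] by measurable
  have "AE z in lborel. quot u z = quot v z"
    using AE_fst[OF assms(3)] AE_snd[OF assms(3)] by eventually_elim (simp add: quot_def case_prod_beta)
  then show "AE z in lebesgue_on Q. \<bar>quot u z\<bar> powr p = \<bar>quot v z\<bar> powr p"
    unfolding AE_lebesgue_on_iff[OF Q_sets] by eventually_elim simp
qed

lemma nn_integral_energy:
  assumes "integrable (lebesgue_on Q) (\<lambda>z. \<bar>quot u z\<bar> powr p)"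
  shows "(\<integral>\<^sup>+z. ennreal (\<bar>quot u z\<bar> powr p) \<partial>lebesgue_on Q) = ennreal (energy u)"
  unfolding energy_def using assms by (intro nn_integral_eq_integral) auto

text \<open>The Lebesgue measure of the product space is not the product of the Lebesgue measures, only its
  completion; Fubini is therefore applied to Borel representatives.\<close>

lemma X0_representative:
  assumes u: "u \<in> X0"
  obtains v where "v \<in> borel_measurable borel" "\<And>x. x \<notin> \<Omega> \<Longrightarrow> v x = 0" "AE x in lborel. u x = v x"
    "(\<integral>\<^sup>+x. frac.F v x \<partial>lborel) \<le> ennreal (energy u / \<theta>)"
proof -
  have um: "u \<in> borel_measurable lebesgue" and I: "integrable (lebesgue_on Q) (\<lambda>z. \<bar>quot u z\<bar> powr p)"
    and ae: "AE x in lborel. x \<notin> \<Omega> \<longrightarrow> u x = 0" using u by (auto simp: X0_iff)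
  obtain w where w: "w \<in> borel_measurable borel" "AE x in lborel. u x = w x"
    using completion_ex_borel_measurable_real[OF um] by auto
  define v where "v x = indicator \<Omega> x * w x" for x
  have [measurable]: "\<Omega> \<in> sets borel" using open_\<Omega> by simp
  have v [measurable]: "v \<in> borel_measurable borel" unfolding v_def using w(1) by measurable
  have v0: "v x = 0" if "x \<notin> \<Omega>" for x using that by (simp add: v_def)
  have uv: "AE x in lborel. u x = v x"
    using w(2) ae by eventually_elim (auto simp: v_def indicator_def)
  define \<beta> where "\<beta> = real DIM('a) + p * \<alpha>"
  have pw: "AE z in lborel. ennreal \<theta> * ennreal (\<bar>v (fst z) - v (snd z)\<bar> powr p * norm (fst z - snd z) powr (- \<beta>))
      \<le> ennreal (\<bar>quot u z\<bar> powr p) * indicator Q z"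
    using AE_fst[OF uv] AE_snd[OF uv]
  proof eventually_elim
    case (elim z)
    obtain x y where z: "z = (x, y)" by (cases z)
    show ?case
    \<comment> \<open>Outside \<open>Q\<close> both points lie off \<Omega>, where v vanishes, and
      on the diagonal the difference is 0. Thus the integral over \<open>Q\<close> already controls
      the one over the whole product.\<close>
    proof (cases "x = y \<or> z \<notin> Q")
      case True
      then have "v x = v y" using v0 by (auto simp: z Q_set_def)
      then show ?thesis by (simp add: z)
    next
      case False
      then have "\<theta> * (\<bar>v x - v y\<bar> powr p * norm (x - y) powr (- \<beta>)) \<le> \<bar>v x - v y\<bar> powr p * K (x - y)"
        using mult_left_mono[OF K_lower[of "x - y"], of "\<bar>v x - v y\<bar> powr p"] by (simp add: \<beta>_def mult_ac)
      also have "\<dots> = \<bar>quot u z\<bar> powr p" using False elim quot_powr[of x y u] by (simp add: z)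
      finally show ?thesis using False \<theta> by (simp add: z ennreal_leI flip: ennreal_mult)
    qed
  qed
  have "ennreal \<theta> * (\<integral>\<^sup>+x. frac.F v x \<partial>lborel) =
      ennreal \<theta> * (\<integral>\<^sup>+z. ennreal (\<bar>v (fst z) - v (snd z)\<bar> powr p * norm (fst z - snd z) powr (- \<beta>)) \<partial>(lborel \<Otimes>\<^sub>M lborel))"
    unfolding gagliardo_density_def \<beta>_def by (subst lborel.nn_integral_fst[symmetric]) auto
  also have "\<dots> = (\<integral>\<^sup>+z. ennreal \<theta> * ennreal (\<bar>v (fst z) - v (snd z)\<bar> powr p * norm (fst z - snd z) powr (- \<beta>)) \<partial>(lborel \<Otimes>\<^sub>M lborel))"
    by (intro nn_integral_cmult[symmetric]) measurable
  also have "\<dots> \<le> (\<integral>\<^sup>+z. ennreal (\<bar>quot u z\<bar> powr p) * indicator Q z \<partial>lborel)"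
    unfolding lborel_prod by (rule nn_integral_mono_AE[OF pw])
  also have "\<dots> = ennreal (energy u)"
    unfolding nn_integral_lebesgue_on[OF Q_sets, symmetric] by (rule nn_integral_energy[OF I])
  finally have "ennreal (1 / \<theta>) * (ennreal \<theta> * (\<integral>\<^sup>+x. frac.F v x \<partial>lborel)) \<le> ennreal (1 / \<theta>) * ennreal (energy u)"
    by (rule mult_left_mono) simp
  also have "ennreal (1 / \<theta>) * (ennreal \<theta> * (\<integral>\<^sup>+x. frac.F v x \<partial>lborel)) = (\<integral>\<^sup>+x. frac.F v x \<partial>lborel)"
    using \<theta> by (simp flip: ennreal_mult mult.assoc)
  also have "ennreal (1 / \<theta>) * ennreal (energy u) = ennreal (energy u / \<theta>)"
    using \<theta> energy_nonneg by (simp flip: ennreal_mult)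
  finally show thesis using that[OF v v0 uv] by blast
qed


section \<open>Embedding and compactness of the energy space\<close>

lemma X0_sobolev:
  assumes u: "u \<in> X0" and T: "energy u \<le> T" "0 < T"
  shows "integrable (lebesgue_on \<Omega>) (\<lambda>x. \<bar>u x\<bar> powr pstar)"
    and "(LINT x|lebesgue_on \<Omega>. \<bar>u x\<bar> powr pstar) \<le> (frac.sobolev_const * (T / \<theta>)) powr (pstar / p)"
proof -
  obtain v where v: "v \<in> borel_measurable borel" "\<And>x. x \<notin> \<Omega> \<Longrightarrow> v x = 0" "AE x in lborel. u x = v x"
    "(\<integral>\<^sup>+x. frac.F v x \<partial>lborel) \<le> ennreal (energy u / \<theta>)" using X0_representative[OF u] by blast
  have um: "u \<in> borel_measurable (lebesgue_on \<Omega>)" using u by (simp add: X0_iff measurable_restrict_space1)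
  have "(\<integral>\<^sup>+x. ennreal (\<bar>u x\<bar> powr pstar) \<partial>lebesgue_on \<Omega>) = (\<integral>\<^sup>+x. ennreal (\<bar>u x\<bar> powr pstar) * indicator \<Omega> x \<partial>lborel)"
    by (rule nn_integral_lebesgue_on[OF \<Omega>_sets])
  also have "\<dots> \<le> (\<integral>\<^sup>+x. ennreal (\<bar>v x\<bar> powr pstar) \<partial>lborel)"
    by (intro nn_integral_mono_AE eventually_mono[OF v(3)]) (auto simp: indicator_def)
  also have "\<dots> \<le> ennreal ((frac.sobolev_const * (T / \<theta>)) powr (pstar / p))"
  proof (rule frac.sobolev[OF v(1) _ \<Omega>_emeasure v(2)])
    show "(\<integral>\<^sup>+x. frac.F v x \<partial>lborel) \<le> ennreal (T / \<theta>)"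
      using T \<theta> by (intro order_trans[OF v(4)] ennreal_leI divide_right_mono) auto
  qed (use open_\<Omega> T \<theta> in auto)
  finally show "integrable (lebesgue_on \<Omega>) (\<lambda>x. \<bar>u x\<bar> powr pstar)"
    "(LINT x|lebesgue_on \<Omega>. \<bar>u x\<bar> powr pstar) \<le> (frac.sobolev_const * (T / \<theta>)) powr (pstar / p)"
    using um by (auto intro!: integrable_if_nn_integral_le)
qed

lemma X0_compactness:
  assumes U: "\<And>k::nat. U k \<in> X0" and T: "\<And>k. energy (U k) \<le> T"
  obtains \<sigma> u e where "strict_mono \<sigma>" "u \<in> X0" "(\<lambda>k. energy (U (\<sigma> k))) \<longlonglongrightarrow> e" "energy u \<le> e"
    "AE x in lborel. (\<lambda>k. U (\<sigma> k) x) \<longlonglongrightarrow> u x"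
proof -
  define T' where "T' = max T 1"
  have T': "0 < T'" "\<And>k. energy (U k) \<le> T'" using T by (auto simp: T'_def intro: le_max_iff_disj[THEN iffD2])
  have "\<forall>k. \<exists>v. v \<in> borel_measurable borel \<and> (\<forall>x. x \<notin> \<Omega> \<longrightarrow> v x = 0) \<and> (AE x in lborel. U k x = v x) \<and>
    (\<integral>\<^sup>+x. frac.F v x \<partial>lborel) \<le> ennreal (energy (U k) / \<theta>)"
    using X0_representative[OF U] by metis
  then obtain V where V: "\<And>k. V k \<in> borel_measurable borel" "\<And>k x. x \<notin> \<Omega> \<Longrightarrow> V k x = 0"
    "\<And>k. AE x in lborel. U k x = V k x" "\<And>k. (\<integral>\<^sup>+x. frac.F (V k) x \<partial>lborel) \<le> ennreal (energy (U k) / \<theta>)" by metis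
  have VT: "(\<integral>\<^sup>+x. frac.F (V k) x \<partial>lborel) \<le> ennreal (T' / \<theta>)" for k
    using T'(2)[of k] \<theta> by (intro order_trans[OF V(4)] ennreal_leI divide_right_mono) auto
  have "\<Omega> \<in> sets borel" "0 < T' / \<theta>" using open_\<Omega> T' \<theta> by auto
  then obtain \<sigma>0 where \<sigma>0: "strict_mono \<sigma>0" "AE x in lborel. convergent (\<lambda>k. V (\<sigma>0 k) x)"
    using frac.compactness_AE[of V \<Omega> "T' / \<theta>"] V(1,2) bounded_\<Omega> VT by blast
  have "bounded (range (\<lambda>k. energy (U (\<sigma>0 k))))"
    unfolding bounded_iff using T' energy_nonneg by (intro exI[of _ T']) auto
  then obtain r e where r: "strict_mono r" "((\<lambda>k. energy (U (\<sigma>0 k))) \<circ> r) \<longlonglongrightarrow> e"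
    using bounded_imp_convergent_subsequence by metis
  define \<sigma> where "\<sigma> = \<sigma>0 \<circ> r"
  have \<sigma>: "strict_mono \<sigma>" unfolding \<sigma>_def using \<sigma>0(1) r(1) by (rule strict_mono_o)
  have e: "(\<lambda>k. energy (U (\<sigma> k))) \<longlonglongrightarrow> e" using r(2) by (simp add: \<sigma>_def o_def)
  have e0: "0 \<le> e" by (rule LIMSEQ_le_const[OF e]) (use energy_nonneg in auto)
  \<comment> \<open>Built from the representatives \<open>V\<close>, so that u is Borel and vanishes
    everywhere off \<Omega>. Divergence occurs only on a null set.\<close>
  define u where "u x = lim (\<lambda>k. V (\<sigma> k) x)" for x
  have ub: "u \<in> borel_measurable borel" unfolding u_def using V(1) by measurable
  then have um: "u \<in> borel_measurable lebesgue" by (intro measurable_completion) simp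
  have u0: "u x = 0" if "x \<notin> \<Omega>" for x using V(2)[OF that] by (simp add: u_def)
  have "AE x in lborel. \<forall>k. U k x = V k x" using V(3) by (simp add: AE_all_countable)
  then have lim: "AE x in lborel. (\<lambda>k. U (\<sigma> k) x) \<longlonglongrightarrow> u x"
    using \<sigma>0(2)
  proof eventually_elim
    case (elim x)
    have "convergent (\<lambda>k. V (\<sigma> k) x)"
      using convergent_subseq_convergent[OF elim(2) r(1)] by (simp add: \<sigma>_def o_def)
    then show ?case using elim(1) by (simp add: u_def convergent_LIMSEQ_iff)
  qed
  have Um: "U k \<in> borel_measurable lebesgue" for k using U by (simp add: X0_iff)
  have quot_lim: "AE z in lebesgue_on Q. (\<lambda>k. quot (U (\<sigma> k)) z) \<longlonglongrightarrow> quot u z"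
    unfolding AE_lebesgue_on_iff[OF Q_sets] using AE_fst[OF lim] AE_snd[OF lim]
    by eventually_elim (auto simp: quot_def case_prod_beta intro!: tendsto_intros)
  have energy_eq: "(\<integral>\<^sup>+z. ennreal (\<bar>quot (U k) z\<bar> powr p) \<partial>lebesgue_on Q) \<le> ennreal (energy (U k))" for k
    using nn_integral_energy[of "U k"] U by (simp add: X0_iff)
  have IQ: "integrable (lebesgue_on Q) (\<lambda>z. \<bar>quot u z\<bar> powr p)" and le: "energy u \<le> e"
    using Fatou_powr[OF quot_measurable_Q[OF Um] quot_measurable_Q[OF um] _ quot_lim energy_eq e e0] p
    unfolding energy_def by auto
  interpret finite_measure "lebesgue_on \<Omega>" by (rule finite_measure_\<Omega>)
  \<comment> \<open>Membership in \<open>X0\<close> also asks for an L^p bound on \<Omega>. It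
    passes to the limit by Fatou, from the bound at exponent \<open>pstar\<close> and |t|^p \<le> 1
    + |t|^pstar.\<close>
  define C where "C = measure lebesgue \<Omega> + (frac.sobolev_const * (T' / \<theta>)) powr (pstar / p)"
  have C0: "0 \<le> C" by (simp add: C_def)
  have bound: "(\<integral>\<^sup>+x. ennreal (\<bar>U k x\<bar> powr p) \<partial>lebesgue_on \<Omega>) \<le> ennreal C" for k
  proof -
    note S = X0_sobolev[OF U T'(2) T'(1)]
    have I: "integrable (lebesgue_on \<Omega>) (\<lambda>x. \<bar>U k x\<bar> powr p)" using U by (simp add: X0_iff)
    have "\<bar>LINT x|lebesgue_on \<Omega>. 1 * \<bar>U k x\<bar> powr p\<bar> \<le> 1 * (measure (lebesgue_on \<Omega>) (space (lebesgue_on \<Omega>)) + (LINT x|lebesgue_on \<Omega>. \<bar>U k x\<bar> powr pstar))"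
      using S[of k] p frac.s_gt Um[of k] by (intro integrable_lower_powr) (auto simp: measurable_restrict_space1)
    also have "\<dots> \<le> C" using S(2)[of k] \<Omega>_sets by (simp add: C_def measure_restrict_space)
    finally have "(LINT x|lebesgue_on \<Omega>. \<bar>U k x\<bar> powr p) \<le> C" by simp
    then show ?thesis using nn_integral_eq_integral[OF I] by (simp add: ennreal_leI)
  qed
  have "AE x in lebesgue_on \<Omega>. (\<lambda>k. U (\<sigma> k) x) \<longlonglongrightarrow> u x"
    unfolding AE_lebesgue_on_iff[OF \<Omega>_sets] using lim by eventually_elim simp
  then have "integrable (lebesgue_on \<Omega>) (\<lambda>x. \<bar>u x\<bar> powr p)"
    using Fatou_powr(1)[of "\<lambda>k. U (\<sigma> k)" "lebesgue_on \<Omega>" u p "\<lambda>_. C" C] Um um p bound C0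
    by (simp add: measurable_restrict_space1)
  then have "u \<in> X0" using um IQ u0 by (simp add: X0_iff)
  then show thesis using that[OF \<sigma> _ e le lim] by blast
qed

text \<open>The cone is bounded and 1-Lipschitz, so |\<phi> x - \<phi> y|^p is at most a constant
  times min(1, |x-y|^p), which the integrability of m K controls. Pairs in \<open>Q\<close> have a
  coordinate in \<Omega>, and each of the two cases contributes at most a constant times the measure
  of \<Omega> times the integral of m K.\<close>

lemma bump_in_X0:
  assumes R: "0 < R" and ball: "ball x0 R \<subseteq> \<Omega>"
  shows "(\<lambda>x. max 0 (R - dist x x0)) \<in> X0"
proof -
  define \<phi> where "\<phi> x = max 0 (R - dist x x0)" for x
  have \<phi>m: "\<phi> \<in> borel_measurable lebesgue"
    unfolding \<phi>_def by (intro measurable_completion) auto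
  have \<phi>0: "\<phi> x = 0" if "x \<notin> \<Omega>" for x
  proof -
    have "x \<notin> ball x0 R" using that ball by blast
    then show ?thesis by (simp add: \<phi>_def dist_commute)
  qed
  have \<phi>R: "0 \<le> \<phi> x" "\<phi> x \<le> R" for x using R by (auto simp: \<phi>_def)
  have \<phi>L: "\<bar>\<phi> x - \<phi> y\<bar> \<le> norm (x - y)" for x y
  proof -
    have "\<bar>dist x x0 - dist y x0\<bar> \<le> dist x y" by (metis abs_dist_diff_le dist_commute)
    then show ?thesis by (auto simp: \<phi>_def dist_norm)
  qed
  interpret finite_measure "lebesgue_on \<Omega>" by (rule finite_measure_\<Omega>)
  have I\<Omega>: "integrable (lebesgue_on \<Omega>) (\<lambda>x. \<bar>\<phi> x\<bar> powr p)"
  proof (rule integrable_const_bound[of _ "R powr p"])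
    show "AE x in lebesgue_on \<Omega>. norm (\<bar>\<phi> x\<bar> powr p) \<le> R powr p"
      using \<phi>R p by (intro AE_I2) (auto intro!: powr_mono2)
    show "(\<lambda>x. \<bar>\<phi> x\<bar> powr p) \<in> borel_measurable (lebesgue_on \<Omega>)"
      using measurable_restrict_space1[OF \<phi>m] by measurable
  qed
  define g where "g x = min 1 (norm x powr p) * K x" for x
  have gi: "integrable lebesgue g" unfolding g_def using K_integrable .
  have g0: "0 \<le> g x" for x using K_pos[of x] by (cases "x = 0") (auto simp: g_def)
  \<comment> \<open>A Borel version of m K, because Tonelli is applied on the Borel product.\<close>
  obtain g' where g' [measurable]: "g' \<in> borel_measurable borel" "AE x in lborel. g x = g' x"
    using completion_ex_borel_measurable_real[OF borel_measurable_integrable[OF gi]] by auto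
  define G where "G = (\<integral>\<^sup>+x. ennreal (g' x) \<partial>lborel)"
  have "G = (\<integral>\<^sup>+x. ennreal (g x) \<partial>lebesgue)"
    unfolding G_def nn_integral_completion by (intro nn_integral_cong_AE eventually_mono[OF g'(2)]) simp
  also have "\<dots> < \<infinity>" using nn_integral_eq_integral[OF gi] g0 by simp
  finally have G: "G < \<infinity>" .
  \<comment> \<open>\<open>L\<close> dominates the Lipschitz constant 1, used for |x-y| \<le> 1, and
    the height R, used beyond.\<close>
  define L where "L = max 1 R"
  have L: "1 \<le> L" "R \<le> L" by (auto simp: L_def)
  have pw: "\<bar>quot \<phi> (x, y)\<bar> powr p \<le> L powr p * g (x - y)" for x y
  proof (cases "x = y")
    case False
    have "\<bar>\<phi> x - \<phi> y\<bar> powr p \<le> L powr p * min 1 (norm (x - y) powr p)"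
    proof (cases "norm (x - y) \<le> 1")
      case True
      then have "norm (x - y) powr p \<le> 1" using p powr_mono2[of p "norm (x - y)" 1] by simp
      moreover have "\<bar>\<phi> x - \<phi> y\<bar> powr p \<le> (L * norm (x - y)) powr p"
        using \<phi>L[of x y] L p mult_right_mono[of 1 L "norm (x - y)"] by (intro powr_mono2) auto
      ultimately show ?thesis using L by (simp add: powr_mult min_def)
    next
      case False
      then have "1 \<le> norm (x - y) powr p" using p by (simp add: ge_one_powr_ge_zero)
      moreover have "\<bar>\<phi> x - \<phi> y\<bar> powr p \<le> L powr p"
        using \<phi>R[of x] \<phi>R[of y] L p by (intro powr_mono2) (auto simp: abs_le_iff)
      ultimately show ?thesis by (simp add: min_def)
    qed
    then have "\<bar>\<phi> x - \<phi> y\<bar> powr p * K (x - y) \<le> (L powr p * min 1 (norm (x - y) powr p)) * K (x - y)"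
      using K_pos[of "x - y"] False by (intro mult_right_mono) auto
    then show ?thesis using quot_powr[OF False, of \<phi>] by (simp add: g_def mult.assoc)
  qed (use g0 in \<open>simp add: quot_def\<close>)
  have [measurable]: "\<Omega> \<in> sets borel" using open_\<Omega> by simp
  have em: "emeasure lborel \<Omega> < \<infinity>" by (rule \<Omega>_emeasure)
  have "(\<integral>\<^sup>+z. ennreal (\<bar>quot \<phi> z\<bar> powr p) \<partial>lebesgue_on Q) = (\<integral>\<^sup>+z. ennreal (\<bar>quot \<phi> z\<bar> powr p) * indicator Q z \<partial>lborel)"
    by (rule nn_integral_lebesgue_on[OF Q_sets])
  also have "\<dots> \<le> (\<integral>\<^sup>+z. ennreal (L powr p) * (ennreal (g' (fst z - snd z)) * indicator \<Omega> (fst z) + ennreal (g' (fst z - snd z)) * indicator \<Omega> (snd z)) \<partial>lborel)"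
  proof (rule nn_integral_mono_AE)
    show "AE z in lborel. ennreal (\<bar>quot \<phi> z\<bar> powr p) * indicator Q z \<le>
      ennreal (L powr p) * (ennreal (g' (fst z - snd z)) * indicator \<Omega> (fst z) + ennreal (g' (fst z - snd z)) * indicator \<Omega> (snd z))"
      using AE_diff[OF g'(2)]
    proof eventually_elim
      case (elim z)
      have "ennreal (\<bar>quot \<phi> z\<bar> powr p) \<le> ennreal (L powr p) * ennreal (g' (fst z - snd z))"
        using pw[of "fst z" "snd z"] elim g0[of "fst z - snd z"] by (simp add: ennreal_leI flip: ennreal_mult)
      moreover have "indicator Q z \<le> (indicator \<Omega> (fst z) + indicator \<Omega> (snd z) :: ennreal)"
        by (cases z) (auto simp: Q_set_def indicator_def)
      ultimately have "ennreal (\<bar>quot \<phi> z\<bar> powr p) * indicator Q z \<le>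
        ennreal (L powr p) * ennreal (g' (fst z - snd z)) * (indicator \<Omega> (fst z) + indicator \<Omega> (snd z))"
        by (intro mult_mono) auto
      then show ?case by (simp add: distrib_left mult.assoc)
    qed
  qed
  also have "\<dots> = ennreal (L powr p) * ((\<integral>\<^sup>+z. ennreal (g' (fst z - snd z)) * indicator \<Omega> (fst z) \<partial>(lborel \<Otimes>\<^sub>M lborel)) +
      (\<integral>\<^sup>+z. ennreal (g' (fst z - snd z)) * indicator \<Omega> (snd z) \<partial>(lborel \<Otimes>\<^sub>M lborel)))"
    unfolding lborel_prod[symmetric] by (subst nn_integral_cmult, measurable) (subst nn_integral_add, measurable)
  also have "(\<integral>\<^sup>+z. ennreal (g' (fst z - snd z)) * indicator \<Omega> (fst z) \<partial>(lborel \<Otimes>\<^sub>M lborel)) = G * emeasure lborel \<Omega>"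
  proof -
    have "(\<integral>\<^sup>+z. ennreal (g' (fst z - snd z)) * indicator \<Omega> (fst z) \<partial>(lborel \<Otimes>\<^sub>M lborel)) =
      (\<integral>\<^sup>+x. \<integral>\<^sup>+y. ennreal (g' (x - y)) * indicator \<Omega> x \<partial>lborel \<partial>lborel)"
      by (subst lborel.nn_integral_fst[symmetric]) auto
    also have "\<dots> = (\<integral>\<^sup>+x. (\<integral>\<^sup>+y. ennreal (g' (x - y)) \<partial>lborel) * indicator \<Omega> x \<partial>lborel)"
      by (intro nn_integral_cong nn_integral_multc) measurable
    also have "\<dots> = (\<integral>\<^sup>+x. G * indicator \<Omega> x \<partial>lborel)"
      unfolding G_def by (subst nn_integral_lborel_reflect) auto
    also have "\<dots> = G * emeasure lborel \<Omega>" by (rule nn_integral_cmult_indicator) simp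
    finally show ?thesis .
  qed
  also have "(\<integral>\<^sup>+z. ennreal (g' (fst z - snd z)) * indicator \<Omega> (snd z) \<partial>(lborel \<Otimes>\<^sub>M lborel)) = G * emeasure lborel \<Omega>"
  proof -
    have "(\<integral>\<^sup>+z. ennreal (g' (fst z - snd z)) * indicator \<Omega> (snd z) \<partial>(lborel \<Otimes>\<^sub>M lborel)) =
      (\<integral>\<^sup>+y. \<integral>\<^sup>+x. ennreal (g' (x - y)) * indicator \<Omega> y \<partial>lborel \<partial>lborel)"
      by (subst lborel_pair.nn_integral_snd[symmetric]) auto
    also have "\<dots> = (\<integral>\<^sup>+y. (\<integral>\<^sup>+x. ennreal (g' (x - y)) \<partial>lborel) * indicator \<Omega> y \<partial>lborel)"
      by (intro nn_integral_cong nn_integral_multc) measurable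
    also have "\<dots> = (\<integral>\<^sup>+y. G * indicator \<Omega> y \<partial>lborel)"
      unfolding G_def by (subst nn_integral_lborel_shift) auto
    also have "\<dots> = G * emeasure lborel \<Omega>" by (rule nn_integral_cmult_indicator) simp
    finally show ?thesis .
  qed
  finally have "(\<integral>\<^sup>+z. ennreal (\<bar>quot \<phi> z\<bar> powr p) \<partial>lebesgue_on Q) \<le> ennreal (L powr p) * (G * emeasure lborel \<Omega> + G * emeasure lborel \<Omega>)" .
  also have "\<dots> < \<infinity>" using G em by (simp add: ennreal_mult_less_top)
  finally have "integrable (lebesgue_on Q) (\<lambda>z. \<bar>quot \<phi> z\<bar> powr p)"
    using quot_measurable_Q[OF \<phi>m] by (intro integrableI_nonneg) (auto simp: less_top)
  then show ?thesis using \<phi>m I\<Omega> \<phi>0 unfolding X0_iff \<phi>_def[abs_def] by auto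
qed

section \<open>Derivatives and weighted integrals of powers\<close>

lemma quot_derivative_density:
  "\<bar>quot u (x, y)\<bar> powr (p - 2) * quot u (x, y) * quot v (x, y) =
    \<bar>u x - u y\<bar> powr (p - 2) * (u x - u y) * (v x - v y) * K (x - y)"
proof (cases "x = y")
  case False
  define k where "k = K (x - y)"
  have k: "0 < k" using False K_pos by (simp add: k_def)
  \<comment> \<open>The modulus contributes K^((p-2)/p) and each linear factor K^(1/p); the
    exponents add up to 1.\<close>
  have "k powr ((p - 2) / p) * k powr (1 / p) * k powr (1 / p) = k powr ((p - 2) / p + 1 / p + 1 / p)"
    by (simp only: powr_add)
  also have "(p - 2) / p + 1 / p + 1 / p = 1" using p by (simp add: field_simps)
  finally have K: "k powr ((p - 2) / p) * k powr (1 / p) * k powr (1 / p) = k" using k by simp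
  have "\<bar>quot u (x, y)\<bar> powr (p - 2) * quot u (x, y) * quot v (x, y) =
    \<bar>u x - u y\<bar> powr (p - 2) * (u x - u y) * (v x - v y) * (k powr ((p - 2) / p) * k powr (1 / p) * k powr (1 / p))"
    by (simp add: quot_def abs_mult powr_mult powr_powr k_def[symmetric])
  then show ?thesis unfolding K by (simp add: k_def)
qed (simp add: quot_def)

definition energy_deriv :: "('a \<Rightarrow> real) \<Rightarrow> ('a \<Rightarrow> real) \<Rightarrow> real" where
  "energy_deriv u v = (LINT z|lebesgue_on Q. \<bar>quot u z\<bar> powr (p - 2) * quot u z * quot v z)"

lemma energy_has_derivative:
  assumes u: "u \<in> X0" and v: "v \<in> X0"
  shows "integrable (lebesgue_on Q) (\<lambda>z. \<bar>quot u z\<bar> powr (p - 2) * quot u z * quot v z)"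
    and "((\<lambda>t. energy (\<lambda>x. u x + t * v x)) has_real_derivative p * energy_deriv u v) (at 0)"
  using weighted_powr_integral_derivative[of p "quot u" "lebesgue_on Q" "quot v" "\<lambda>_. 1"] u v p quot_measurable_Q
  by (auto simp: X0_iff energy_def quot_add energy_deriv_def)

definition weighted :: "('a \<Rightarrow> real) \<Rightarrow> real \<Rightarrow> ('a \<Rightarrow> real) \<Rightarrow> real" where
  "weighted h s u = (LINT x|lebesgue_on \<Omega>. h x * \<bar>u x\<bar> powr s)"

definition weighted_deriv :: "('a \<Rightarrow> real) \<Rightarrow> real \<Rightarrow> ('a \<Rightarrow> real) \<Rightarrow> ('a \<Rightarrow> real) \<Rightarrow> real" where
  "weighted_deriv h s u v = (LINT x|lebesgue_on \<Omega>. h x * (\<bar>u x\<bar> powr (s - 2) * u x * v x))"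

lemma X0_measurable_\<Omega>: "u \<in> X0 \<Longrightarrow> u \<in> borel_measurable (lebesgue_on \<Omega>)"
  by (simp add: X0_iff measurable_restrict_space1)

lemma X0_pstar_integrable: "u \<in> X0 \<Longrightarrow> integrable (lebesgue_on \<Omega>) (\<lambda>x. \<bar>u x\<bar> powr pstar)"
  using X0_sobolev(1)[of u "max 1 (energy u)"] by simp

lemma weighted_cong:
  assumes "h \<in> borel_measurable (lebesgue_on \<Omega>)"
    and "u \<in> borel_measurable lebesgue" "v \<in> borel_measurable lebesgue" "AE x in lborel. u x = v x"
  shows "weighted h s u = weighted h s v"
  unfolding weighted_def
proof (rule integral_cong_AE)
  show "(\<lambda>x. h x * \<bar>u x\<bar> powr s) \<in> borel_measurable (lebesgue_on \<Omega>)"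
    "(\<lambda>x. h x * \<bar>v x\<bar> powr s) \<in> borel_measurable (lebesgue_on \<Omega>)"
    using assms(1) measurable_restrict_space1[OF assms(2)] measurable_restrict_space1[OF assms(3)] by measurable
  show "AE x in lebesgue_on \<Omega>. h x * \<bar>u x\<bar> powr s = h x * \<bar>v x\<bar> powr s"
    unfolding AE_lebesgue_on_iff[OF \<Omega>_sets] using assms(4) by eventually_elim simp
qed

lemma weighted_scale: "0 \<le> t \<Longrightarrow> weighted h s (\<lambda>x. t * u x) = t powr s * weighted h s u"
  unfolding weighted_def by (simp add: abs_mult powr_mult mult.left_commute flip: integral_mult_right_zero)

lemma weighted_abs: "weighted h s (\<lambda>x. \<bar>u x\<bar>) = weighted h s u"
  by (simp add: weighted_def)

context
  fixes h :: "'a \<Rightarrow> real" and s W :: real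
  assumes h: "h \<in> borel_measurable (lebesgue_on \<Omega>)" "\<And>x. x \<in> \<Omega> \<Longrightarrow> \<bar>h x\<bar> \<le> W"
    and s: "0 < s" "s < pstar"
begin

interpretation finite_measure "lebesgue_on \<Omega>" by (rule finite_measure_\<Omega>)

lemma weighted_integrable:
  "u \<in> X0 \<Longrightarrow> integrable (lebesgue_on \<Omega>) (\<lambda>x. h x * \<bar>u x\<bar> powr s)"
  by (rule integrable_lower_powr(1)[OF X0_measurable_\<Omega> h(1) s(1) less_imp_le[OF s(2)] X0_pstar_integrable, where W = W])
    (use h(2) in auto)

lemma weighted_bounded:
  obtains C where "\<And>u. u \<in> X0 \<Longrightarrow> energy u \<le> 1 \<Longrightarrow> \<bar>weighted h s u\<bar> \<le> C"
proof
  fix u assume u: "u \<in> X0" "energy u \<le> 1"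
  have "\<bar>weighted h s u\<bar> \<le> \<bar>W\<bar> * (measure (lebesgue_on \<Omega>) (space (lebesgue_on \<Omega>)) + (LINT x|lebesgue_on \<Omega>. \<bar>u x\<bar> powr pstar))"
    unfolding weighted_def
    by (rule integrable_lower_powr(2)[OF X0_measurable_\<Omega>[OF u(1)] h(1) s(1) less_imp_le[OF s(2)] X0_pstar_integrable[OF u(1)]])
      (use order_trans[OF h(2) abs_ge_self] in simp)
  also have "\<dots> \<le> \<bar>W\<bar> * (measure (lebesgue_on \<Omega>) (space (lebesgue_on \<Omega>)) + (frac.sobolev_const * (1 / \<theta>)) powr (pstar / p))"
    using X0_sobolev(2)[OF u] by (intro mult_left_mono add_left_mono) auto
  finally show "\<bar>weighted h s u\<bar> \<le> \<bar>W\<bar> * (measure (lebesgue_on \<Omega>) (space (lebesgue_on \<Omega>)) + (frac.sobolev_const * (1 / \<theta>)) powr (pstar / p))" .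
qed

lemma weighted_has_derivative:
  assumes "1 < s" "u \<in> X0" "v \<in> X0"
  shows "integrable (lebesgue_on \<Omega>) (\<lambda>x. h x * (\<bar>u x\<bar> powr (s - 2) * u x * v x))"
    and "((\<lambda>t. weighted h s (\<lambda>x. u x + t * v x)) has_real_derivative s * weighted_deriv h s u v) (at 0)"
  unfolding weighted_def weighted_deriv_def
  using assms h weighted_integrable X0_measurable_\<Omega>
  by (intro weighted_powr_integral_derivative; simp)+

text \<open>Subcriticality at work: \<open>X0_sobolev\<close> bounds the integrals at exponent
  \<open>pstar\<close>, and the gap between s and \<open>pstar\<close> feeds
  \<open>powr_integral_limit\<close>.\<close>

lemma weighted_tendsto:
  assumes U: "\<And>k::nat. U k \<in> X0" "\<And>k. energy (U k) \<le> T" and u: "u \<in> X0" "energy u \<le> T"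
    and lim: "AE x in lborel. (\<lambda>k. U k x) \<longlonglongrightarrow> u x"
  shows "(\<lambda>k. weighted h s (U k)) \<longlonglongrightarrow> weighted h s u"
  unfolding weighted_def
proof (rule powr_integral_limit)
  have T: "0 < max 1 T" "\<And>k. energy (U k) \<le> max 1 T" "energy u \<le> max 1 T"
    using U u by (auto simp: le_max_iff_disj)
  show "(LINT x|lebesgue_on \<Omega>. \<bar>U k x\<bar> powr pstar) \<le> (frac.sobolev_const * (max 1 T / \<theta>)) powr (pstar / p)" for k
    by (rule X0_sobolev(2)[OF U(1) T(2) T(1)])
  show "(LINT x|lebesgue_on \<Omega>. \<bar>u x\<bar> powr pstar) \<le> (frac.sobolev_const * (max 1 T / \<theta>)) powr (pstar / p)"
    by (rule X0_sobolev(2)[OF u(1) T(3) T(1)])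
  show "AE x in lebesgue_on \<Omega>. (\<lambda>k. U k x) \<longlonglongrightarrow> u x"
    unfolding AE_lebesgue_on_iff[OF \<Omega>_sets] using lim by eventually_elim simp
  show "\<bar>h x\<bar> \<le> W" if "x \<in> space (lebesgue_on \<Omega>)" for x using h(2) that by simp
qed (use h s U u X0_measurable_\<Omega> X0_pstar_integrable in auto)

text \<open>By continuity h is positive on a small ball; for the cone supported there the integrand
  is nonnegative, and positive on the ball.\<close>

lemma weighted_positive:
  assumes x0: "x0 \<in> \<Omega>" "0 < h x0" and cont: "continuous_on \<Omega> h"
  obtains u where "u \<in> X0" "0 < weighted h s u"
proof -
  have "isCont h x0" using cont open_\<Omega> x0(1) by (simp add: continuous_on_eq_continuous_at)
  then have "eventually (\<lambda>x. 0 < h x) (nhds x0)"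
    unfolding continuous_at using x0(2) by (intro order_tendstoD(1)[OF tendsto_at_iff_tendsto_nhds[THEN iffD1]])
  moreover have "eventually (\<lambda>x. x \<in> \<Omega>) (nhds x0)" using open_\<Omega> x0(1) by (rule eventually_nhds_in_open)
  ultimately have "eventually (\<lambda>x. 0 < h x \<and> x \<in> \<Omega>) (nhds x0)" by (rule eventually_conj)
  then obtain R where R: "0 < R" "\<And>x. dist x x0 < R \<Longrightarrow> 0 < h x \<and> x \<in> \<Omega>"
    by (auto simp: eventually_nhds_metric)
  have ball: "ball x0 R \<subseteq> \<Omega>" using R(2) by (auto simp: dist_commute)
  define \<phi> where "\<phi> x = max 0 (R - dist x x0)" for x
  have \<phi>: "\<phi> \<in> X0" using bump_in_X0[OF R(1) ball] by (simp add: \<phi>_def[abs_def])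
  have nn: "0 \<le> h x * \<bar>\<phi> x\<bar> powr s" for x
    using R(2)[of x] by (cases "dist x x0 < R") (auto simp: \<phi>_def)
  have I: "integrable (lebesgue_on \<Omega>) (\<lambda>x. h x * \<bar>\<phi> x\<bar> powr s)" using weighted_integrable[OF \<phi>] .
  have "weighted h s \<phi> \<noteq> 0"
  proof
    assume "weighted h s \<phi> = 0"
    then have "AE x in lebesgue_on \<Omega>. h x * \<bar>\<phi> x\<bar> powr s = 0"
      using integral_nonneg_eq_0_iff_AE[OF I] nn by (simp add: weighted_def)
    then have "AE x in lborel. x \<notin> ball x0 R"
      unfolding AE_lebesgue_on_iff[OF \<Omega>_sets]
    proof (rule eventually_mono, intro notI)
      fix x assume x: "x \<in> \<Omega> \<longrightarrow> h x * \<bar>\<phi> x\<bar> powr s = 0" "x \<in> ball x0 R"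
      then have "dist x x0 < R" by (simp add: dist_commute)
      then show False using x(1) R(2)[of x] by (auto simp: \<phi>_def)
    qed
    then have "emeasure lborel (ball x0 R) = 0" by (subst (asm) AE_iff_measurable[of "ball x0 R"]) auto
    then show False using emeasure_ball_unit[OF R(1), of x0] R(1) unit_ball_vol_pos[of "real DIM('a)"] by simp
  qed
  moreover have "0 \<le> weighted h s \<phi>" unfolding weighted_def using nn by simp
  ultimately show thesis using that[OF \<phi>] by simp
qed

end

section \<open>From the abstract functionals to weak solutions\<close>

lemma concave_convex_functionals:
  assumes h: "h \<in> borel_measurable (lebesgue_on \<Omega>)" "\<And>x. x \<in> \<Omega> \<Longrightarrow> \<bar>h x\<bar> \<le> Wh" "continuous_on \<Omega> h" "x1 \<in> \<Omega>" "0 < h x1"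
    and b: "b \<in> borel_measurable (lebesgue_on \<Omega>)" "\<And>x. x \<in> \<Omega> \<Longrightarrow> \<bar>b x\<bar> \<le> Wb" "continuous_on \<Omega> b" "x2 \<in> \<Omega>" "0 < b x2"
    and exps: "1 < a" "a < p" "p < s" "s < pstar"
  shows "concave_convex X0 energy (weighted h a) (weighted b s) energy_deriv (weighted_deriv h a) (weighted_deriv b s) a p s"
proof
  have a: "0 < a" "a < pstar" and s: "0 < s" "1 < s" using exps by auto
  note H = h(1,2) a and B = b(1,2) s(1) exps(4)
  show "\<exists>C. \<forall>u\<in>X0. energy u \<le> 1 \<longrightarrow> \<bar>weighted h a u\<bar> \<le> C \<and> \<bar>weighted b s u\<bar> \<le> C"
  proof -
    obtain C1 where "\<And>u. u \<in> X0 \<Longrightarrow> energy u \<le> 1 \<Longrightarrow> \<bar>weighted h a u\<bar> \<le> C1"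
      using weighted_bounded[OF H] by blast
    moreover obtain C2 where "\<And>u. u \<in> X0 \<Longrightarrow> energy u \<le> 1 \<Longrightarrow> \<bar>weighted b s u\<bar> \<le> C2"
      using weighted_bounded[OF B] by blast
    ultimately show ?thesis by (intro exI[of _ "max C1 C2"]) (auto simp: le_max_iff_disj)
  qed
  show "\<exists>\<sigma> u e. strict_mono \<sigma> \<and> u \<in> X0 \<and> (\<lambda>k. energy (U (\<sigma> k))) \<longlonglongrightarrow> e \<and> energy u \<le> e \<and>
      (\<lambda>k. weighted h a (U (\<sigma> k))) \<longlonglongrightarrow> weighted h a u \<and> (\<lambda>k. weighted b s (U (\<sigma> k))) \<longlonglongrightarrow> weighted b s u"
    if U: "\<And>k::nat. U k \<in> X0" "\<And>k. energy (U k) \<le> T" for U T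
  proof -
    obtain \<sigma> u e where \<sigma>: "strict_mono \<sigma>" "u \<in> X0" "(\<lambda>k. energy (U (\<sigma> k))) \<longlonglongrightarrow> e" "energy u \<le> e"
      "AE x in lborel. (\<lambda>k. U (\<sigma> k) x) \<longlonglongrightarrow> u x" using X0_compactness[of U T] U by blast
    have "e \<le> T" by (rule LIMSEQ_le_const2[OF \<sigma>(3)]) (use U in auto)
    then have uT: "energy u \<le> T" using \<sigma>(4) by simp
    show ?thesis
      using \<sigma> weighted_tendsto[OF H, of "\<lambda>k. U (\<sigma> k)" T u] weighted_tendsto[OF B, of "\<lambda>k. U (\<sigma> k)" T u] U uT by blast
  qed
  show "\<exists>u\<in>X0. 0 < weighted h a u" using weighted_positive[OF H h(4,5,3)] by blast
  show "\<exists>u\<in>X0. 0 < weighted b s u" using weighted_positive[OF B b(4,5,3)] by blast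
  show "((\<lambda>t. weighted h a (\<lambda>x. u x + t * v x)) has_real_derivative a * weighted_deriv h a u v) (at 0)"
    if "u \<in> X0" "v \<in> X0" for u v using weighted_has_derivative(2)[OF H exps(1) that] .
  show "((\<lambda>t. weighted b s (\<lambda>x. u x + t * v x)) has_real_derivative s * weighted_deriv b s u v) (at 0)"
    if "u \<in> X0" "v \<in> X0" for u v using weighted_has_derivative(2)[OF B s(2) that] .
qed (use exps X0_add X0_abs energy_nonneg energy_scale weighted_scale weighted_abs energy_has_derivative(2) in auto)

text \<open>For a = q + 1 and a = r + 1 the density |u|^(a-2) u is the nonlinearity itself. The
  outer factors of the derivatives are cancelled by the divisors in \<open>J\<close>, hence no
  constants in \<open>crit\<close>.\<close>

lemma weak_solutionI:
  assumes h: "h \<in> borel_measurable (lebesgue_on \<Omega>)" "\<And>x. x \<in> \<Omega> \<Longrightarrow> \<bar>h x\<bar> \<le> Wh"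
    and b: "b \<in> borel_measurable (lebesgue_on \<Omega>)" "\<And>x. x \<in> \<Omega> \<Longrightarrow> \<bar>b x\<bar> \<le> Wb"
    and exps: "0 < q" "q + 1 < pstar" "0 < r" "r + 1 < pstar"
    and u: "u \<in> X0"
    and crit: "\<And>v. v \<in> X0 \<Longrightarrow> energy_deriv u v = l * weighted_deriv h (q + 1) u v + weighted_deriv b (r + 1) u v"
  shows "weak_solution \<Omega> p K q r h b l u"
  unfolding weak_solution_def Let_def
proof (intro conjI ballI)
  fix v assume v: "v \<in> X0"
  have E: "(\<lambda>(x, y). \<bar>u x - u y\<bar> powr (p - 2) * (u x - u y) * (v x - v y) * K (x - y)) =
      (\<lambda>z. \<bar>quot u z\<bar> powr (p - 2) * quot u z * quot v z)"
    by (auto simp: fun_eq_iff quot_derivative_density)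
  have H: "(\<lambda>x. h x * \<bar>u x\<bar> powr (q - 1) * u x * v x) = (\<lambda>x. h x * (\<bar>u x\<bar> powr (q + 1 - 2) * u x * v x))"
    and B: "(\<lambda>x. b x * \<bar>u x\<bar> powr (r - 1) * u x * v x) = (\<lambda>x. b x * (\<bar>u x\<bar> powr (r + 1 - 2) * u x * v x))"
    by (auto simp: fun_eq_iff algebra_simps)
  show "integrable (lebesgue_on Q) (\<lambda>(x, y). \<bar>u x - u y\<bar> powr (p - 2) * (u x - u y) * (v x - v y) * K (x - y))"
    unfolding E by (rule energy_has_derivative(1)[OF u v])
  show "integrable (lebesgue_on \<Omega>) (\<lambda>x. h x * \<bar>u x\<bar> powr (q - 1) * u x * v x)"
    unfolding H using exps by (intro weighted_has_derivative(1)[OF h _ _ _ u v]) auto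
  show "integrable (lebesgue_on \<Omega>) (\<lambda>x. b x * \<bar>u x\<bar> powr (r - 1) * u x * v x)"
    unfolding B using exps by (intro weighted_has_derivative(1)[OF b _ _ _ u v]) auto
  show "(LINT z|lebesgue_on Q. (\<lambda>(x, y). \<bar>u x - u y\<bar> powr (p - 2) * (u x - u y) * (v x - v y) * K (x - y)) z) =
      l * (LINT x|lebesgue_on \<Omega>. h x * \<bar>u x\<bar> powr (q - 1) * u x * v x) +
      (LINT x|lebesgue_on \<Omega>. b x * \<bar>u x\<bar> powr (r - 1) * u x * v x)"
    unfolding E H B using crit[OF v] by (simp add: energy_deriv_def weighted_deriv_def)
qed (rule u)

end

lemma smooth_on_closure_imp:
  assumes "smooth_on_closure \<Omega> f" "open \<Omega>" "bounded \<Omega>"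
  shows "continuous_on \<Omega> f" "f \<in> borel_measurable (lebesgue_on \<Omega>)" "\<exists>W. \<forall>x\<in>\<Omega>. \<bar>f x\<bar> \<le> W"
proof -
  obtain D :: "'a list \<Rightarrow> 'a \<Rightarrow> real" where D: "\<And>x. x \<in> closure \<Omega> \<Longrightarrow> D [] x = f x" "continuous_on (closure \<Omega>) (D [])"
    \<comment> \<open>The empty list gives the continuous extension of f itself; boundedness then
      comes from compactness of the closure.\<close>
    using assms(1) unfolding smooth_on_closure_def by (metis empty_set empty_subsetI)
  have c: "continuous_on (closure \<Omega>) f" using D(2) by (rule continuous_on_eq) (rule D(1))
  then show cont: "continuous_on \<Omega> f" using closure_subset by (rule continuous_on_subset)
  then show "f \<in> borel_measurable (lebesgue_on \<Omega>)"
    using assms(2) by (intro continuous_imp_measurable_on_sets_lebesgue) auto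
  have "compact (f ` closure \<Omega>)" using c assms(3) by (intro compact_continuous_image) auto
  then obtain W where "\<forall>y\<in>f ` closure \<Omega>. norm y \<le> W" using compact_imp_bounded bounded_iff by metis
  then show "\<exists>W. \<forall>x\<in>\<Omega>. \<bar>f x\<bar> \<le> W" using closure_subset[of \<Omega>] by (intro exI[of _ W]) auto
qed

theorem theorem1p1:
  fixes \<Omega> :: "'a::euclidean_space set"
    and K h b :: "'a \<Rightarrow> real"
    and p \<alpha> q r \<theta> :: real
  assumes "bounded_lipschitz_domain \<Omega>"
    and "p \<ge> 2" and "0 < \<alpha>" and "\<alpha> < 1" and "real DIM('a) > p * \<alpha>"
    and "0 < q" and "q < p - 1" and "p - 1 < r"
    and "r < critical_exponent (real DIM('a)) p \<alpha> - 1"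
    and "smooth_on_closure \<Omega> h" and "sign_changing_on \<Omega> h"
    and "smooth_on_closure \<Omega> b" and "sign_changing_on \<Omega> b"
    and "K \<in> borel_measurable (lebesgue_on (UNIV - {0}))"
    and "\<And>x. x \<noteq> 0 \<Longrightarrow> K x > 0"
    and "integrable lebesgue (\<lambda>x. min 1 (norm x powr p) * K x)"
    and "\<theta> > 0" and "\<And>x. x \<noteq> 0 \<Longrightarrow> K x \<ge> \<theta> * norm x powr (- (real DIM('a) + p * \<alpha>))"
    and "\<And>x. x \<noteq> 0 \<Longrightarrow> K x = K (- x)"
  shows "\<exists>lam0>0. \<forall>lam. 0 < lam \<and> lam < lam0 \<longrightarrow>
           (\<exists>u1 u2.
              weak_solution \<Omega> p K q r h b lam u1 \<and> nonneg_nontrivial u1 \<and>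
              weak_solution \<Omega> p K q r h b lam u2 \<and> nonneg_nontrivial u2 \<and>
              \<not> (AE x in lebesgue. u1 x = u2 x))"
proof -
  have \<Omega>: "open \<Omega>" "bounded \<Omega>" using assms(1) by (auto simp: bounded_lipschitz_domain_def)
  define pstar where "pstar = critical_exponent (real DIM('a)) p \<alpha>"
  interpret nonlocal_problem \<Omega> K p \<alpha> \<theta> pstar
    by unfold_locales (use assms(2-18) \<Omega> in \<open>auto simp: pstar_def\<close>)
  note hs = smooth_on_closure_imp[OF assms(10) \<Omega>] and bs = smooth_on_closure_imp[OF assms(12) \<Omega>]
  obtain Wh Wb where W: "\<And>x. x \<in> \<Omega> \<Longrightarrow> \<bar>h x\<bar> \<le> Wh" "\<And>x. x \<in> \<Omega> \<Longrightarrow> \<bar>b x\<bar> \<le> Wb"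
    using hs(3) bs(3) by blast
  obtain x1 x2 where x: "x1 \<in> \<Omega>" "0 < h x1" "x2 \<in> \<Omega>" "0 < b x2"
    using assms(11,13) by (auto simp: sign_changing_on_def)
  have exps: "1 < q + 1" "q + 1 < p" "p < r + 1" "r + 1 < pstar" "q + 1 < pstar" "0 < r" "0 < q"
    using assms(2,6-9) by (auto simp: pstar_def)
  interpret concave_convex X0 energy "weighted h (q + 1)" "weighted b (r + 1)" energy_deriv
    "weighted_deriv h (q + 1)" "weighted_deriv b (r + 1)" "q + 1" p "r + 1"
    using hs(2) W(1) hs(1) x(1,2) bs(2) W(2) bs(1) x(3,4) exps(1-4) by (rule concave_convex_functionals)
  \<comment> \<open>\<open>J\<close> depends only on the class modulo null sets. Its opposite signs,
    and its value 0 at the zero function, therefore give nontriviality and distinctness in the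
    almost everywhere sense.\<close>
  have J_cong: "J l u = J l v"
    if "u \<in> borel_measurable lebesgue" "v \<in> borel_measurable lebesgue" "AE x in lborel. u x = v x" for l u v
    using energy_cong[OF that] weighted_cong[OF hs(2) that] weighted_cong[OF bs(2) that] by (simp add: J_def)
  have J_zero: "J l (\<lambda>_. 0) = 0" for l
    by (simp add: J_def energy_def weighted_def quot_def case_prod_beta)
  obtain l0 where l0: "l0 > 0" "\<And>l. 0 < l \<Longrightarrow> l < l0 \<Longrightarrow> \<exists>u1\<in>X0. \<exists>u2\<in>X0.
     (\<forall>x. 0 \<le> u1 x) \<and> (\<forall>v\<in>X0. energy_deriv u1 v = l * weighted_deriv h (q + 1) u1 v + weighted_deriv b (r + 1) u1 v) \<and> J l u1 < 0 \<and>
     (\<forall>x. 0 \<le> u2 x) \<and> (\<forall>v\<in>X0. energy_deriv u2 v = l * weighted_deriv h (q + 1) u2 v + weighted_deriv b (r + 1) u2 v) \<and> J l u2 > 0"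
    using two_critical_points by blast
  show ?thesis
  proof (intro exI[of _ l0] conjI allI impI)
    fix l assume l: "0 < l \<and> l < l0"
    then obtain u1 u2 where u: "u1 \<in> X0" "u2 \<in> X0" "\<And>x. 0 \<le> u1 x" "\<And>x. 0 \<le> u2 x" "J l u1 < 0" "J l u2 > 0"
      "\<And>v. v \<in> X0 \<Longrightarrow> energy_deriv u1 v = l * weighted_deriv h (q + 1) u1 v + weighted_deriv b (r + 1) u1 v"
      "\<And>v. v \<in> X0 \<Longrightarrow> energy_deriv u2 v = l * weighted_deriv h (q + 1) u2 v + weighted_deriv b (r + 1) u2 v"
      using l0(2)[of l] by blast
    have um: "u1 \<in> borel_measurable lebesgue" "u2 \<in> borel_measurable lebesgue" using u(1,2) by (auto simp: X0_iff)
    have "weak_solution \<Omega> p K q r h b l u1"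
      using hs(2) W(1) bs(2) W(2) exps(7,5,6,4) u(1,7) by (rule weak_solutionI)
    moreover have "weak_solution \<Omega> p K q r h b l u2"
      using hs(2) W(1) bs(2) W(2) exps(7,5,6,4) u(2,8) by (rule weak_solutionI)
    moreover have "\<not> (AE x in lebesgue. u1 x = 0)" "\<not> (AE x in lebesgue. u2 x = 0)"
      unfolding AE_completion_iff using J_cong[OF um(1), of "\<lambda>_. 0" l] J_cong[OF um(2), of "\<lambda>_. 0" l] J_zero[of l] u(5,6) by auto
    moreover have "\<not> (AE x in lebesgue. u1 x = u2 x)"
      unfolding AE_completion_iff using J_cong[OF um, of l] u(5,6) by auto
    ultimately show "\<exists>u1 u2.
              weak_solution \<Omega> p K q r h b l u1 \<and> nonneg_nontrivial u1 \<and>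
              weak_solution \<Omega> p K q r h b l u2 \<and> nonneg_nontrivial u2 \<and>
              \<not> (AE x in lebesgue. u1 x = u2 x)"
      using u(3,4) unfolding nonneg_nontrivial_def by (intro exI[of _ u1] exI[of _ u2]) auto
  qed (use l0 in simp)
qed

end
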